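(* (i) There exists a radial $\psi\in L^2(\mathbb{R}^n)$ such that for every $1\le q<\infty$, $e^{-itH}\psi\notin L^2(\mathbb{R};L^{2^*,q}(\mathbb{R}^n))$. (ii) For every $C>0$ there exists a function $F\in L^2(\mathbb{R};L^{2_*,1}(\mathbb{R}^n))$ with $F(t)$ radial for a.e. $t$, such that $$\Big\|\int_0^te^{-i(t-s)H}F(s)ds\Big\|_{L^2(\mathbb{R};L^{2^*,\infty}(\mathbb{R}^n))}>C\|F\|_{L^2(\mathbb{R};L^{2_*,1}(\mathbb{R}^n))}.$$
   Context: $n\ge3$, $C_H=(n-2)^2/4$, $H=-\Delta-C_H|x|^{-2}$ is the Friedrichs extension on $L^2(\mathbb{R}^n)$ of the nonnegative form $\int(\nabla u\cdot\overline{\nabla v}-C_H|x|^{-2}u\bar v)dx$ on $C_0^\infty(\mathbb{R}^n)$. $2^*=2n/(n-2)$, $2_*=2n/(n+2)$; $L^{p,q}$ denotes Lorentz spaces. *)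

theory Defs
  imports "HOL-Analysis.Analysis"
begin

definition L2 :: "('a::euclidean_space \<Rightarrow> complex) \<Rightarrow> bool" where
  "L2 f \<longleftrightarrow> f \<in> borel_measurable lebesgue \<and> integrable lebesgue (\<lambda>x. (norm (f x))\<^sup>2)"

definition L2norm :: "('a::euclidean_space \<Rightarrow> complex) \<Rightarrow> real" where
  "L2norm f = sqrt (\<integral>x. (norm (f x))\<^sup>2 \<partial>lebesgue)"

definition l2inner :: "('a::euclidean_space \<Rightarrow> complex) \<Rightarrow> ('a \<Rightarrow> complex) \<Rightarrow> complex" where
  "l2inner f g = (\<integral>x. f x * cnj (g x) \<partial>lebesgue)"

definition radial :: "('a::euclidean_space \<Rightarrow> complex) \<Rightarrow> bool" where
  "radial f \<longleftrightarrow> (\<forall>x y. norm x = norm y \<longrightarrow> f x = f y)"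

primrec Ck :: "nat \<Rightarrow> ('a::euclidean_space \<Rightarrow> complex) \<Rightarrow> bool" where
  "Ck 0 f \<longleftrightarrow> continuous_on UNIV f"
| "Ck (Suc k) f \<longleftrightarrow> (\<forall>x. f differentiable (at x)) \<and>
                     (\<forall>b\<in>Basis. Ck k (\<lambda>x. frechet_derivative f (at x) b))"

definition test_fn :: "('a::euclidean_space \<Rightarrow> complex) \<Rightarrow> bool" where
  "test_fn f \<longleftrightarrow> (\<forall>k. Ck k f) \<and> compact (closure {x. f x \<noteq> 0})"

section \<open>Hardy form and its Friedrichs extension H = -Delta - C_H |x|^-2\<close>

definition C_H :: "nat \<Rightarrow> real" where
  "C_H n = (real n - 2)\<^sup>2 / 4"

definition hardy_form :: "('a::euclidean_space \<Rightarrow> complex) \<Rightarrow> ('a \<Rightarrow> complex) \<Rightarrow> complex" where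
  "hardy_form u v =
     (\<integral>x. (\<Sum>b\<in>Basis. frechet_derivative u (at x) b * cnj (frechet_derivative v (at x) b))
          - complex_of_real (C_H DIM('a) / (norm x)\<^sup>2) * u x * cnj (v x) \<partial>lebesgue)"

text \<open>hardyH u w: u lies in the domain of the Friedrichs extension H and H u = w (a.e.).
  u is in the form domain (closure of C_0^infinity in the form norm), witnessed by a sequence
  of test functions converging to u in L^2 and Cauchy for the form, and the closed form
  satisfies qbar(u,psi) = <w,psi> for all test functions psi.\<close>
definition hardyH :: "('a::euclidean_space \<Rightarrow> complex) \<Rightarrow> ('a \<Rightarrow> complex) \<Rightarrow> bool" where
  "hardyH u w \<longleftrightarrow> L2 u \<and> L2 w \<and>
     (\<exists>\<phi>::nat \<Rightarrow> 'a \<Rightarrow> complex.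
        (\<forall>k. test_fn (\<phi> k)) \<and>
        (\<lambda>k. L2norm (\<lambda>x. \<phi> k x - u x)) \<longlonglongrightarrow> 0 \<and>
        (\<forall>e>0. \<exists>N. \<forall>k\<ge>N. \<forall>l\<ge>N.
            norm (hardy_form (\<lambda>x. \<phi> k x - \<phi> l x) (\<lambda>x. \<phi> k x - \<phi> l x)) < e) \<and>
        (\<forall>\<psi>. test_fn \<psi> \<longrightarrow> (\<lambda>k. hardy_form (\<phi> k) \<psi>) \<longlonglongrightarrow> l2inner w \<psi>))"

text \<open>U is (a representative-choice of) the unitary group e^{-itH} on L^2:
  isometric, linear, U 0 = id and d/dt U(t)psi = -i H U(t) psi for psi in D(H).\<close>
definition schr_group :: "(real \<Rightarrow> ('a::euclidean_space \<Rightarrow> complex) \<Rightarrow> ('a \<Rightarrow> complex)) \<Rightarrow> bool" where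
  "schr_group U \<longleftrightarrow>
     (\<forall>t f. L2 f \<longrightarrow> L2 (U t f) \<and> L2norm (U t f) = L2norm f) \<and>
     (\<forall>t f g a. L2 f \<longrightarrow> L2 g \<longrightarrow>
        (AE x in lebesgue. U t (\<lambda>y. a * f y + g y) x = a * U t f x + U t g x)) \<and>
     (\<forall>\<psi> w. hardyH \<psi> w \<longrightarrow>
        (AE x in lebesgue. U 0 \<psi> x = \<psi> x) \<and>
        (\<forall>t. \<exists>w'. hardyH (U t \<psi>) w' \<and>
           ((\<lambda>h. L2norm (\<lambda>x. (U (t + h) \<psi> x - U t \<psi> x) / complex_of_real h + \<i> * w' x))
              \<longlongrightarrow> 0) (at 0)))"

definition epowr :: "ennreal \<Rightarrow> real \<Rightarrow> ennreal" where
  "epowr x a = (if x = top then top else ennreal (enn2real x powr a))"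

definition distrib_fn :: "('a::euclidean_space \<Rightarrow> complex) \<Rightarrow> real \<Rightarrow> ennreal" where
  "distrib_fn f lam = emeasure lebesgue {x. lam < norm (f x)}"

definition rearr :: "('a::euclidean_space \<Rightarrow> complex) \<Rightarrow> real \<Rightarrow> ennreal" where
  "rearr f s = (INF lam\<in>{lam::real. 0 \<le> lam \<and> distrib_fn f lam \<le> ennreal s}. ennreal lam)"

definition lorentz_norm :: "real \<Rightarrow> real \<Rightarrow> ('a::euclidean_space \<Rightarrow> complex) \<Rightarrow> ennreal" where
  "lorentz_norm p q f =
     epowr (\<integral>\<^sup>+ s. indicator {0<..} s *
              epowr (ennreal (s powr (1 / p)) * rearr f s) q / ennreal s \<partial>lborel) (1 / q)"

definition lorentz_weak :: "real \<Rightarrow> ('a::euclidean_space \<Rightarrow> complex) \<Rightarrow> ennreal" where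
  "lorentz_weak p f = (SUP s\<in>{0<..}. ennreal (s powr (1 / p)) * rearr f s)"

definition L2_time :: "(('a \<Rightarrow> complex) \<Rightarrow> ennreal) \<Rightarrow> (real \<Rightarrow> 'a \<Rightarrow> complex) \<Rightarrow> ennreal" where
  "L2_time N u = epowr (\<integral>\<^sup>+ t. (N (u t))\<^sup>2 \<partial>lborel) (1 / 2)"

definition upper_exp :: "nat \<Rightarrow> real" where "upper_exp n = 2 * real n / (real n - 2)"
definition lower_exp :: "nat \<Rightarrow> real" where "lower_exp n = 2 * real n / (real n + 2)"

text \<open>Weak (dual-pairing) form of G(t) = int_0^t U(t-s) F(s) ds (oriented integral)\<close>
definition duhamel :: "(real \<Rightarrow> ('a::euclidean_space \<Rightarrow> complex) \<Rightarrow> ('a \<Rightarrow> complex))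
     \<Rightarrow> (real \<Rightarrow> 'a \<Rightarrow> complex) \<Rightarrow> (real \<Rightarrow> 'a \<Rightarrow> complex) \<Rightarrow> bool" where
  "duhamel U F G \<longleftrightarrow> (\<forall>t. L2 (G t) \<and>
     (\<forall>\<phi>. L2 \<phi> \<longrightarrow> l2inner (G t) \<phi> = (LBINT s=0..t. l2inner (U (t - s) (F s)) \<phi>)))"

end

theory Submission
  imports Defs
begin

text \<open>Write \<open>c = (n - 2) / 2\<close>. On radial functions \<open>u = |x|\<^sup>-\<^sup>c f\<close> the operator \<open>H\<close> acts on \<open>f\<close> as minus the
  Laplacian of the plane, so the planar heat kernel at complex time gives the explicit solution
  \<open>z |x|\<^sup>-\<^sup>c exp (- z |x|\<^sup>2)\<close> with \<open>z = 1 / (1 + 4 i t)\<close>. It lies in the domain of \<open>H\<close> at all times, and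
  symmetry of \<open>H\<close> together with the isometry property of \<open>U\<close> forces \<open>U\<close> to follow it.

  Near the origin this solution has size \<open>|x|\<^sup>-\<^sup>c\<close>, which belongs to the weak Lorentz space of exponent
  \<open>2n / (n - 2)\<close> but to none of the spaces with finite second index; hence its norm is infinite at every
  time. For the inhomogeneous estimate take as source the Gaussian profile itself on \<open>[0, T]\<close>: the
  coefficient of \<open>|x|\<^sup>-\<^sup>c\<close> in the Duhamel integral is close to the integral of \<open>1 / (1 + 4 i s)\<close> over
  \<open>[0, t]\<close>, whose imaginary part grows like \<open>ln t\<close>, while both norms otherwise scale like
  \<open>sqrt T\<close>.\<close>

section \<open>Square-integrable functions\<close>

text \<open>The group \<open>U\<close> is available only through the properties listed in
  \<open>schr_group\<close>, so nothing can be computed from a functional calculus, and the explicit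
  curve has to be placed by hand in the domain described by \<open>hardyH\<close>. The obstacle is
  that near the origin the curve behaves like |x|^-c, for which the gradient term and the Hardy term
  of the form both diverge, like the integral of |x|^-n; only their combination is finite. Hence the
  form is rewritten as a sum of squares of first-order expressions that annihilate |x|^-c, and the
  approximating test functions come from a cutoff in ln |x|. The value z = 1 / (1 + 4 i t) is
  forced: \<open>H\<close> multiplies the profile by 4 z (1 - z |x|^2), while differentiation in z
  multiplies it by 1/z - |x|^2, so the Schroedinger equation becomes z' = - 4 i z^2 with z = 1 at
  time 0. The Duhamel integral is known only through pairings, so a pointwise lower bound for it is
  obtained by testing with the indicator of the set on which that bound could fail.\<close>

lemma L2_measurable: "L2 f \<Longrightarrow> f \<in> borel_measurable lebesgue"
  by (simp add: L2_def)

lemma L2_integrable: "L2 f \<Longrightarrow> integrable lebesgue (\<lambda>x. (norm (f x))\<^sup>2)"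
  by (simp add: L2_def)

lemma L2norm_nonneg [simp]: "L2norm f \<ge> 0"
  by (simp add: L2norm_def)

lemma L2norm_square: "(L2norm f)\<^sup>2 = (\<integral>x. (norm (f x))\<^sup>2 \<partial>lebesgue)"
  by (simp add: L2norm_def)

lemma L2I_bound:
  assumes "f \<in> borel_measurable lebesgue" "integrable lebesgue h"
    and "AE x in lebesgue. (norm (f x))\<^sup>2 \<le> h x"
  shows "L2 f"
  unfolding L2_def
proof (intro conjI assms(1))
  show "integrable lebesgue (\<lambda>x. (norm (f x))\<^sup>2)"
    by (rule Bochner_Integration.integrable_bound[OF assms(2)])
      (use assms in \<open>auto elim!: eventually_mono\<close>)
qed

lemma L2_cmult [intro]: "L2 f \<Longrightarrow> L2 (\<lambda>x. a * f x)"
  by (auto simp: L2_def norm_mult power_mult_distrib)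

lemma L2_zero [simp]: "L2 (\<lambda>x. 0)"
  by (simp add: L2_def)

lemma L2_uminus [intro]: "L2 f \<Longrightarrow> L2 (\<lambda>x. - f x)"
  by (auto simp: L2_def)

lemma norm_add_square_le: "(norm (x + y))\<^sup>2 \<le> 2 * (norm x)\<^sup>2 + 2 * (norm (y::'b::real_normed_vector))\<^sup>2"
proof -
  have "(norm (x + y))\<^sup>2 \<le> (norm x + norm y)\<^sup>2"
    by (intro power_mono norm_triangle_ineq) auto
  also have "\<dots> \<le> 2 * (norm x)\<^sup>2 + 2 * (norm y)\<^sup>2"
    using sum_squares_bound[of "norm x" "norm y"] by (simp add: power2_sum)
  finally show ?thesis .
qed

lemma L2_add [intro]:
  assumes "L2 f" "L2 g" shows "L2 (\<lambda>x. f x + g x)"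
proof (rule L2I_bound)
  show "integrable lebesgue (\<lambda>x. 2 * (norm (f x))\<^sup>2 + 2 * (norm (g x))\<^sup>2)"
    using assms by (auto simp: L2_def)
qed (use assms norm_add_square_le in \<open>auto simp: L2_def\<close>)

lemma L2_diff [intro]: "L2 f \<Longrightarrow> L2 g \<Longrightarrow> L2 (\<lambda>x. f x - g x)"
  using L2_add[of f "\<lambda>x. - g x"] L2_uminus[of g] by simp

lemma L2_norm_mult_integrable:
  assumes "L2 f" "L2 g" shows "integrable lebesgue (\<lambda>x. norm (f x) * norm (g x))"
proof (rule Bochner_Integration.integrable_bound)
  show "integrable lebesgue (\<lambda>x. (norm (f x))\<^sup>2 + (norm (g x))\<^sup>2)"
    using assms by (auto simp: L2_def)
  have [measurable]: "f \<in> borel_measurable lebesgue" "g \<in> borel_measurable lebesgue"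
    using assms by (auto simp: L2_def)
  show "(\<lambda>x. norm (f x) * norm (g x)) \<in> borel_measurable lebesgue"
    by measurable
  have "norm (f x) * norm (g x) \<le> (norm (f x))\<^sup>2 + (norm (g x))\<^sup>2" for x
    using sum_squares_bound[of "norm (f x)" "norm (g x)"]
      mult_nonneg_nonneg[OF norm_ge_zero norm_ge_zero, of "f x" "g x"] by linarith
  then show "AE x in lebesgue. norm (norm (f x) * norm (g x)) \<le> norm ((norm (f x))\<^sup>2 + (norm (g x))\<^sup>2)"
    by simp
qed

lemma L2_mult_integrable:
  assumes "L2 f" "L2 g" shows "integrable lebesgue (\<lambda>x. f x * cnj (g x))"
proof (rule Bochner_Integration.integrable_bound[OF L2_norm_mult_integrable[OF assms]])
  have [measurable]: "f \<in> borel_measurable lebesgue" "g \<in> borel_measurable lebesgue"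
    using assms by (auto simp: L2_def)
  have "cnj \<in> borel_measurable borel"
    by (intro borel_measurable_continuous_onI continuous_intros)
  from measurable_compose[OF _ this, of g lebesgue]
  show "(\<lambda>x. f x * cnj (g x)) \<in> borel_measurable lebesgue"
    by measurable
qed (simp add: norm_mult)

lemma norm_l2inner_le:
  assumes "L2 f" "L2 g" shows "norm (l2inner f g) \<le> L2norm f * L2norm g"
proof -
  have [measurable]: "f \<in> borel_measurable lebesgue" "g \<in> borel_measurable lebesgue"
    using assms by (auto simp: L2_def)
  let ?I = "\<integral>x. norm (f x) * norm (g x) \<partial>lebesgue"
  have "norm (l2inner f g) \<le> ?I"
    unfolding l2inner_def
    by (rule order_trans[OF integral_norm_bound]) (simp add: norm_mult)
  moreover have "?I \<le> L2norm f * L2norm g"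
  proof (rule power2_le_imp_le)
    \<comment> \<open>Cauchy-Schwarz is applied to extended nonnegative integrals; the finiteness of
      all three integrals then brings it back to the reals.\<close>
    have "(\<integral>\<^sup>+x. ennreal (norm (f x)) * ennreal (norm (g x)) \<partial>lebesgue)\<^sup>2 \<le>
        (\<integral>\<^sup>+x. (ennreal (norm (f x)))\<^sup>2 \<partial>lebesgue) * (\<integral>\<^sup>+x. (ennreal (norm (g x)))\<^sup>2 \<partial>lebesgue)"
      by (rule Cauchy_Schwarz_nn_integral) auto
    moreover have "(\<integral>\<^sup>+x. ennreal (norm (f x)) * ennreal (norm (g x)) \<partial>lebesgue) = ennreal ?I"
      using L2_norm_mult_integrable[OF assms]
      by (subst nn_integral_eq_integral[symmetric]) (auto simp: ennreal_mult)
    moreover have sq: "(\<integral>\<^sup>+x. (ennreal (norm (h x)))\<^sup>2 \<partial>lebesgue) = ennreal ((L2norm h)\<^sup>2)"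
      if "L2 h" for h :: "'a \<Rightarrow> complex"
      using L2_integrable[OF that] unfolding L2norm_square
      by (subst nn_integral_eq_integral[symmetric]) (auto simp: ennreal_power)
    ultimately have "(ennreal ?I)\<^sup>2 \<le> ennreal ((L2norm f)\<^sup>2) * ennreal ((L2norm g)\<^sup>2)"
      by (simp only: sq[OF assms(1)] sq[OF assms(2)])
    then have "ennreal (?I\<^sup>2) \<le> ennreal ((L2norm f)\<^sup>2 * (L2norm g)\<^sup>2)"
      by (simp add: ennreal_power ennreal_mult)
    then show "?I\<^sup>2 \<le> (L2norm f * L2norm g)\<^sup>2"
      by (simp add: power_mult_distrib)
  qed simp
  ultimately show ?thesis by linarith
qed

lemma l2inner_add_left: "L2 f \<Longrightarrow> L2 g \<Longrightarrow> L2 h \<Longrightarrow> l2inner (\<lambda>x. f x + g x) h = l2inner f h + l2inner g h"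
  unfolding l2inner_def distrib_right
  by (rule Bochner_Integration.integral_add) (auto intro: L2_mult_integrable)

lemma l2inner_diff_left: "L2 f \<Longrightarrow> L2 g \<Longrightarrow> L2 h \<Longrightarrow> l2inner (\<lambda>x. f x - g x) h = l2inner f h - l2inner g h"
  unfolding l2inner_def left_diff_distrib
  by (rule Bochner_Integration.integral_diff) (auto intro: L2_mult_integrable)

lemma l2inner_cmult_left: "l2inner (\<lambda>x. a * f x) h = a * l2inner f h"
  unfolding l2inner_def by (simp add: mult.assoc)

lemma l2inner_commute: "l2inner g f = cnj (l2inner f g)"
proof -
  have "(\<lambda>x. g x * cnj (f x)) = (\<lambda>x. cnj (f x * cnj (g x)))"
    by (simp add: mult.commute)
  then show ?thesis
    by (simp only: l2inner_def Bochner_Integration.integral_cnj)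
qed

lemma l2inner_cmult_right: "l2inner f (\<lambda>x. a * g x) = cnj a * l2inner f g"
  by (subst (1 2) l2inner_commute) (simp add: l2inner_cmult_left)

lemma l2inner_add_right: "L2 f \<Longrightarrow> L2 g \<Longrightarrow> L2 h \<Longrightarrow> l2inner h (\<lambda>x. f x + g x) = l2inner h f + l2inner h g"
  by (subst (1 2 3) l2inner_commute) (simp add: l2inner_add_left)

lemma l2inner_diff_right: "L2 f \<Longrightarrow> L2 g \<Longrightarrow> L2 h \<Longrightarrow> l2inner h (\<lambda>x. f x - g x) = l2inner h f - l2inner h g"
  by (subst (1 2 3) l2inner_commute) (simp add: l2inner_diff_left)

lemma l2inner_self: "l2inner f f = complex_of_real ((L2norm f)\<^sup>2)"
  unfolding l2inner_def L2norm_square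
  by (subst integral_complex_of_real[symmetric]) (simp only: complex_norm_square)

lemma L2norm_triangle:
  assumes "L2 f" "L2 g" shows "L2norm (\<lambda>x. f x + g x) \<le> L2norm f + L2norm g"
proof (rule power2_le_imp_le)
  have fg: "L2 (\<lambda>x. f x + g x)" using assms by auto
  have "complex_of_real ((L2norm (\<lambda>x. f x + g x))\<^sup>2) = l2inner f f + l2inner g g + (l2inner f g + cnj (l2inner f g))"
    unfolding l2inner_self[symmetric]
    by (subst l2inner_add_left[OF assms fg], subst l2inner_add_right[OF assms assms(1)],
        subst l2inner_add_right[OF assms assms(2)]) (simp add: l2inner_commute[of g f])
  then have "(L2norm (\<lambda>x. f x + g x))\<^sup>2 = Re (l2inner f f + l2inner g g + (l2inner f g + cnj (l2inner f g)))"
    by (metis Re_complex_of_real)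
  also have "\<dots> = (L2norm f)\<^sup>2 + (L2norm g)\<^sup>2 + 2 * Re (l2inner f g)"
    by (simp add: l2inner_self)
  also have "Re (l2inner f g) \<le> L2norm f * L2norm g"
    using norm_l2inner_le[OF assms] complex_Re_le_cmod order_trans by blast
  finally show "(L2norm (\<lambda>x. f x + g x))\<^sup>2 \<le> (L2norm f + L2norm g)\<^sup>2"
    by (simp add: power2_sum)
qed simp

lemma L2norm_cmult: "L2norm (\<lambda>x. a * f x) = norm a * L2norm f"
  by (simp add: L2norm_def norm_mult power_mult_distrib real_sqrt_mult)

lemma L2norm_minus_commute: "L2norm (\<lambda>x. f x - g x) = L2norm (\<lambda>x. g x - f x)"
  by (simp add: L2norm_def norm_minus_commute)

lemma L2norm_le_diff:
  assumes "L2 f" "L2 g" shows "L2norm f \<le> L2norm (\<lambda>x. f x - g x) + L2norm g"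
  using L2norm_triangle[of "\<lambda>x. f x - g x" g] assms by auto

lemma L2norm_cong_AE:
  assumes "L2 f" "L2 g" "AE x in lebesgue. f x = g x" shows "L2norm f = L2norm g"
  unfolding L2norm_def
  by (intro arg_cong[where f = sqrt] integral_cong_AE)
    (use assms L2_integrable[THEN borel_measurable_integrable] in \<open>auto elim!: eventually_mono\<close>)

lemma l2inner_cong_AE:
  assumes "L2 f" "L2 g" "L2 h" "AE x in lebesgue. f x = g x" shows "l2inner f h = l2inner g h"
  unfolding l2inner_def
  by (intro integral_cong_AE borel_measurable_integrable L2_mult_integrable)
    (use assms in \<open>auto elim!: eventually_mono\<close>)

lemma l2inner_tendsto:
  assumes "\<And>k. L2 (f k)" "L2 g" "L2 h" "((\<lambda>k. L2norm (\<lambda>x. f k x - g x)) \<longlongrightarrow> 0) F"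
  shows "((\<lambda>k. l2inner (f k) h) \<longlongrightarrow> l2inner g h) F"
proof (rule Lim_transform_bound[where g = "\<lambda>k. L2norm (\<lambda>x. f k x - g x) * L2norm h",
      THEN LIM_zero_cancel])
  have "norm (l2inner (f k) h - l2inner g h) \<le> norm (L2norm (\<lambda>x. f k x - g x) * L2norm h)" for k
    using norm_l2inner_le[of "\<lambda>x. f k x - g x" h] assms(1)[of k] assms(2,3)
    by (subst l2inner_diff_left[symmetric]) auto
  then show "\<forall>\<^sub>F k in F. norm (l2inner (f k) h - l2inner g h) \<le> norm (L2norm (\<lambda>x. f k x - g x) * L2norm h)"
    by simp
  show "((\<lambda>k. L2norm (\<lambda>x. f k x - g x) * L2norm h) \<longlongrightarrow> 0) F"
    by (rule tendsto_mult_left_zero[OF assms(4)])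
qed

lemma l2inner_tendsto_right:
  assumes "\<And>k. L2 (f k)" "L2 g" "L2 h" "((\<lambda>k. L2norm (\<lambda>x. f k x - g x)) \<longlongrightarrow> 0) F"
  shows "((\<lambda>k. l2inner h (f k)) \<longlongrightarrow> l2inner h g) F"
  using tendsto_cnj[OF l2inner_tendsto[OF assms]] by (simp flip: l2inner_commute)

lemma L2norm_tendsto_0_dominated:
  fixes f :: "nat \<Rightarrow> 'a::euclidean_space \<Rightarrow> complex"
  assumes "\<And>k. f k \<in> borel_measurable lebesgue" "integrable lebesgue h"
    and "\<And>k. AE x in lebesgue. (norm (f k x))\<^sup>2 \<le> h x"
    and "AE x in lebesgue. (\<lambda>k. f k x) \<longlonglongrightarrow> 0"
  shows "(\<lambda>k. L2norm (f k)) \<longlonglongrightarrow> 0"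
proof -
  have "(\<lambda>k. \<integral>x. (norm (f k x))\<^sup>2 \<partial>lebesgue) \<longlonglongrightarrow> (\<integral>x. 0 \<partial>(lebesgue::'a measure))"
  proof (rule integral_dominated_convergence[where w = h])
    show "AE x in lebesgue. (\<lambda>k. (norm (f k x))\<^sup>2) \<longlonglongrightarrow> 0"
      using assms(4) by eventually_elim (use tendsto_power[OF tendsto_norm, where n = 2] in force)
  qed (use assms in auto)
  then show ?thesis
    unfolding L2norm_def using tendsto_real_sqrt by fastforce
qed

lemma L2_diff_zero_imp_AE_eq:
  assumes "L2 f" "L2 g" "L2norm (\<lambda>x. f x - g x) = 0" shows "AE x in lebesgue. f x = g x"
proof -
  have "L2 (\<lambda>x. f x - g x)" using assms by auto
  then have "AE x in lebesgue. (norm (f x - g x))\<^sup>2 = 0"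
    using integral_nonneg_eq_0_iff_AE[of lebesgue "\<lambda>x. (norm (f x - g x))\<^sup>2"] assms(3)
    by (auto simp: L2norm_def L2_def)
  then show ?thesis by simp
qed

section \<open>Radial integrals\<close>

abbreviation sphere_vol :: "'a::euclidean_space itself \<Rightarrow> real" where
  "sphere_vol _ \<equiv> real DIM('a) * unit_ball_vol (real DIM('a))"

text \<open>Polar coordinates without a surface measure: both measures give \<open>{..a}\<close> the
  volume of a ball of radius a, on the right because n V r^(n-1) is the derivative of V r^n, and
  half-lines form an intersection-stable generator.\<close>

lemma distr_norm_lborel:
  "distr lborel borel (norm :: 'a::euclidean_space \<Rightarrow> real) =
   density lborel (\<lambda>r. ennreal (sphere_vol TYPE('a) * r ^ (DIM('a) - 1)) * indicator {0..} r)"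
    (is "?M = ?N")
proof -
  let ?V = "unit_ball_vol (real DIM('a))" and ?n = "DIM('a)"
  have V: "?V > 0" by simp
  have M: "emeasure ?M {..a} = ennreal (if a < 0 then 0 else ?V * a ^ ?n)" for a
  proof -
    have "emeasure ?M {..a} = emeasure lborel {x::'a. norm x \<le> a}"
      by (subst emeasure_distr) (auto simp: vimage_def)
    also have "{x::'a. norm x \<le> a} = (if a < 0 then {} else cball 0 a)"
      by (auto, meson norm_ge_zero not_less order_trans)
    finally show ?thesis
      by (auto simp: emeasure_cball)
  qed
  have N: "emeasure ?N {..a} = ennreal (if a < 0 then 0 else ?V * a ^ ?n)" for a
  proof -
    have eq: "emeasure ?N {..a} =
        (\<integral>\<^sup>+r. ennreal (real ?n * ?V * r ^ (?n - 1)) * indicator {0..a} r \<partial>lborel)"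
      by (subst emeasure_density) (auto intro!: nn_integral_cong simp: indicator_def)
    show ?thesis
    proof (cases "a < 0")
      case True
      then show ?thesis unfolding eq by auto
    next
      case False
      have "(\<integral>\<^sup>+r. ennreal (real ?n * ?V * r ^ (?n - 1)) * indicator {0..a} r \<partial>lborel)
          = ?V * a ^ ?n - ?V * 0 ^ ?n"
        by (rule nn_integral_FTC_Icc)
          (use False V in \<open>auto intro!: derivative_eq_intros mult_nonneg_nonneg\<close>)
      with False show ?thesis unfolding eq by simp
    qed
  qed
  show ?thesis
  proof (rule measure_eqI_generator_eq[where E = "range (\<lambda>a::real. {..a})" and \<Omega> = UNIV
        and A = "\<lambda>i. {..real i}"])
    show "Int_stable (range (\<lambda>a::real. {..a}))"
      by (auto simp: Int_stable_def)
    show "(\<Union>i. {..real i}) = UNIV"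
      using real_arch_simple by auto
    show "sets ?M = sigma_sets UNIV (range (\<lambda>a::real. {..a}))"
      by (simp add: borel_eq_atMost)
    show "sets ?N = sigma_sets UNIV (range (\<lambda>a::real. {..a}))"
      by (simp add: borel_eq_atMost)
    show "emeasure ?M {..real i} \<noteq> \<infinity>" for i
      unfolding M by simp
    show "emeasure ?M X = emeasure ?N X" if "X \<in> range (\<lambda>a::real. {..a})" for X
      using that by (auto simp only: M N)
  qed auto
qed

lemma nn_integral_radial:
  fixes h :: "real \<Rightarrow> ennreal"
  assumes [measurable]: "h \<in> borel_measurable borel"
  shows "(\<integral>\<^sup>+x. h (norm (x::'a::euclidean_space)) \<partial>lebesgue) =
    ennreal (sphere_vol TYPE('a)) * (\<integral>\<^sup>+r. ennreal (r ^ (DIM('a) - 1)) * indicator {0..} r * h r \<partial>lborel)"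
proof -
  have "(\<integral>\<^sup>+x. h (norm (x::'a::euclidean_space)) \<partial>lebesgue) = (\<integral>\<^sup>+r. h r \<partial>distr lborel borel (norm :: 'a \<Rightarrow> real))"
    by (simp add: nn_integral_distr nn_integral_completion)
  also have "\<dots> = (\<integral>\<^sup>+r. ennreal (sphere_vol TYPE('a)) * (ennreal (r ^ (DIM('a) - 1)) * indicator {0..} r * h r) \<partial>lborel)"
    unfolding distr_norm_lborel
    by (subst nn_integral_density)
      (auto intro!: nn_integral_cong simp: indicator_def ennreal_mult ac_simps)
  finally show ?thesis
    by (simp add: nn_integral_cmult)
qed

lemma integrable_radial:
  fixes h :: "real \<Rightarrow> real"
  assumes [measurable]: "h \<in> borel_measurable borel"
    and "(\<integral>\<^sup>+r. ennreal (r ^ (DIM('a) - 1)) * indicator {0..} r * ennreal (norm (h r)) \<partial>lborel) < \<infinity>"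
  shows "integrable lebesgue (\<lambda>x::'a::euclidean_space. h (norm x))"
proof (rule integrableI_bounded)
  show "(\<lambda>x::'a. h (norm x)) \<in> borel_measurable lebesgue"
    by (rule measurable_completion) measurable
  show "(\<integral>\<^sup>+x. ennreal (norm (h (norm (x::'a)))) \<partial>lebesgue) < \<infinity>"
    using assms(2)
    by (subst nn_integral_radial[of "\<lambda>r. ennreal (norm (h r))"])
       (auto simp: ennreal_mult_less_top)
qed

lemma power_pred_mult_powr:
  assumes "DIM('a::euclidean_space) = n" "(r::real) > 0"
  shows "r ^ (n - 1) * r powr e = r powr (real n - 1 + e)"
proof -
  have "n > 0" using assms by (metis DIM_positive)
  then show ?thesis
    using assms by (simp add: powr_add powr_realpow of_nat_diff flip: powr_realpow)
qed

lemma integrable_radial_powr_near: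
  assumes "a < real DIM('a)" "R \<ge> 0"
  shows "integrable lebesgue (\<lambda>x::'a::euclidean_space. norm x powr (-a) * indicator {..R} (norm x))"
proof (rule integrable_radial[of "\<lambda>r. r powr (-a) * indicator {..R} r"])
  let ?e = "real DIM('a) - 1 - a"
  have "(\<integral>\<^sup>+r. ennreal (r ^ (DIM('a) - 1)) * indicator {0..} r * ennreal (norm (r powr (-a) * indicator {..R} r)) \<partial>lborel)
      = (\<integral>\<^sup>+r. ennreal (r powr ?e) * indicator {0..R} r \<partial>lborel)"
  proof (rule nn_integral_cong)
    fix r :: real
    show "ennreal (r ^ (DIM('a) - 1)) * indicator {0..} r * ennreal (norm (r powr (-a) * indicator {..R} r))
       = ennreal (r powr ?e) * indicator {0..R} r"
      using power_pred_mult_powr[where 'a = 'a, OF refl, of r "-a"]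
      by (cases "r > 0"; cases "r = 0") (auto simp: indicator_def ennreal_mult[symmetric])
  qed
  also have "\<dots> < \<infinity>"
    using nn_integral_has_integral_lebesgue'[OF _ has_integral_powr_from_0[of ?e R]] assms by simp
  finally show "(\<integral>\<^sup>+r. ennreal (r ^ (DIM('a) - 1)) * indicator {0..} r * ennreal (norm (r powr (-a) * indicator {..R} r)) \<partial>lborel) < \<infinity>" .
qed measurable

lemma integrable_radial_powr_far:
  assumes "b > real DIM('a)" "R > 0"
  shows "integrable lebesgue (\<lambda>x::'a::euclidean_space. norm x powr (-b) * indicator {R..} (norm x))"
proof (rule integrable_radial[of "\<lambda>r. r powr (-b) * indicator {R..} r"])
  let ?e = "real DIM('a) - 1 - b"
  have "(\<integral>\<^sup>+r. ennreal (r ^ (DIM('a) - 1)) * indicator {0..} r * ennreal (norm (r powr (-b) * indicator {R..} r)) \<partial>lborel)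
      = (\<integral>\<^sup>+r. ennreal (r powr ?e) * indicator {R..} r \<partial>lborel)"
  proof (rule nn_integral_cong)
    fix r :: real
    show "ennreal (r ^ (DIM('a) - 1)) * indicator {0..} r * ennreal (norm (r powr (-b) * indicator {R..} r))
       = ennreal (r powr ?e) * indicator {R..} r"
      using power_pred_mult_powr[where 'a = 'a, OF refl, of r "-b"] assms(2)
      by (cases "r > 0") (auto simp: indicator_def ennreal_mult[symmetric])
  qed
  also have "\<dots> < \<infinity>"
    using nn_integral_has_integral_lebesgue'[OF _ has_integral_powr_to_inf[of ?e R]] assms by simp
  finally show "(\<integral>\<^sup>+r. ennreal (r ^ (DIM('a) - 1)) * indicator {0..} r * ennreal (norm (r powr (-b) * indicator {R..} r)) \<partial>lborel) < \<infinity>" .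
qed measurable

lemma integrable_radial_bound:
  fixes f :: "'a::euclidean_space \<Rightarrow> 'b::{banach,second_countable_topology}"
  assumes "f \<in> borel_measurable lebesgue" "a < real DIM('a)" "b > real DIM('a)"
    and "\<And>x. x \<noteq> 0 \<Longrightarrow> norm x \<le> 1 \<Longrightarrow> norm (f x) \<le> K * norm x powr (-a)"
    and "\<And>x. norm x \<ge> 1 \<Longrightarrow> norm (f x) \<le> L * norm x powr (-b)"
  shows "integrable lebesgue f"
proof (rule Bochner_Integration.integrable_bound)
  let ?h = "\<lambda>x::'a. K * (norm x powr (-a) * indicator {..1} (norm x)) + L * (norm x powr (-b) * indicator {1..} (norm x))"
  show "integrable lebesgue ?h"
    by (intro Bochner_Integration.integrable_add integrable_mult_right integrable_radial_powr_near
        integrable_radial_powr_far) (use assms in auto)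
  \<comment> \<open>A basis vector has norm 1, so both growth hypotheses apply to it and force the
    two constants to be nonnegative.\<close>
  have "K \<ge> 0" "L \<ge> 0"
  proof -
    obtain b0 :: 'a where "b0 \<in> Basis" using nonempty_Basis by blast
    then have "norm b0 = 1" "b0 \<noteq> 0" by auto
    then show "K \<ge> 0" "L \<ge> 0"
      using order_trans[OF norm_ge_zero assms(4)[of b0]] order_trans[OF norm_ge_zero assms(5)[of b0]] by auto
  qed
  then have "norm (f x) \<le> norm (?h x)" if "x \<noteq> 0" for x
    using assms(4)[OF that] assms(5)[of x] by (cases "norm x < 1"; cases "norm x = 1") auto
  moreover have "AE x in lebesgue. x \<noteq> (0::'a)"
    by (rule AE_I[where N = "{0}"]) auto
  ultimately show "AE x in lebesgue. norm (f x) \<le> norm (?h x)"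
    by (auto elim!: eventually_mono)
qed (rule assms(1))

lemma integral_scaleR_lborel:
  fixes g :: "'a::euclidean_space \<Rightarrow> 'b::{banach,second_countable_topology}"
  assumes [measurable]: "g \<in> borel_measurable borel" and "l > 0" and g: "integrable lborel g"
  shows "integrable lborel (\<lambda>x. g (l *\<^sub>R x))"
    "(\<integral>x. g (l *\<^sub>R x) \<partial>lborel) = inverse (l ^ DIM('a)) *\<^sub>R (\<integral>x. g x \<partial>lborel)"
proof -
  let ?D = "density (distr lborel borel (\<lambda>x::'a. 0 + l *\<^sub>R x)) (\<lambda>_. ennreal (\<bar>l\<bar> ^ DIM('a)))"
  have D: "(lborel::'a measure) = ?D"
    by (rule lborel_affine) (use \<open>l > 0\<close> in simp)
  have "integrable ?D g"
    using g by (subst D[symmetric])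
  then have "integrable lborel (\<lambda>x. (\<bar>l\<bar> ^ DIM('a)) *\<^sub>R g (l *\<^sub>R x))"
    by (subst (asm) integrable_density) (auto simp: integrable_distr_eq)
  then have "integrable lborel (\<lambda>x. inverse (\<bar>l\<bar> ^ DIM('a)) *\<^sub>R ((\<bar>l\<bar> ^ DIM('a)) *\<^sub>R g (l *\<^sub>R x)))"
    by (rule integrable_scaleR_right)
  then show *: "integrable lborel (\<lambda>x. g (l *\<^sub>R x))"
    using \<open>l > 0\<close> by simp
  have "(\<integral>x. g x \<partial>lborel) = (\<integral>x. g x \<partial>?D)"
    by (subst D[symmetric]) (rule refl)
  also have "\<dots> = (\<integral>x. (\<bar>l\<bar> ^ DIM('a)) *\<^sub>R g (l *\<^sub>R x) \<partial>lborel)"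
    by (subst integral_density) (auto simp: integral_distr)
  finally show "(\<integral>x. g (l *\<^sub>R x) \<partial>lborel) = inverse (l ^ DIM('a)) *\<^sub>R (\<integral>x. g x \<partial>lborel)"
    using \<open>l > 0\<close> by simp
qed

lemma has_vector_derivative_imp_tendsto:
  assumes "(f has_vector_derivative D) (at x)"
  shows "((\<lambda>y. (f y - f x) /\<^sub>R (y - x)) \<longlongrightarrow> D) (at x)"
proof (rule LIM_zero_cancel, rule tendsto_norm_zero_cancel)
  have eq: "norm (f y - f x - (y - x) *\<^sub>R D) / norm (y - x) = norm ((f y - f x) /\<^sub>R (y - x) - D)"
    if "y \<noteq> x" for y
  proof -
    have "f y - f x - (y - x) *\<^sub>R D = (y - x) *\<^sub>R ((f y - f x) /\<^sub>R (y - x) - D)"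
      using that by (simp add: scaleR_diff_right)
    then show ?thesis
      using that by simp
  qed
  have "((\<lambda>y. norm (f y - f x - (y - x) *\<^sub>R D) / norm (y - x)) \<longlongrightarrow> 0) (at x)"
    using assms by (auto simp: has_vector_derivative_def has_derivative_iff_norm)
  then show "((\<lambda>y. norm ((f y - f x) /\<^sub>R (y - x) - D)) \<longlongrightarrow> 0) (at x)"
    by (rule Lim_transform_eventually) (use eq in \<open>auto simp: eventually_at_filter\<close>)
qed

text \<open>Differentiating the scaling identity for the integral of \<^term>\<open>g (l *\<^sub>R x)\<close>
  at \<open>l = 1\<close> gives the divergence theorem for the vector field \<open>x g(x)\<close>, with a
  singularity of \<open>g\<close> at the origin allowed.\<close>

lemma integral_radial_derivative:
  fixes g e :: "'a::euclidean_space \<Rightarrow> complex"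
  assumes [measurable]: "g \<in> borel_measurable borel" "e \<in> borel_measurable borel"
    and deriv: "\<And>x. x \<noteq> 0 \<Longrightarrow> ((\<lambda>l. g (l *\<^sub>R x)) has_vector_derivative e x) (at 1)"
    and a: "0 \<le> a" "a < real DIM('a)" and R: "R \<ge> 0"
    and g_bound: "\<And>x. x \<noteq> 0 \<Longrightarrow> norm (g x) \<le> K * (norm x powr (-a) * indicator {..R} (norm x))"
    and e_bound: "\<And>x. x \<noteq> 0 \<Longrightarrow> norm (e x) \<le> K * (norm x powr (-a) * indicator {..R} (norm x))"
  shows "integrable lebesgue g" "integrable lebesgue e"
    "(\<integral>x. e x \<partial>lebesgue) = - of_nat DIM('a) * (\<integral>x. g x \<partial>lebesgue)"
proof -
  let ?h = "\<lambda>x::'a. K * (norm x powr (-a) * indicator {..R} (norm x))"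
  have h: "integrable lborel ?h"
    using integrable_radial_powr_near[OF a(2) R] by (simp add: integrable_completion)
  have nz: "AE x in lborel. x \<noteq> (0::'a)"
    by (rule AE_lborel_singleton)
  have h0: "?h x \<ge> 0" if "x \<noteq> 0" for x
    using g_bound[OF that] norm_ge_zero order_trans by blast
  have ig: "integrable lborel g" and ie: "integrable lborel e"
    by (auto intro!: Bochner_Integration.integrable_bound[OF h] eventually_mono[OF nz] order_trans[OF g_bound]
        order_trans[OF e_bound])
  then show "integrable lebesgue g" "integrable lebesgue e"
    by (simp_all add: integrable_completion)
  \<comment> \<open>Dominated convergence wants a sequence of dilation factors. Factors above 1 move
    points outwards, where the majorant \<open>?h\<close> can only decrease, so that a single
    majorant serves all the difference quotients.\<close>
  define l :: "nat \<Rightarrow> real" where "l k = 1 + 1 / real (Suc k)" for k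
  have l1: "l k > 1" for k by (simp add: l_def)
  have llim: "l \<longlonglongrightarrow> 1"
    unfolding l_def using tendsto_add[OF tendsto_const LIMSEQ_inverse_real_of_nat, of 1]
    by (simp add: inverse_eq_divide)
  define q where "q k x = (g (l k *\<^sub>R x) - g x) /\<^sub>R (l k - 1)" for k x
  have [measurable]: "q k \<in> borel_measurable borel" for k
    unfolding q_def by measurable
  \<comment> \<open>The hypothesis speaks only of the dilation factor 1; applied to the point t x it
    gives the derivative at the factor t, at the cost of 1/t.\<close>
  have deriv': "((\<lambda>m. g (m *\<^sub>R x)) has_vector_derivative e (t *\<^sub>R x) /\<^sub>R t) (at t)"
    if "x \<noteq> 0" "t > 0" for x t
  proof -
    have "((\<lambda>m. g (m *\<^sub>R (t *\<^sub>R x))) has_vector_derivative e (t *\<^sub>R x)) (at (t / t))"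
      using deriv[of "t *\<^sub>R x"] that by simp
    moreover have "((\<lambda>m. m / t) has_vector_derivative 1 / t) (at t)"
      by (auto intro!: derivative_eq_intros)
    ultimately have "((\<lambda>m. g (m *\<^sub>R (t *\<^sub>R x))) \<circ> (\<lambda>m. m / t) has_vector_derivative (1 / t) *\<^sub>R e (t *\<^sub>R x)) (at t)"
      by (intro vector_diff_chain_at) auto
    then show ?thesis
      using that by (simp add: o_def divide_inverse[of 1])
  qed
  have q_bound: "norm (q k x) \<le> ?h x" if x: "x \<noteq> 0" for k x
  proof -
    have "norm (g (l k *\<^sub>R x) - g (1 *\<^sub>R x)) \<le> ?h x * norm (l k - 1)"
    proof (rule differentiable_bound[where S = "{1..l k}" and f' = "\<lambda>t s. s *\<^sub>R (e (t *\<^sub>R x) /\<^sub>R t)"])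
      fix t assume t: "t \<in> {1..l k}"
      show "((\<lambda>m. g (m *\<^sub>R x)) has_derivative (\<lambda>s. s *\<^sub>R (e (t *\<^sub>R x) /\<^sub>R t))) (at t within {1..l k})"
        using deriv'[OF x, of t] t by (auto simp: has_vector_derivative_def intro: has_derivative_at_withinI)
      have K: "K * indicator {..R} (norm x) \<ge> 0"
        using h0[OF x] x by (auto simp: zero_le_mult_iff indicator_def)
      have "norm (e (t *\<^sub>R x) /\<^sub>R t) \<le> norm (e (t *\<^sub>R x))"
        using t mult_right_mono[of 1 t "norm (e (t *\<^sub>R x))"] by (auto simp: field_simps)
      also have "\<dots> \<le> ?h (t *\<^sub>R x)"
        by (rule e_bound) (use x t in auto)
      also have "\<dots> \<le> ?h x"
      proof (cases "norm (t *\<^sub>R x) \<le> R")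
        case True
        have "norm x \<le> norm (t *\<^sub>R x)"
          using t by (auto simp: mult_le_cancel_right1)
        then have R: "norm x \<le> R" and "norm (t *\<^sub>R x) powr (-a) \<le> norm x powr (-a)"
          using True x a powr_mono2'[of "-a" "norm x" "norm (t *\<^sub>R x)"]
          by (linarith, simp del: norm_scaleR)
        then show ?thesis
          using True K by (auto intro!: mult_left_mono simp del: norm_scaleR)
      next
        case False
        then show ?thesis using h0[OF x] by (auto simp del: norm_scaleR)
      qed
      finally have *: "norm (e (t *\<^sub>R x) /\<^sub>R t) \<le> ?h x" .
      have "norm (s *\<^sub>R (e (t *\<^sub>R x) /\<^sub>R t)) \<le> ?h x * norm s" for s :: real
        using mult_left_mono[OF *, of "norm s"] by (simp only: norm_scaleR mult.commute real_norm_def abs_ge_zero)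
      then show "onorm (\<lambda>s. s *\<^sub>R (e (t *\<^sub>R x) /\<^sub>R t)) \<le> ?h x"
        by (rule onorm_le)
    qed (use l1[of k] in auto)
    moreover have "norm (q k x) = norm (g (l k *\<^sub>R x) - g x) / (l k - 1)"
      using l1[of k] unfolding q_def norm_scaleR by (simp add: divide_inverse mult.commute)
    ultimately show ?thesis
      using l1[of k] by (simp add: pos_divide_le_eq)
  qed
  have "(\<lambda>k. \<integral>x. q k x \<partial>lborel) \<longlonglongrightarrow> (\<integral>x. e x \<partial>lborel)"
  proof (rule integral_dominated_convergence[where w = ?h, OF _ _ h])
    show "AE x in lborel. (\<lambda>k. q k x) \<longlonglongrightarrow> e x"
      using nz
    proof eventually_elim
      case (elim x)
      have "((\<lambda>m. (g (m *\<^sub>R x) - g x) /\<^sub>R (m - 1)) \<longlongrightarrow> e x) (at 1)"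
        using has_vector_derivative_imp_tendsto[OF deriv[OF elim]] by simp
      from this[THEN filterlim_compose, of l sequentially] show ?case
        unfolding q_def using llim l1 by (auto simp: filterlim_at less_imp_neq[symmetric] eventually_sequentially)
    qed
    show "AE x in lborel. norm (q k x) \<le> ?h x" for k
      using nz by eventually_elim (rule q_bound)
  qed auto
  moreover have "(\<lambda>k. \<integral>x. q k x \<partial>lborel) \<longlonglongrightarrow> - of_nat DIM('a) * (\<integral>x. g x \<partial>lborel)"
  proof -
    have eq: "(\<integral>x. q k x \<partial>lborel) = ((inverse (l k ^ DIM('a)) - 1) / (l k - 1)) *\<^sub>R (\<integral>x. g x \<partial>lborel)" for k
      using integral_scaleR_lborel[OF assms(1) _ ig, of "l k"] l1[of k] ig
      unfolding q_def by (simp add: scaleR_diff_left scaleR_diff_right divide_inverse algebra_simps)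
    have "(\<lambda>k. (inverse (l k ^ DIM('a)) - 1) / (l k - 1)) \<longlonglongrightarrow> - real DIM('a)"
    proof -
      have "((\<lambda>t::real. inverse (t ^ DIM('a))) has_real_derivative - real DIM('a)) (at 1)"
        by (auto intro!: derivative_eq_intros)
      then have "((\<lambda>t::real. (inverse (t ^ DIM('a)) - 1) / (t - 1)) \<longlongrightarrow> - real DIM('a)) (at 1)"
        by (simp add: has_field_derivative_iff)
      from this[THEN filterlim_compose, of l sequentially] show ?thesis
        using llim l1 by (auto simp: filterlim_at less_imp_neq[symmetric] eventually_sequentially)
    qed
    from tendsto_scaleR[OF this tendsto_const[of "\<integral>x. g x \<partial>lborel"]] show ?thesis
      unfolding eq by (simp add: scaleR_conv_of_real)
  qed
  ultimately have "(\<integral>x. e x \<partial>lborel) = - of_nat DIM('a) * (\<integral>x. g x \<partial>lborel)"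
    by (rule LIMSEQ_unique)
  then show "(\<integral>x. e x \<partial>lebesgue) = - of_nat DIM('a) * (\<integral>x. g x \<partial>lebesgue)"
    by (simp add: integral_completion)
qed

section \<open>The Hardy form on test functions\<close>

definition crit_exp :: "'a::euclidean_space itself \<Rightarrow> real" where
  "crit_exp _ = (real DIM('a) - 2) / 2"

text \<open>The partial derivative conjugated by the ground state: |x|^-c times the derivative of
  |x|^c u in direction \<open>b\<close>.\<close>

definition hgrad :: "('a::euclidean_space \<Rightarrow> complex) \<Rightarrow> 'a \<Rightarrow> 'a \<Rightarrow> complex" where
  "hgrad u b x = frechet_derivative u (at x) b
     + complex_of_real (crit_exp TYPE('a) * (x \<bullet> b) / (norm x)\<^sup>2) * u x"

lemma Ck_Suc_imp_Ck: "Ck (Suc k) f \<Longrightarrow> Ck k f"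
proof (induction k arbitrary: f)
  case 0
  then show ?case
    by (auto intro!: continuous_at_imp_continuous_on differentiable_imp_continuous_within)
next
  case (Suc k)
  then show ?case
    unfolding Ck.simps(2)[of "Suc k"] Ck.simps(2)[of k f] by blast
qed

lemma Ck_add_cmult: "Ck k f \<Longrightarrow> Ck k g \<Longrightarrow> Ck k (\<lambda>x. f x + a * g x)"
proof (induction k arbitrary: f g)
  case 0
  then show ?case unfolding Ck.simps(1) by (intro continuous_intros)
next
  case (Suc k)
  have fg: "f differentiable at x" "g differentiable at x" for x
    using Suc.prems by auto
  have D: "((\<lambda>x. f x + a * g x) has_derivative
      (\<lambda>b. frechet_derivative f (at x) b + a * frechet_derivative g (at x) b)) (at x)" for x
    by (intro derivative_intros frechet_derivative_works[THEN iffD1] fg)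
  show ?case
    unfolding Ck.simps(2) frechet_derivative_at[OF D, symmetric]
  proof (intro conjI allI ballI)
    show "(\<lambda>x. f x + a * g x) differentiable at x" for x
      using D differentiable_def by blast
    show "Ck k (\<lambda>x. frechet_derivative f (at x) b + a * frechet_derivative g (at x) b)"
      if "b \<in> Basis" for b
      using Suc.prems that unfolding Ck.simps(2) by (intro Suc.IH) blast+
  qed
qed

lemma test_fn_diff:
  assumes "test_fn u" "test_fn v" shows "test_fn (\<lambda>x. u x - v x)"
proof -
  have "{x. u x - v x \<noteq> 0} \<subseteq> {x. u x \<noteq> 0} \<union> {x. v x \<noteq> 0}" by auto
  moreover have "bounded ({x. u x \<noteq> 0} \<union> {x. v x \<noteq> 0})"
    using assms by (simp add: test_fn_def compact_closure)
  ultimately have "bounded {x. u x - v x \<noteq> 0}"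
    by (rule bounded_subset[rotated])
  moreover have "Ck k (\<lambda>x. u x - v x)" for k
    using assms Ck_add_cmult[of k u v "-1"] by (simp add: test_fn_def)
  ultimately show ?thesis
    unfolding test_fn_def by (simp only: compact_closure) blast
qed

lemma test_fn_differentiable: "test_fn u \<Longrightarrow> u differentiable at x"
  unfolding test_fn_def by (metis Ck.simps(2))

lemma test_fn_continuous: "test_fn u \<Longrightarrow> continuous_on A u"
  unfolding test_fn_def by (metis Ck.simps(1) continuous_on_subset subset_UNIV)

lemma test_fn_partial_continuous:
  "test_fn u \<Longrightarrow> b \<in> Basis \<Longrightarrow> continuous_on A (\<lambda>x. frechet_derivative u (at x) b)"
  unfolding test_fn_def by (metis Ck.simps continuous_on_subset subset_UNIV)

lemma test_fn_bounds:
  fixes u :: "'a::euclidean_space \<Rightarrow> complex"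
  assumes u: "test_fn u"
  obtains R K where "R > 0" "K > 0" "\<And>x. R < norm x \<Longrightarrow> u x = 0"
    "\<And>x b. R < norm x \<Longrightarrow> frechet_derivative u (at x) b = 0"
    "\<And>x. norm (u x) \<le> K" "\<And>x b. b \<in> Basis \<Longrightarrow> norm (frechet_derivative u (at x) b) \<le> K"
proof -
  have "bounded (closure {x. u x \<noteq> 0})"
    using u by (auto simp: test_fn_def compact_imp_bounded)
  then obtain R where R: "R > 0" "\<And>x. x \<in> closure {x. u x \<noteq> 0} \<Longrightarrow> norm x \<le> R"
    by (auto simp: bounded_pos)
  have u0: "u x = 0" if "R < norm x" for x
    using R(2)[of x] that closure_subset[of "{x. u x \<noteq> 0}"] by fastforce
  have du0: "frechet_derivative u (at x) = (\<lambda>b. 0)" if "R < norm x" for x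
  proof (rule frechet_derivative_at[symmetric], rule has_derivative_transform_within_open)
    show "((\<lambda>x. 0) has_derivative (\<lambda>b. 0)) (at x)" by simp
    show "open (- cball (0::'a) R)" by auto
  qed (use that u0 in auto)
  have bdd: "\<exists>K. \<forall>x. norm (f x) \<le> K" if "continuous_on (cball 0 R) f" "\<And>x. R < norm x \<Longrightarrow> f x = 0"
    for f :: "'a \<Rightarrow> complex"
  proof -
    have "bounded (f ` cball 0 R)"
      by (intro compact_imp_bounded compact_continuous_image that) auto
    then obtain K where "\<forall>x\<in>cball 0 R. norm (f x) \<le> K"
      unfolding bounded_iff by blast
    then have K: "\<And>x. norm x \<le> R \<Longrightarrow> norm (f x) \<le> K"
      by simp
    show ?thesis
    proof (intro exI allI)
      show "norm (f x) \<le> max K 0" for x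
        using K[of x] that(2)[of x] by (cases "norm x \<le> R") (auto intro: max.coboundedI1)
    qed
  qed
  obtain K0 where K0: "\<And>x. norm (u x) \<le> K0"
    using bdd[OF test_fn_continuous[OF u] u0] by blast
  have "\<forall>b\<in>Basis. \<exists>K. \<forall>x. norm (frechet_derivative u (at x) b) \<le> K"
    using bdd[OF test_fn_partial_continuous[OF u]] du0 by simp
  then obtain K1 where K1: "\<And>b x. b \<in> Basis \<Longrightarrow> norm (frechet_derivative u (at x) b) \<le> K1 b"
    by metis
  show ?thesis
  \<comment> \<open>A crude sum, so that one constant bounds the function and all partial
    derivatives; the summand 1 makes it strictly positive.\<close>
  proof (rule that[of R "\<bar>K0\<bar> + (\<Sum>b\<in>Basis. \<bar>K1 b\<bar>) + 1"])
    have "(\<Sum>b\<in>Basis. \<bar>K1 b\<bar>) \<ge> 0"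
      by (intro sum_nonneg) auto
    then show "norm (u x) \<le> \<bar>K0\<bar> + (\<Sum>b\<in>Basis. \<bar>K1 b\<bar>) + 1" for x
      using K0[of x] by linarith
    show "norm (frechet_derivative u (at x) b) \<le> \<bar>K0\<bar> + (\<Sum>b\<in>Basis. \<bar>K1 b\<bar>) + 1"
      if "b \<in> Basis" for x b
      using K1[OF that, of x] member_le_sum[of b Basis "\<lambda>b. \<bar>K1 b\<bar>"] that by auto
    show "\<bar>K0\<bar> + (\<Sum>b\<in>Basis. \<bar>K1 b\<bar>) + 1 > 0"
      by (intro add_nonneg_pos add_nonneg_nonneg sum_nonneg) auto
  qed (use R u0 du0 in auto)
qed

lemma test_fn_radial_derivative:
  assumes "test_fn u"
  shows "((\<lambda>l. u (l *\<^sub>R x)) has_vector_derivative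
    (\<Sum>b\<in>Basis. complex_of_real (x \<bullet> b) * frechet_derivative u (at x) b)) (at 1)"
proof -
  have D: "(u has_derivative frechet_derivative u (at x)) (at x)"
    using test_fn_differentiable[OF assms] frechet_derivative_works by blast
  then have lin: "linear (frechet_derivative u (at x))"
    using has_derivative_linear by blast
  have "frechet_derivative u (at x) x = frechet_derivative u (at x) (\<Sum>b\<in>Basis. (x \<bullet> b) *\<^sub>R b)"
    by (simp add: euclidean_representation)
  also have "\<dots> = (\<Sum>b\<in>Basis. complex_of_real (x \<bullet> b) * frechet_derivative u (at x) b)"
    by (simp add: linear_sum[OF lin] linear_cmul[OF lin] scaleR_conv_of_real)
  finally have eq: "frechet_derivative u (at x) x = \<dots>" .
  have "(u \<circ> (\<lambda>l. l *\<^sub>R x) has_derivative frechet_derivative u (at x) \<circ> (\<lambda>h. h *\<^sub>R x)) (at 1)"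
    by (rule diff_chain_at) (use D in \<open>auto intro!: derivative_eq_intros\<close>)
  then show ?thesis
    by (simp add: has_vector_derivative_def o_def linear_cmul[OF lin] eq)
qed

lemma borel_measurable_test_fn: "test_fn u \<Longrightarrow> u \<in> borel_measurable borel"
  by (intro borel_measurable_continuous_onI test_fn_continuous)

lemma borel_measurable_test_fn_partial:
  "test_fn u \<Longrightarrow> b \<in> Basis \<Longrightarrow> (\<lambda>x. frechet_derivative u (at x) b) \<in> borel_measurable borel"
  by (intro borel_measurable_continuous_onI test_fn_partial_continuous)

lemma borel_measurable_hgrad:
  assumes "test_fn u" "b \<in> Basis"
  shows "hgrad u b \<in> borel_measurable borel"
proof -
  note [measurable] = borel_measurable_test_fn[OF assms(1)] borel_measurable_test_fn_partial[OF assms]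
  show ?thesis unfolding hgrad_def by measurable
qed

lemma lebesgue_measurable_borel: "f \<in> borel_measurable borel \<Longrightarrow> f \<in> borel_measurable lebesgue"
  by (simp add: measurable_completion)

lemma AE_lebesgue_nonzero: "AE x in lebesgue. x \<noteq> (0::'a::euclidean_space)"
  by (rule AE_I[where N = "{0}"]) auto

lemma L2_powr_bound:
  fixes f :: "'a::euclidean_space \<Rightarrow> complex"
  assumes "f \<in> borel_measurable borel" "2 * a < real DIM('a)" "R > 0"
    and "\<And>x. x \<noteq> 0 \<Longrightarrow> norm x \<le> R \<Longrightarrow> norm (f x) \<le> K * norm x powr (-a)"
    and "\<And>x. R < norm x \<Longrightarrow> f x = 0"
  shows "L2 f"
proof (rule L2I_bound)
  show "integrable lebesgue (\<lambda>x::'a. K\<^sup>2 * (norm x powr (- (2 * a)) * indicator {..R} (norm x)))"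
    using assms by (intro integrable_mult_right integrable_radial_powr_near) auto
  have "(norm (f x))\<^sup>2 \<le> K\<^sup>2 * (norm x powr (- (2 * a)) * indicator {..R} (norm x))" if "x \<noteq> 0" for x
  proof (cases "norm x \<le> R")
    case True
    have "(norm (f x))\<^sup>2 \<le> (K * norm x powr (-a))\<^sup>2"
      by (intro power_mono assms) (use True that in auto)
    also have "\<dots> = K\<^sup>2 * norm x powr (- (2 * a))"
      by (simp add: power2_eq_square ac_simps flip: powr_add)
    finally show ?thesis using True by simp
  qed (use assms in auto)
  then show "AE x in lebesgue. (norm (f x))\<^sup>2 \<le> K\<^sup>2 * (norm x powr (- (2 * a)) * indicator {..R} (norm x))"
    using AE_lebesgue_nonzero by (auto elim!: eventually_mono)
qed (use assms lebesgue_measurable_borel in auto)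

lemma L2_test_fn:
  fixes u :: "'a::euclidean_space \<Rightarrow> complex"
  assumes u: "test_fn u" shows "L2 u"
proof -
  obtain R K where *: "R > 0" "K > 0" "\<And>x. R < norm x \<Longrightarrow> u x = 0" "\<And>x. norm (u x) \<le> K"
    using test_fn_bounds[OF u] by metis
  show ?thesis
    by (rule L2_powr_bound[OF borel_measurable_test_fn[OF u], where a = 0 and K = K and R = R]) (use * in auto)
qed

text \<open>The dimension enters here: the extra term of \<open>hgrad\<close> has size 1/|x|, which
  is square integrable at the origin once n > 2.\<close>

lemma L2_hgrad:
  fixes u :: "'a::euclidean_space \<Rightarrow> complex"
  assumes u: "test_fn u" and b: "b \<in> Basis" and dim: "DIM('a) \<ge> 3" shows "L2 (hgrad u b)"
proof -
  obtain R K where R: "R > 0" "K > 0" "\<And>x. R < norm x \<Longrightarrow> u x = 0"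
    "\<And>x b. R < norm x \<Longrightarrow> frechet_derivative u (at x) b = 0"
    "\<And>x. norm (u x) \<le> K" "\<And>x b. b \<in> Basis \<Longrightarrow> norm (frechet_derivative u (at x) b) \<le> K"
    using test_fn_bounds[OF u] by metis
  let ?c = "crit_exp TYPE('a)"
  show ?thesis
  proof (rule L2_powr_bound[OF borel_measurable_hgrad[OF u b], where a = 1 and K = "R * K + \<bar>?c\<bar> * K" and R = R])
    fix x :: 'a assume x: "x \<noteq> 0" "norm x \<le> R"
    have "norm (hgrad u b x) \<le> norm (frechet_derivative u (at x) b) + \<bar>?c * (x \<bullet> b) / (norm x)\<^sup>2\<bar> * norm (u x)"
      unfolding hgrad_def
      by (rule order_trans[OF norm_triangle_ineq]) (simp only: norm_mult norm_of_real order_refl)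
    also have "\<dots> \<le> K + \<bar>?c * norm x / (norm x)\<^sup>2\<bar> * K"
      using R b Basis_le_norm[OF b, of x]
      by (intro add_mono mult_mono) (auto simp: abs_mult intro!: divide_right_mono mult_left_mono)
    also have "\<dots> = K + \<bar>?c\<bar> * K / norm x"
      using x by (auto simp: abs_mult power2_eq_square)
    finally have "norm (hgrad u b x) \<le> K + \<bar>?c\<bar> * K / norm x" .
    \<comment> \<open>Inside the support radius the bounded term is also dominated by a multiple of
      1/|x|, which leaves a single power to integrate.\<close>
    moreover have "K \<le> R * K / norm x"
      using x R by (simp add: field_simps)
    ultimately show "norm (hgrad u b x) \<le> (R * K + \<bar>?c\<bar> * K) * norm x powr (-1)"
      using x by (simp add: powr_minus divide_inverse algebra_simps)
  qed (use R dim in \<open>auto simp: hgrad_def\<close>)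
qed

lemma C_H_crit_exp: "C_H DIM('a::euclidean_space) = (crit_exp TYPE('a))\<^sup>2"
  by (simp add: C_H_def crit_exp_def power_divide)

lemma norm_radial_sum_le:
  assumes "\<And>b. b \<in> Basis \<Longrightarrow> norm (w b) \<le> K"
  shows "norm (\<Sum>b\<in>Basis. complex_of_real (x \<bullet> b) * w b) \<le> norm (x::'a::euclidean_space) * (real DIM('a) * K)"
proof -
  have "norm (\<Sum>b\<in>Basis. complex_of_real (x \<bullet> b) * w b) \<le> (\<Sum>b\<in>(Basis::'a set). norm x * K)"
    using assms Basis_le_norm by (intro sum_norm_le) (auto simp: norm_mult intro!: mult_mono)
  then show ?thesis by (simp add: ac_simps)
qed

text \<open>Shaped after the expansion of a product of two \<open>hgrad\<close> expressions: main
  term, two mixed terms, and a term that contains the squared coordinate.\<close>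

lemma sum_mult_split:
  fixes k m v w z :: complex
  shows "(\<Sum>b\<in>B. A b + k * (P b * v + z * cnj (Q b)) + m * T b * w) =
    (\<Sum>b\<in>B. A b) + k * ((\<Sum>b\<in>B. P b) * v + z * cnj (\<Sum>b\<in>B. Q b)) + m * (\<Sum>b\<in>B. T b) * w"
  by (induction B rule: infinite_finite_induct) (simp_all add: algebra_simps)

lemma sum_Basis_inner_square:
  "(\<Sum>b\<in>Basis. complex_of_real (x \<bullet> b) * complex_of_real (x \<bullet> b)) = complex_of_real ((norm x)\<^sup>2)"
  unfolding power2_norm_eq_inner euclidean_inner[of x x] by simp

text \<open>Ground state representation: \<open>hgrad\<close> annihilates the zero-energy solution
  \<open>norm x powr - crit_exp TYPE('a)\<close>.\<close>

lemma hardy_form_eq: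
  fixes u v :: "'a::euclidean_space \<Rightarrow> complex"
  assumes u: "test_fn u" and v: "test_fn v" and dim: "DIM('a) \<ge> 3"
  shows "hardy_form u v = (\<Sum>b\<in>Basis. l2inner (hgrad u b) (hgrad v b))"
proof -
  let ?c = "crit_exp TYPE('a)" and ?n = "DIM('a)"
  let ?du = "\<lambda>x. \<Sum>b\<in>Basis. complex_of_real (x \<bullet> b) * frechet_derivative u (at x) b"
  let ?dv = "\<lambda>x. \<Sum>b\<in>Basis. complex_of_real (x \<bullet> b) * frechet_derivative v (at x) b"
  \<comment> \<open>The mixed terms of the product amount to c times the radial derivative of u
    cnj(v), divided by |x|^2. For this \<open>g\<close>, with radial derivative \<open>e\<close>,
    they equal c (e + 2 g), and e + n g is the divergence of the field x g(x), which integrates to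
    zero.\<close>
  define g where "g x = complex_of_real (inverse ((norm x)\<^sup>2)) * (u x * cnj (v x))" for x
  define e where "e x = complex_of_real (inverse ((norm x)\<^sup>2)) * (?du x * cnj (v x) + u x * cnj (?dv x)) - 2 * g x" for x
  obtain R K where R: "R > 0" "K > 0" "\<And>x. R < norm x \<Longrightarrow> u x = 0"
    "\<And>x b. R < norm x \<Longrightarrow> frechet_derivative u (at x) b = 0"
    "\<And>x. norm (u x) \<le> K" "\<And>x b. b \<in> Basis \<Longrightarrow> norm (frechet_derivative u (at x) b) \<le> K"
    using test_fn_bounds[OF u] by metis
  obtain S L where S: "S > 0" "L > 0" "\<And>x. S < norm x \<Longrightarrow> v x = 0"
    "\<And>x b. S < norm x \<Longrightarrow> frechet_derivative v (at x) b = 0"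
    "\<And>x. norm (v x) \<le> L" "\<And>x b. b \<in> Basis \<Longrightarrow> norm (frechet_derivative v (at x) b) \<le> L"
    using test_fn_bounds[OF v] by metis
  note [measurable] = borel_measurable_test_fn[OF u] borel_measurable_test_fn[OF v]
    borel_measurable_test_fn_partial[OF u] borel_measurable_test_fn_partial[OF v]
  have [measurable]: "cnj \<in> borel_measurable borel"
    by (intro borel_measurable_continuous_onI continuous_intros)
  \<comment> \<open>Bounds |x|^2 times \<open>g\<close> and \<open>e\<close>: the product rule
    contributes two terms of size R n K L, the summand - 2 g of \<open>e\<close> contributes 2 K
    L.\<close>
  define M where "M = 2 * (R * (real ?n * (K * L))) + 2 * (K * L)"
  have M: "K * L \<le> M" "M \<ge> 0"
    using R S by (auto simp: M_def intro!: add_nonneg_nonneg mult_nonneg_nonneg)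
  have r2: "inverse ((norm x)\<^sup>2) = norm x powr (-2)" if "x \<noteq> 0" for x :: 'a
    using that by (simp add: powr_minus)
  have gM: "norm (g x) \<le> norm x powr (-2) * (K * L)" "norm x > R \<Longrightarrow> g x = 0" if "x \<noteq> 0" for x
    using R(3)[of x] that mult_mono[OF R(5)[of x] S(5)[of x]] R(2)
    by (auto simp: g_def r2 norm_mult intro!: mult_left_mono)
  have g_bound: "norm (g x) \<le> M * (norm x powr (-2) * indicator {..R} (norm x))" if x: "x \<noteq> 0" for x
    using gM[OF that] M mult_left_mono[OF M(1), of "norm x powr (-2)"] by (auto simp: indicator_def ac_simps)
  have e_bound: "norm (e x) \<le> M * (norm x powr (-2) * indicator {..R} (norm x))" if x: "x \<noteq> 0" for x
  proof (cases "norm x \<le> R")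
    case False
    then show ?thesis using R(3,4)[of x] M by (simp add: e_def g_def)
  next
    case True
    have 1: "norm (?du x) \<le> R * (real ?n * K)"
      by (rule order_trans[OF norm_radial_sum_le[OF R(6)] mult_right_mono[OF True]]) (use R in auto)
    have 2: "norm (?dv x) \<le> R * (real ?n * L)"
      by (rule order_trans[OF norm_radial_sum_le[OF S(6)] mult_right_mono[OF True]]) (use S in auto)
    have "norm (?du x * cnj (v x) + u x * cnj (?dv x)) \<le> norm (?du x) * norm (v x) + norm (u x) * norm (?dv x)"
      by (rule order_trans[OF norm_triangle_ineq]) (simp only: norm_mult complex_mod_cnj order_refl)
    also have "\<dots> \<le> R * (real ?n * K) * L + K * (R * (real ?n * L))"
      by (intro add_mono mult_mono 1 2 R S norm_ge_zero mult_nonneg_nonneg of_nat_0_le_iff less_imp_le[OF R(1)]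
          less_imp_le[OF R(2)] less_imp_le[OF S(2)])
    finally have 3: "norm (?du x * cnj (v x) + u x * cnj (?dv x)) \<le> 2 * (R * (real ?n * (K * L)))"
      by (simp add: algebra_simps)
    have "norm (e x) \<le> norm x powr (-2) * norm (?du x * cnj (v x) + u x * cnj (?dv x)) + 2 * norm (g x)"
      unfolding e_def r2[OF x]
      by (rule order_trans[OF norm_triangle_ineq4])
        (simp only: norm_mult norm_of_real abs_of_nonneg[OF powr_ge_zero] norm_numeral order_refl)
    also have "\<dots> \<le> norm x powr (-2) * (2 * (R * (real ?n * (K * L)))) + 2 * (norm x powr (-2) * (K * L))"
      by (intro add_mono mult_left_mono 3 gM(1)[OF x] powr_ge_zero zero_le_numeral)
    finally show ?thesis using True by (simp add: M_def algebra_simps)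
  qed
  have deriv: "((\<lambda>l. g (l *\<^sub>R x)) has_vector_derivative e x) (at 1)" if "x \<noteq> 0" for x
  proof -
    have "((\<lambda>l. complex_of_real (inverse (l\<^sup>2 * (norm x)\<^sup>2)) * (u (l *\<^sub>R x) * cnj (v (l *\<^sub>R x)))) has_vector_derivative
       complex_of_real (inverse (1\<^sup>2 * (norm x)\<^sup>2)) * (u (1 *\<^sub>R x) * cnj (?dv x) + ?du x * cnj (v (1 *\<^sub>R x)))
       + complex_of_real (- 2 * inverse ((norm x)\<^sup>2)) * (u (1 *\<^sub>R x) * cnj (v (1 *\<^sub>R x)))) (at 1)"
    proof (intro has_vector_derivative_mult has_vector_derivative_of_real
        bounded_linear.has_vector_derivative[OF bounded_linear_cnj] test_fn_radial_derivative u v)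
      show "((\<lambda>l. inverse (l\<^sup>2 * (norm x)\<^sup>2)) has_real_derivative - 2 * inverse ((norm x)\<^sup>2)) (at 1)"
        using that by (auto intro!: derivative_eq_intros simp: field_simps power2_eq_square)
    qed
    moreover have "g (l *\<^sub>R x) = complex_of_real (inverse (l\<^sup>2 * (norm x)\<^sup>2)) * (u (l *\<^sub>R x) * cnj (v (l *\<^sub>R x)))" for l
      by (simp only: g_def norm_scaleR power_mult_distrib power2_abs)
    moreover have "complex_of_real (inverse (1\<^sup>2 * (norm x)\<^sup>2)) * (u (1 *\<^sub>R x) * cnj (?dv x) + ?du x * cnj (v (1 *\<^sub>R x)))
       + complex_of_real (- 2 * inverse ((norm x)\<^sup>2)) * (u (1 *\<^sub>R x) * cnj (v (1 *\<^sub>R x))) = e x"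
      by (simp add: g_def e_def algebra_simps)
    ultimately show ?thesis
      by simp
  qed
  have gm: "g \<in> borel_measurable borel" unfolding g_def by measurable
  have em: "e \<in> borel_measurable borel" unfolding e_def g_def by measurable
  have pre: "0 \<le> (2::real)" "2 < real ?n" "0 \<le> R"
    using dim R by auto
  have div: "integrable lebesgue g" "integrable lebesgue e" "(\<integral>x. e x \<partial>lebesgue) = - of_nat ?n * (\<integral>x. g x \<partial>lebesgue)"
    using integral_radial_derivative[OF gm em deriv pre g_bound e_bound] by blast+
  \<comment> \<open>The coefficients of \<open>g\<close> add up to c^2 + 2 c - c n, which is - c^2
    because n = 2 c + 2. This is where exactly the critical constant \<open>C_H\<close> comes
    out.\<close>
  have eq: "(\<Sum>b\<in>Basis. hgrad u b x * cnj (hgrad v b x)) - of_real ?c * (e x + of_nat ?n * g x) =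
     (\<Sum>b\<in>Basis. frechet_derivative u (at x) b * cnj (frechet_derivative v (at x) b))
          - complex_of_real (C_H ?n / (norm x)\<^sup>2) * u x * cnj (v x)" for x
  proof -
    let ?i = "complex_of_real (inverse ((norm x)\<^sup>2))" and ?C = "complex_of_real ?c"
    have "(\<Sum>b\<in>Basis. hgrad u b x * cnj (hgrad v b x)) =
       (\<Sum>b\<in>Basis. frechet_derivative u (at x) b * cnj (frechet_derivative v (at x) b)
         + ?C * ?i * ((complex_of_real (x \<bullet> b) * frechet_derivative u (at x) b) * cnj (v x)
               + u x * cnj (complex_of_real (x \<bullet> b) * frechet_derivative v (at x) b))
         + ?C * ?C * ?i * ?i * (complex_of_real (x \<bullet> b) * complex_of_real (x \<bullet> b)) * (u x * cnj (v x)))"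
      by (rule sum.cong) (auto simp: hgrad_def divide_inverse algebra_simps)
    also have "\<dots> = (\<Sum>b\<in>Basis. frechet_derivative u (at x) b * cnj (frechet_derivative v (at x) b))
         + ?C * ?i * (?du x * cnj (v x) + u x * cnj (?dv x))
         + ?C * ?C * ?i * ?i * complex_of_real ((norm x)\<^sup>2) * (u x * cnj (v x))"
      unfolding sum_Basis_inner_square[symmetric] by (rule sum_mult_split)
    also have "?C * ?i * (?du x * cnj (v x) + u x * cnj (?dv x)) = ?C * (e x + 2 * g x)"
      by (simp add: e_def)
    \<comment> \<open>At the origin both sides vanish, since \<open>inverse 0\<close> is 0.\<close>
    also have "?C * ?C * ?i * ?i * complex_of_real ((norm x)\<^sup>2) * (u x * cnj (v x)) = ?C * ?C * g x"
      by (cases "x = 0") (auto simp: g_def field_simps)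
    finally have "(\<Sum>b\<in>Basis. hgrad u b x * cnj (hgrad v b x)) =
      (\<Sum>b\<in>Basis. frechet_derivative u (at x) b * cnj (frechet_derivative v (at x) b))
        + ?C * (e x + 2 * g x) + ?C * ?C * g x" .
    moreover have "of_nat ?n = 2 * ?C + 2"
    proof -
      have "real ?n = 2 * ?c + 2" by (simp add: crit_exp_def field_simps)
      then have "complex_of_real (real ?n) = complex_of_real (2 * ?c + 2)" by (rule arg_cong)
      then show ?thesis by simp
    qed
    moreover have "complex_of_real (C_H ?n / (norm x)\<^sup>2) * u x * cnj (v x) = ?C * ?C * g x"
      unfolding C_H_crit_exp by (simp add: g_def divide_inverse power2_eq_square)
    ultimately show ?thesis by (simp add: algebra_simps)
  qed
  have int: "integrable lebesgue (\<lambda>x. hgrad u b x * cnj (hgrad v b x))" if "b \<in> Basis" for b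
    using that by (intro L2_mult_integrable L2_hgrad u v dim)
  have "hardy_form u v = (\<integral>x. (\<Sum>b\<in>Basis. hgrad u b x * cnj (hgrad v b x)) - of_real ?c * (e x + of_nat ?n * g x) \<partial>lebesgue)"
    unfolding hardy_form_def eq ..
  also have "\<dots> = (\<integral>x. (\<Sum>b\<in>Basis. hgrad u b x * cnj (hgrad v b x)) \<partial>lebesgue)
     - (\<integral>x. of_real ?c * (e x + of_nat ?n * g x) \<partial>lebesgue)"
    using int div by (intro Bochner_Integration.integral_diff Bochner_Integration.integrable_sum
        integrable_mult_right Bochner_Integration.integrable_add) auto
  also have "(\<integral>x. of_real ?c * (e x + of_nat ?n * g x) \<partial>lebesgue) = 0"
    using div by simp
  also have "(\<integral>x. (\<Sum>b\<in>Basis. hgrad u b x * cnj (hgrad v b x)) \<partial>lebesgue) = (\<Sum>b\<in>Basis. l2inner (hgrad u b) (hgrad v b))"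
    unfolding l2inner_def by (rule Bochner_Integration.integral_sum[OF int])
  finally show ?thesis by simp
qed

section \<open>Smooth radial functions and a logarithmic cutoff\<close>

text \<open>Relative to a set because the profiles below involve \<open>ln\<close> and
  \<open>powr\<close>, smooth only on the positive reals, and must be glued to zero elsewhere.
  Quantifying over the derivative lets each closure rule supply its own formula.\<close>

primrec Dk :: "nat \<Rightarrow> real set \<Rightarrow> (real \<Rightarrow> 'b::real_normed_field) \<Rightarrow> bool" where
  "Dk 0 S f \<longleftrightarrow> True"
| "Dk (Suc k) S f \<longleftrightarrow> (\<exists>f'. (\<forall>s\<in>S. (f has_vector_derivative f' s) (at s)) \<and> Dk k S f')"

lemma Dk_SucI: "(\<And>s. s \<in> S \<Longrightarrow> (f has_vector_derivative f' s) (at s)) \<Longrightarrow> Dk k S f' \<Longrightarrow> Dk (Suc k) S f"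
  by auto

lemma Dk_SucE:
  assumes "Dk (Suc k) S f"
  obtains f' where "\<And>s. s \<in> S \<Longrightarrow> (f has_vector_derivative f' s) (at s)" "Dk k S f'"
  using assms by auto

lemma Dk_cong:
  assumes "open S" "Dk k S f" "\<And>s. s \<in> S \<Longrightarrow> f s = g s" shows "Dk k S g"
proof (cases k)
  case (Suc j)
  then obtain f' where f': "\<And>s. s \<in> S \<Longrightarrow> (f has_vector_derivative f' s) (at s)" "Dk j S f'"
    using assms(2) Dk_SucE by metis
  have "(g has_vector_derivative f' s) (at s)" if "s \<in> S" for s
    by (rule has_vector_derivative_transform_within_open[OF f'(1)[OF that] assms(1) that]) (rule assms(3))
  then show ?thesis
    unfolding Suc by (rule Dk_SucI) (use f' in auto)
qed simp

text \<open>On the overlap the two derivatives agree by uniqueness, so a definition by cases is a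
  derivative on the union and is again differentiable to lower order on both pieces.\<close>

lemma Dk_Un:
  assumes "open S" "open T" shows "Dk k S f \<Longrightarrow> Dk k T f \<Longrightarrow> Dk k (S \<union> T) f"
proof (induction k arbitrary: f)
  case (Suc k)
  obtain f1 where f1: "\<And>s. s \<in> S \<Longrightarrow> (f has_vector_derivative f1 s) (at s)" "Dk k S f1"
    using Suc.prems(1) by (rule Dk_SucE) (rule that)
  obtain f2 where f2: "\<And>s. s \<in> T \<Longrightarrow> (f has_vector_derivative f2 s) (at s)" "Dk k T f2"
    using Suc.prems(2) by (rule Dk_SucE) (rule that)
  let ?f = "\<lambda>s. if s \<in> S then f1 s else f2 s"
  have "Dk k S ?f" by (rule Dk_cong[OF assms(1) f1(2)]) simp
  moreover have "Dk k T ?f"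
    by (rule Dk_cong[OF assms(2) f2(2)]) (use vector_derivative_unique_at[OF f1(1) f2(1)] in auto)
  ultimately have "Dk k (S \<union> T) ?f" by (rule Suc.IH)
  with f1(1) f2(1) show ?case by (intro Dk_SucI[where f' = ?f]) auto
qed simp

lemma Dk_Suc_imp_Dk: "Dk (Suc k) S f \<Longrightarrow> Dk k S f"
proof (induction k arbitrary: f)
  case (Suc k)
  from Suc.prems show ?case
    by (rule Dk_SucE) (rule Dk_SucI, auto intro!: Suc.IH simp del: Dk.simps)
qed simp

lemma Dk_const: "Dk k S (\<lambda>s. a)"
proof (induction k arbitrary: a)
  case (Suc k)
  show ?case by (rule Dk_SucI[OF _ Suc.IH[of 0]]) simp
qed simp

lemma Dk_add: "Dk k S f \<Longrightarrow> Dk k S g \<Longrightarrow> Dk k S (\<lambda>s. f s + g s)"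
proof (induction k arbitrary: f g)
  case (Suc k)
  obtain f' where f': "\<And>s. s \<in> S \<Longrightarrow> (f has_vector_derivative f' s) (at s)" "Dk k S f'"
    using Suc.prems(1) by (rule Dk_SucE) (rule that)
  obtain g' where g': "\<And>s. s \<in> S \<Longrightarrow> (g has_vector_derivative g' s) (at s)" "Dk k S g'"
    using Suc.prems(2) by (rule Dk_SucE) (rule that)
  show ?case
    by (rule Dk_SucI[OF _ Suc.IH[OF f'(2) g'(2)]]) (intro has_vector_derivative_add f' g')
qed simp

lemma Dk_mult: "Dk k S f \<Longrightarrow> Dk k S g \<Longrightarrow> Dk k S (\<lambda>s. f s * g s)"
proof (induction k arbitrary: f g)
  case (Suc k)
  obtain f' where f': "\<And>s. s \<in> S \<Longrightarrow> (f has_vector_derivative f' s) (at s)" "Dk k S f'"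
    using Suc.prems(1) by (rule Dk_SucE) (rule that)
  obtain g' where g': "\<And>s. s \<in> S \<Longrightarrow> (g has_vector_derivative g' s) (at s)" "Dk k S g'"
    using Suc.prems(2) by (rule Dk_SucE) (rule that)
  have "Dk k S (\<lambda>s. f s * g' s + f' s * g s)"
    by (intro Dk_add Suc.IH f'(2) g'(2) Dk_Suc_imp_Dk[OF Suc.prems(1)] Dk_Suc_imp_Dk[OF Suc.prems(2)])
  then show ?case
    by (rule Dk_SucI[rotated]) (intro has_vector_derivative_mult f' g')
qed simp

lemma Dk_compose:
  fixes f h :: "real \<Rightarrow> real"
  assumes "h ` S \<subseteq> T"
  shows "Dk k T f \<Longrightarrow> Dk k S h \<Longrightarrow> Dk k S (\<lambda>s. f (h s))"
proof (induction k arbitrary: f)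
  case (Suc k)
  obtain f' where f': "\<And>s. s \<in> T \<Longrightarrow> (f has_vector_derivative f' s) (at s)" "Dk k T f'"
    using Suc.prems(1) by (rule Dk_SucE) (rule that)
  obtain h' where h': "\<And>s. s \<in> S \<Longrightarrow> (h has_vector_derivative h' s) (at s)" "Dk k S h'"
    using Suc.prems(2) by (rule Dk_SucE) (rule that)
  have "Dk k S (\<lambda>s. h' s * f' (h s))"
    by (rule Dk_mult[OF h'(2) Suc.IH[OF f'(2) Dk_Suc_imp_Dk[OF Suc.prems(2)]]])
  moreover have "((\<lambda>s. f (h s)) has_vector_derivative h' s * f' (h s)) (at s)" if s: "s \<in> S" for s
    using vector_diff_chain_at[OF h'(1)[OF s] f'(1)] assms s by (simp add: o_def image_subset_iff)
  ultimately show ?case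
    by (rule Dk_SucI[rotated])
qed simp

lemma Dk_of_real: "Dk k S f \<Longrightarrow> Dk k S (\<lambda>s. of_real (f s) :: 'b::real_normed_field)"
proof (induction k arbitrary: f)
  case (Suc k)
  obtain f' where f': "\<And>s. s \<in> S \<Longrightarrow> (f has_vector_derivative f' s) (at s)" "Dk k S f'"
    using Suc.prems(1) by (rule Dk_SucE) (rule that)
  show ?case
    by (rule Dk_SucI[OF _ Suc.IH[OF f'(2)]])
      (intro bounded_linear.has_vector_derivative[OF bounded_linear_of_real] f')
qed simp

lemma Dk_exp: "Dk k S (\<lambda>s. exp (a * of_real s) :: complex)"
proof (induction k)
  case (Suc k)
  have "((\<lambda>s. a * of_real s) has_vector_derivative a * of_real 1) (at s)" for s
    by (intro has_vector_derivative_mult_right has_vector_derivative_of_real) (auto intro!: derivative_eq_intros)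
  from field_vector_diff_chain_at[OF this DERIV_exp]
  have "((\<lambda>s. exp (a * of_real s)) has_vector_derivative a * exp (a * of_real s)) (at s)" for s
    by (simp add: o_def)
  then show ?case
    by (rule Dk_SucI) (rule Dk_mult[OF Dk_const Suc.IH])
qed simp

lemma Dk_powr: "Dk k {0<..} (\<lambda>s. s powr a)"
proof (induction k arbitrary: a)
  case (Suc k)
  have "((\<lambda>s. s powr a) has_vector_derivative a * s powr (a - 1)) (at s)" if "s \<in> {0<..}" for s
    unfolding has_real_derivative_iff_has_vector_derivative[symmetric]
    using that by (auto intro!: derivative_eq_intros)
  then show ?case
    using Dk_SucI[of "{0<..}", OF _ Dk_mult[OF Dk_const Suc.IH]] by blast
qed simp

lemma Dk_ln: "Dk k {0<..} (ln :: real \<Rightarrow> real)"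
proof (cases k)
  case (Suc j)
  have "(ln has_vector_derivative s powr -1) (at s)" if "s \<in> {0<..}" for s :: real
    unfolding has_real_derivative_iff_has_vector_derivative[symmetric]
    using that by (auto intro!: derivative_eq_intros simp: powr_minus divide_inverse)
  then show ?thesis
    unfolding Suc using Dk_SucI[of "{0<..}", OF _ Dk_powr] by blast
qed simp

text \<open>The classical flat function exp(-1/y), divided by a power of y. The index makes the
  family closed under differentiation up to linear combinations, so smoothness becomes a plain
  induction.\<close>

definition bump :: "nat \<Rightarrow> real \<Rightarrow> real" where
  "bump j y = (if y > 0 then exp (- 1 / y) / y ^ j else 0)"

text \<open>The k-th power of x/k <= exp(x/k).\<close>

lemma power_le_exp:
  assumes "x \<ge> (0::real)" shows "x ^ k \<le> real k ^ k * exp x"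
proof (cases "k = 0")
  case False
  have "x / real k \<le> exp (x / real k)"
    using exp_ge_add_one_self[of "x / real k"] by linarith
  then have "(x / real k) ^ k \<le> exp (x / real k) ^ k"
    by (intro power_mono) (use assms in auto)
  also have "\<dots> = exp x"
    using False by (simp flip: exp_of_nat_mult)
  finally show ?thesis
    using False by (simp add: power_divide pos_divide_le_eq mult.commute)
qed (use assms in simp)

lemma bump_nonneg: "bump j y \<ge> 0"
  by (simp add: bump_def)

text \<open>\<open>power_le_exp\<close> at 1/y with exponent j + k. The case k = 2 gives the
  derivative at 0, the case k = 0 a uniform bound.\<close>

lemma bump_le: "y \<ge> 0 \<Longrightarrow> bump j y \<le> real (j + k) ^ (j + k) * y ^ k"
proof (cases "y = 0")
  case False
  assume "y \<ge> 0"
  with False have y: "y > 0" by simp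
  have "(1 / y) ^ (j + k) * exp (- 1 / y) \<le> real (j + k) ^ (j + k) * exp (1 / y) * exp (- 1 / y)"
    by (intro mult_right_mono power_le_exp) (use y in auto)
  also have "\<dots> = real (j + k) ^ (j + k)"
    by (simp add: mult.assoc flip: exp_add)
  finally show ?thesis
    using y by (simp add: bump_def field_simps power_add)
qed (simp add: bump_def)

lemma bump_has_derivative:
  "(bump j has_real_derivative - real j * bump (Suc j) y + bump (j + 2) y) (at y)"
proof -
  consider "y > 0" | "y < 0" | "y = 0" by linarith
  then show ?thesis
  proof cases
    case 1
    have "((\<lambda>y. exp (- 1 / y) / y ^ j) has_real_derivative - real j * bump (Suc j) y + bump (j + 2) y) (at y)"
    proof (cases j)
      case 0
      then show ?thesis
        using 1 by (auto intro!: derivative_eq_intros simp: bump_def field_simps power2_eq_square)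
    next
      case (Suc i)
      then show ?thesis
        using 1 by (auto intro!: derivative_eq_intros simp: bump_def field_simps power2_eq_square)
          (cases i; simp)
    qed
    then show ?thesis
      by (rule has_field_derivative_transform_within_open[where S = "{0<..}"]) (use 1 in \<open>auto simp: bump_def\<close>)
  next
    case 2
    have "((\<lambda>y. 0) has_real_derivative - real j * bump (Suc j) y + bump (j + 2) y) (at y)"
      using 2 by (simp add: bump_def)
    then show ?thesis
      by (rule has_field_derivative_transform_within_open[where S = "{..<0}"]) (use 2 in \<open>auto simp: bump_def\<close>)
  next
    case 3
    \<comment> \<open>At the origin the difference quotient is at most K |h|, because
      \<open>bump_le\<close> with k = 2 shows that the function vanishes there to second
      order.\<close>
    define K where "K = real (j + 2) ^ (j + 2)"
    have K: "K \<ge> 0"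
      unfolding K_def by (rule zero_le_power, rule of_nat_0_le_iff)
    have b: "\<bar>bump j h / h\<bar> \<le> K * \<bar>h\<bar>" for h
    proof (cases "h > 0")
      case True
      have "bump j h \<le> K * h\<^sup>2"
        unfolding K_def by (rule bump_le) (use True in simp)
      then show ?thesis
        using True bump_nonneg[of j h] by (simp add: pos_divide_le_eq power2_eq_square mult.assoc)
    next
      case False
      then have "bump j h / h = 0" by (simp add: bump_def)
      then show ?thesis using mult_nonneg_nonneg[OF K abs_ge_zero[of h]] by linarith
    qed
    have "((\<lambda>h. K * \<bar>h\<bar>) \<longlongrightarrow> K * \<bar>0\<bar>) (at 0)"
      by (intro tendsto_intros)
    then have lim: "((\<lambda>h. K * \<bar>h\<bar>) \<longlongrightarrow> 0) (at 0)"
      by simp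
    have "((\<lambda>h. bump j h / h) \<longlongrightarrow> 0) (at 0)"
      by (rule Lim_null_comparison[OF _ lim]) (use b in simp)
    then show ?thesis
      using 3 by (simp add: DERIV_def bump_def)
  qed
qed

lemma Dk_bump: "Dk k S (bump j)"
proof (induction k arbitrary: j)
  case (Suc k)
  have "(bump j has_vector_derivative - real j * bump (Suc j) y + bump (j + 2) y) (at y)" for y
    using bump_has_derivative by (rule has_real_derivative_iff_has_vector_derivative[THEN iffD1])
  then show ?case
    using Dk_SucI[of S, OF _ Dk_add[OF Dk_mult[OF Dk_const Suc.IH] Suc.IH]] by blast
qed simp

lemma continuous_bump: "isCont (bump j) y"
  using bump_has_derivative DERIV_isCont by blast

text \<open>The cutoff lives on the logarithmic scale because the reduced problem is planar: a cutoff by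
  rescaling near the origin has energy of order one, this one of order \<open>1 / m\<close>.\<close>

definition log_cutoff :: "real \<Rightarrow> real \<Rightarrow> real" where
  "log_cutoff m s = exp 1 * bump 0 (1 - (ln s / m)\<^sup>2)"

text \<open>The factor \<open>exp 1\<close> normalises: the argument of \<open>bump 0\<close> is at
  most 1, and there exp(-1/y) is at most exp(-1).\<close>

lemma log_cutoff_bounds: "0 \<le> log_cutoff m s" "log_cutoff m s \<le> 1"
proof -
  show "0 \<le> log_cutoff m s" by (simp add: log_cutoff_def bump_nonneg)
  show "log_cutoff m s \<le> 1"
  proof (cases "1 - (ln s / m)\<^sup>2 > 0")
    case True
    then have "1 \<le> 1 / (1 - (ln s / m)\<^sup>2)" by simp
    then show ?thesis using True by (simp add: log_cutoff_def bump_def flip: exp_add)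
  qed (simp add: log_cutoff_def bump_def)
qed

lemma log_cutoff_eq_0:
  assumes "m > 0" "s > 0" "s \<le> exp (-m) \<or> s \<ge> exp m" shows "log_cutoff m s = 0"
proof -
  have "\<bar>ln s\<bar> \<ge> m"
    using assms ln_le_cancel_iff[of s "exp (-m)"] ln_le_cancel_iff[of "exp m" s] by auto
  then have "\<bar>ln s / m\<bar> \<ge> 1" using assms by (simp add: field_simps)
  then have "(ln s / m)\<^sup>2 \<ge> 1" by (metis abs_ge_zero one_le_power power2_abs)
  then show ?thesis by (simp add: log_cutoff_def bump_def)
qed

lemma log_cutoff_has_derivative:
  assumes "m > 0" "s > 0"
  shows "(log_cutoff m has_real_derivative - 2 * exp 1 * bump 2 (1 - (ln s / m)\<^sup>2) * (ln s / m) / (m * s)) (at s)"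
proof -
  have "((\<lambda>s. bump 0 (1 - (ln s / m)\<^sup>2)) has_real_derivative
      (- real 0 * bump (Suc 0) (1 - (ln s / m)\<^sup>2) + bump (0 + 2) (1 - (ln s / m)\<^sup>2)) * (- (2 * (ln s / m) * (1 / s / m)))) (at s)"
    by (rule DERIV_chain2[OF bump_has_derivative]) (use assms in \<open>auto intro!: derivative_eq_intros\<close>)
  from DERIV_cmult[OF this, of "exp 1"] show ?thesis
    unfolding log_cutoff_def[abs_def] by (simp add: field_simps numeral_2_eq_2)
qed

lemma log_cutoff_derivative_bound:
  assumes "m > 0" "s > 0"
  shows "\<bar>- 2 * exp 1 * bump 2 (1 - (ln s / m)\<^sup>2) * (ln s / m) / (m * s)\<bar> \<le> 8 * exp 1 / (m * s) * indicator {exp (-m)..exp m} s"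
proof (cases "\<bar>ln s / m\<bar> < 1")
  case True
  then have "\<bar>ln s\<bar> < m" using assms by (simp add: field_simps)
  then have s: "s \<in> {exp (-m)..exp m}"
    using assms exp_le_cancel_iff[of "-m" "ln s"] exp_le_cancel_iff[of "ln s" m] by auto
  have B: "bump 2 (1 - (ln s / m)\<^sup>2) * \<bar>ln s / m\<bar> \<le> 4 * 1"
  proof (rule mult_mono)
    \<comment> \<open>The constant is 2^2, from \<open>bump_le\<close> with j = 2 and k = 0.\<close>
    show "bump 2 (1 - (ln s / m)\<^sup>2) \<le> 4"
      using bump_le[of "1 - (ln s / m)\<^sup>2" 2 0] True
      by (simp add: bump_def abs_square_less_1 abs_square_le_1)
  qed (use True in auto)
  have "\<bar>- 2 * exp 1 * bump 2 (1 - (ln s / m)\<^sup>2) * (ln s / m) / (m * s)\<bar>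
      = 2 * exp 1 / (m * s) * (bump 2 (1 - (ln s / m)\<^sup>2) * \<bar>ln s / m\<bar>)"
    using assms bump_nonneg[of 2 "1 - (ln s / m)\<^sup>2"] by (simp add: abs_mult ac_simps)
  also have "\<dots> \<le> 2 * exp 1 / (m * s) * (4 * 1)"
    by (rule mult_left_mono[OF B]) (use assms in auto)
  finally show ?thesis
    using s by simp
next
  case False
  then have "(ln s / m)\<^sup>2 \<ge> 1" by (metis abs_ge_zero linorder_not_less one_le_power power2_abs)
  then show ?thesis using assms by (simp add: bump_def)
qed

lemma log_cutoff_tendsto: "(\<lambda>k. log_cutoff (real (Suc k)) s) \<longlonglongrightarrow> 1"
proof -
  have "(\<lambda>k. ln s / real (Suc k)) \<longlonglongrightarrow> 0"
    using tendsto_mult_right_zero[OF LIMSEQ_inverse_real_of_nat, of "ln s"] by (simp add: divide_inverse)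
  then have "(\<lambda>k. 1 - (ln s / real (Suc k))\<^sup>2) \<longlonglongrightarrow> 1 - 0\<^sup>2"
    by (intro tendsto_intros)
  then have "(\<lambda>k. exp 1 * bump 0 (1 - (ln s / real (Suc k))\<^sup>2)) \<longlonglongrightarrow> exp 1 * bump 0 1"
    by (intro tendsto_mult tendsto_const isCont_tendsto_compose[OF continuous_bump]) simp
  then show ?thesis
    by (simp add: log_cutoff_def bump_def flip: exp_add)
qed

lemma Dk_log_cutoff: "Dk k {0<..} (log_cutoff m)"
proof -
  have ln_m: "Dk k {0<..} (\<lambda>s. ln s * (1 / m))"
    by (rule Dk_mult[OF Dk_ln Dk_const])
  note arg = Dk_add[OF Dk_const[where a = 1] Dk_mult[OF Dk_const[where a = "-1"] Dk_mult[OF ln_m ln_m]]]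
  have "Dk k {0<..} (\<lambda>s. exp 1 * bump 0 (1 + (-1) * ((ln s * (1 / m)) * (ln s * (1 / m)))))"
    by (rule Dk_mult[OF Dk_const Dk_compose[OF subset_UNIV Dk_bump arg]])
  moreover have "(\<lambda>s. exp 1 * bump 0 (1 + (-1) * ((ln s * (1 / m)) * (ln s * (1 / m))))) = log_cutoff m"
    by (simp add: log_cutoff_def fun_eq_iff power2_eq_square)
  ultimately show ?thesis by simp
qed

section \<open>From smooth one-variable profiles to smooth radial functions\<close>

lemma Ck_SucI:
  assumes "\<And>x. (f has_derivative f' x) (at x)" "\<And>b. b \<in> Basis \<Longrightarrow> Ck k (\<lambda>x. f' x b)"
  shows "Ck (Suc k) f"
proof -
  have "f differentiable at x" for x
    using assms(1) differentiable_def by blast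
  moreover have "Ck k (\<lambda>x. frechet_derivative f (at x) b)" if "b \<in> Basis" for b
    using assms(2)[OF that] by (simp only: frechet_derivative_at[OF assms(1), symmetric])
  ultimately show ?thesis by simp
qed

lemma Ck_const: "Ck k (\<lambda>x. a)"
proof (induction k arbitrary: a)
  case (Suc k)
  show ?case by (rule Ck_SucI[where f' = "\<lambda>x b. 0"]) (auto intro: Suc.IH)
qed simp

lemma Ck_mult: "Ck k f \<Longrightarrow> Ck k g \<Longrightarrow> Ck k (\<lambda>x. f x * g x)"
proof (induction k arbitrary: f g)
  case 0
  then show ?case unfolding Ck.simps(1) by (intro continuous_intros)
next
  case (Suc k)
  have D: "(f has_derivative frechet_derivative f (at x)) (at x)" "(g has_derivative frechet_derivative g (at x)) (at x)" for x
    using Suc.prems frechet_derivative_works unfolding Ck.simps(2) by blast+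
  show ?case
  proof (rule Ck_SucI[OF has_derivative_mult[OF D]])
    fix b :: 'a assume "b \<in> Basis"
    then have "Ck k (\<lambda>x. f x * frechet_derivative g (at x) b)" "Ck k (\<lambda>x. frechet_derivative f (at x) b * g x)"
      using Suc.prems Ck_Suc_imp_Ck by (auto intro!: Suc.IH)
    from Ck_add_cmult[OF this, of 1]
    show "Ck k (\<lambda>x. f x * frechet_derivative g (at x) b + frechet_derivative f (at x) b * g x)"
      by simp
  qed
qed

lemma Ck_inner: "Ck k (\<lambda>x. complex_of_real (2 * (x \<bullet> b)))"
proof (cases k)
  case 0
  then show ?thesis by (auto intro!: continuous_intros)
next
  case (Suc j)
  show ?thesis
    unfolding Suc
    by (rule Ck_SucI[where f' = "\<lambda>x h. complex_of_real (2 * (h \<bullet> b))"])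
       (auto intro!: derivative_eq_intros Ck_const)
qed

lemma radial_has_derivative:
  fixes x :: "'a::euclidean_space"
  assumes "(g has_vector_derivative d) (at ((norm x)\<^sup>2))"
  shows "((\<lambda>x. g ((norm x)\<^sup>2)) has_derivative (\<lambda>h. complex_of_real (2 * (x \<bullet> h)) * d)) (at x)"
proof -
  have "((\<lambda>x::'a. x \<bullet> x) has_derivative (\<lambda>h. 2 * (x \<bullet> h))) (at x)"
    by (auto intro!: derivative_eq_intros simp: inner_commute)
  from diff_chain_at[OF this assms[unfolded has_vector_derivative_def power2_norm_eq_inner]] show ?thesis
    by (simp add: o_def power2_norm_eq_inner scaleR_conv_of_real)
qed

text \<open>The partial derivatives of g(|x|^2) are 2 x_b g'(|x|^2), a coordinate times a function
  of the same kind, so the product rule closes the induction. Using the squared norm avoids the kink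
  of the norm at the origin.\<close>

lemma Ck_radial: "(\<And>k. Dk k UNIV g) \<Longrightarrow> Ck k (\<lambda>x. g ((norm x)\<^sup>2) :: complex)"
proof (induction k arbitrary: g)
  case 0
  obtain g' where "\<And>s. (g has_vector_derivative g' s) (at s)"
    using Dk_SucE[OF 0[of "Suc 0"]] by (metis UNIV_I)
  then have "continuous_on UNIV g"
    by (meson continuous_at_imp_continuous_on has_vector_derivative_continuous)
  then have "continuous_on UNIV (\<lambda>x::'a. g ((norm x)\<^sup>2))"
    by (rule continuous_on_compose2) (auto intro!: continuous_intros)
  then show ?case by simp
next
  case (Suc k)
  obtain g' where g': "\<And>s. (g has_vector_derivative g' s) (at s)"
    using Dk_SucE[OF Suc.prems[of "Suc 0"]] by (metis UNIV_I)
  \<comment> \<open>Each order of smoothness of \<open>g\<close> comes with its own witness for the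
    first derivative; uniqueness of derivatives identifies them all with \<open>g'\<close>.\<close>
  have "Dk j UNIV g'" for j
  proof -
    obtain h where h: "\<And>s. (g has_vector_derivative h s) (at s)" "Dk j UNIV h"
      using Dk_SucE[OF Suc.prems[of "Suc j"]] by (metis UNIV_I)
    then have "h = g'" using g' vector_derivative_unique_at by blast
    with h show ?thesis by simp
  qed
  then have "Ck k (\<lambda>x::'a. g' ((norm x)\<^sup>2))"
    by (rule Suc.IH)
  then have C: "Ck k (\<lambda>x::'a. complex_of_real (2 * (x \<bullet> b)) * g' ((norm x)\<^sup>2))" for b
    by (intro Ck_mult Ck_inner)
  show ?case
    by (rule Ck_SucI[OF radial_has_derivative[OF g'] C])
qed

section \<open>Gaussian profiles\<close>

definition gauss :: "complex \<Rightarrow> 'a::euclidean_space \<Rightarrow> complex" where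
  "gauss z x = z * complex_of_real (norm x powr - crit_exp TYPE('a)) * exp (- z * complex_of_real ((norm x)\<^sup>2))"

text \<open>For f(r) = z exp(- z r^2) the planar operator - f'' - f'/r gives 4 z (1 - z r^2) f; this
  is that function times |x|^-c.\<close>

definition hardy_gauss :: "complex \<Rightarrow> 'a::euclidean_space \<Rightarrow> complex" where
  "hardy_gauss z x = 4 * z * (1 - z * complex_of_real ((norm x)\<^sup>2)) * gauss z x"

text \<open>The expected value of \<open>hgrad\<close> on the profile: the power |x|^-c is
  annihilated, so only the Gaussian factor is differentiated.\<close>

definition grad_gauss :: "complex \<Rightarrow> 'a::euclidean_space \<Rightarrow> 'a \<Rightarrow> complex" where
  "grad_gauss z b x = - 2 * z * complex_of_real (x \<bullet> b) * gauss z x"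

text \<open>A common square-integrable majorant for the profile, its image under \<open>H\<close>
  and its gradient. The only parameter is a lower bound for Re z, which later permits domination
  uniformly over a time interval.\<close>

definition gauss_bound :: "real \<Rightarrow> 'a::euclidean_space \<Rightarrow> real" where
  "gauss_bound a x = norm x powr - crit_exp TYPE('a) * (1 + (norm x)\<^sup>2) * exp (- a * (norm x)\<^sup>2)"

lemma borel_measurable_gauss [measurable]: "gauss z \<in> borel_measurable borel"
proof -
  have [measurable]: "(exp :: complex \<Rightarrow> complex) \<in> borel_measurable borel"
    by (intro borel_measurable_continuous_onI continuous_intros)
  show ?thesis unfolding gauss_def by measurable
qed

lemma borel_measurable_hardy_gauss [measurable]: "hardy_gauss z \<in> borel_measurable borel"
  unfolding hardy_gauss_def by measurable

lemma borel_measurable_grad_gauss [measurable]: "grad_gauss z b \<in> borel_measurable borel"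
  unfolding grad_gauss_def by measurable

lemma gauss_bound_nonneg: "gauss_bound a x \<ge> 0"
  by (simp add: gauss_bound_def)

lemma two_crit_exp: "2 * crit_exp TYPE('a::euclidean_space) = real DIM('a) - 2"
  by (simp add: crit_exp_def)

lemma integrable_gauss_bound:
  assumes "a > 0" shows "integrable lebesgue (\<lambda>x::'a::euclidean_space. (gauss_bound a x)\<^sup>2)"
proof (rule integrable_radial_bound)
  show "(\<lambda>x::'a. (gauss_bound a x)\<^sup>2) \<in> borel_measurable lebesgue"
    by (rule lebesgue_measurable_borel) (unfold gauss_bound_def, measurable)
  let ?c = "crit_exp TYPE('a)"
  have c2: "(r powr - ?c)\<^sup>2 = r powr - (real DIM('a) - 2)" for r
    using two_crit_exp[where 'a = 'a] by (simp add: power2_eq_square flip: powr_add)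
  show "real DIM('a) - 2 < real DIM('a)" "real DIM('a) + 2 > real DIM('a)" by auto
  fix x :: 'a
  show "norm ((gauss_bound a x)\<^sup>2) \<le> 4 * norm x powr - (real DIM('a) - 2)" if "x \<noteq> 0" "norm x \<le> 1"
  proof -
    have "(norm x)\<^sup>2 \<le> 1" using that by (simp add: power_le_one)
    then have "(1 + (norm x)\<^sup>2) * exp (- a * (norm x)\<^sup>2) \<le> 2 * 1"
      using assms by (intro mult_mono) auto
    then have "((1 + (norm x)\<^sup>2) * exp (- a * (norm x)\<^sup>2))\<^sup>2 \<le> 2\<^sup>2"
      by (intro power_mono) auto
    then have "(norm x powr - ?c)\<^sup>2 * ((1 + (norm x)\<^sup>2) * exp (- a * (norm x)\<^sup>2))\<^sup>2 \<le> (norm x powr - ?c)\<^sup>2 * 2\<^sup>2"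
      by (intro mult_left_mono) auto
    then show ?thesis
      by (simp add: gauss_bound_def power_mult_distrib c2 mult.assoc)
  qed
  show "norm ((gauss_bound a x)\<^sup>2) \<le> 64 / a ^ 4 * norm x powr - (real DIM('a) + 2)" if "norm x \<ge> 1"
  proof -
    let ?r = "norm x"
    have r: "?r > 0" using that by linarith
    \<comment> \<open>The exponent 4 yields decay r^-8. Against (1 + r^2)^2 of order r^4 and the
      factor r^-(n-2) this leaves r^-(n+2), integrable at infinity.\<close>
    have "(2 * a * ?r\<^sup>2) ^ 4 \<le> real 4 ^ 4 * exp (2 * a * ?r\<^sup>2)"
      by (rule power_le_exp) (use assms in simp)
    then have e: "exp (- a * ?r\<^sup>2) ^ 2 \<le> 16 / a ^ 4 / ?r ^ 8"
      using assms r by (simp add: field_simps exp_minus flip: exp_double)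
    have "1 \<le> ?r\<^sup>2" using that by simp
    then have "(1 + ?r\<^sup>2)\<^sup>2 \<le> (2 * ?r\<^sup>2)\<^sup>2" by (intro power_mono) auto
    then have "(1 + ?r\<^sup>2)\<^sup>2 * exp (- a * ?r\<^sup>2) ^ 2 \<le> (2 * ?r\<^sup>2)\<^sup>2 * (16 / a ^ 4 / ?r ^ 8)"
      by (intro mult_mono e) auto
    also have "\<dots> = 64 / a ^ 4 * ?r powr (-4)"
      using r power_add[of ?r 4 4] by (simp add: powr_minus divide_simps)
    finally have "(?r powr - ?c)\<^sup>2 * ((1 + ?r\<^sup>2)\<^sup>2 * exp (- a * ?r\<^sup>2) ^ 2) \<le> (?r powr - ?c)\<^sup>2 * (64 / a ^ 4 * ?r powr (-4))"
      by (intro mult_left_mono) auto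
    also have "\<dots> = 64 / a ^ 4 * ?r powr (- (real DIM('a) + 2))"
    proof -
      have "- (real DIM('a) + 2) = - (real DIM('a) - 2) + (-4)"
        by simp
      then show ?thesis
        unfolding c2 by (simp only: powr_add) simp
    qed
    finally show ?thesis
      by (simp add: gauss_bound_def power_mult_distrib mult.assoc)
  qed
qed

lemma L2_gauss_bound:
  fixes f :: "'a::euclidean_space \<Rightarrow> complex"
  assumes "f \<in> borel_measurable borel" "a > 0" "\<And>x. norm (f x) \<le> K * gauss_bound a x"
  shows "L2 f"
proof (rule L2I_bound[OF lebesgue_measurable_borel[OF assms(1)]])
  show "integrable lebesgue (\<lambda>x::'a. K\<^sup>2 * (gauss_bound a x)\<^sup>2)"
    by (intro integrable_mult_right integrable_gauss_bound assms)
  have "(norm (f x))\<^sup>2 \<le> (K * gauss_bound a x)\<^sup>2" for x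
    by (intro power_mono assms) auto
  then show "AE x in lebesgue. (norm (f x))\<^sup>2 \<le> K\<^sup>2 * (gauss_bound a x)\<^sup>2"
    by (simp add: power_mult_distrib)
qed

lemma norm_gauss:
  "norm (gauss z (x::'a::euclidean_space)) = norm z * (norm x powr - crit_exp TYPE('a) * exp (- Re z * (norm x)\<^sup>2))"
  by (simp add: gauss_def norm_mult)

lemma norm_gauss_mult_le:
  assumes "k \<le> 1 + (norm x)\<^sup>2"
  shows "norm (gauss z x) * k \<le> norm z * gauss_bound (Re z) (x::'a::euclidean_space)"
proof -
  have "norm z * (norm x powr - crit_exp TYPE('a) * exp (- Re z * (norm x)\<^sup>2)) * k
     \<le> norm z * (norm x powr - crit_exp TYPE('a) * exp (- Re z * (norm x)\<^sup>2)) * (1 + (norm x)\<^sup>2)"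
    by (intro mult_left_mono assms) auto
  then show ?thesis by (simp add: norm_gauss gauss_bound_def ac_simps)
qed

lemma norm_gauss_le: "norm (gauss z x) \<le> norm z * gauss_bound (Re z) x"
  using norm_gauss_mult_le[of 1 x z] by simp

lemma norm_hardy_gauss_le:
  "norm (hardy_gauss z x) \<le> 4 * norm z * (1 + norm z) * norm z * gauss_bound (Re z) x"
proof -
  have "norm (1 - z * complex_of_real ((norm x)\<^sup>2)) \<le> 1 + norm z * (norm x)\<^sup>2"
    by (rule order_trans[OF norm_triangle_ineq4]) (simp add: norm_mult norm_power)
  also have "\<dots> \<le> (1 + norm z) * (1 + (norm x)\<^sup>2)"
    by (simp add: algebra_simps)
  finally have "norm (hardy_gauss z x) \<le> 4 * norm z * ((1 + norm z) * (1 + (norm x)\<^sup>2)) * norm (gauss z x)"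
    unfolding hardy_gauss_def norm_mult by (intro mult_mono) auto
  also have "\<dots> = 4 * norm z * (1 + norm z) * (norm (gauss z x) * (1 + (norm x)\<^sup>2))"
    by simp
  also have "\<dots> \<le> 4 * norm z * (1 + norm z) * (norm z * gauss_bound (Re z) x)"
    by (intro mult_left_mono norm_gauss_mult_le) auto
  finally show ?thesis by (simp add: mult.assoc)
qed

lemma norm_grad_gauss_le:
  assumes "b \<in> Basis"
  shows "norm (grad_gauss z b x) \<le> 2 * norm z * norm z * gauss_bound (Re z) x"
proof -
  have "\<bar>x \<bullet> b\<bar> \<le> 1 + (norm x)\<^sup>2"
    using Basis_le_norm[OF assms, of x] sum_squares_bound[of "norm x" 1] by simp
  then have "norm (gauss z x) * \<bar>x \<bullet> b\<bar> \<le> norm z * gauss_bound (Re z) x"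
    by (rule norm_gauss_mult_le)
  then have "2 * norm z * (norm (gauss z x) * \<bar>x \<bullet> b\<bar>) \<le> 2 * norm z * (norm z * gauss_bound (Re z) x)"
    by (intro mult_left_mono) auto
  then show ?thesis
    by (simp add: grad_gauss_def norm_mult ac_simps)
qed

lemma L2_gauss: "Re z > 0 \<Longrightarrow> L2 (gauss z)"
  using norm_gauss_le by (intro L2_gauss_bound) auto

lemma L2_hardy_gauss: "Re z > 0 \<Longrightarrow> L2 (hardy_gauss z)"
  by (rule L2_gauss_bound[OF _ _ norm_hardy_gauss_le]) auto

lemma L2_grad_gauss: "Re z > 0 \<Longrightarrow> b \<in> Basis \<Longrightarrow> L2 (grad_gauss z b)"
  by (rule L2_gauss_bound[OF _ _ norm_grad_gauss_le]) auto

lemma gauss_radial_derivative: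
  fixes x :: "'a::euclidean_space"
  assumes "x \<noteq> 0"
  shows "((\<lambda>l. gauss z (l *\<^sub>R x)) has_vector_derivative
    - (complex_of_real (crit_exp TYPE('a)) + 2 * z * complex_of_real ((norm x)\<^sup>2)) * gauss z x) (at 1)"
proof -
  let ?c = "crit_exp TYPE('a)" and ?r = "norm x"
  have r: "?r > 0" using assms by simp
  have E: "((\<lambda>l. - z * complex_of_real (l\<^sup>2 * ?r\<^sup>2)) has_vector_derivative - z * complex_of_real (2 * ?r\<^sup>2)) (at 1)"
    by (intro has_vector_derivative_mult_right has_vector_derivative_of_real) (auto intro!: derivative_eq_intros)
  have "((\<lambda>l. z * complex_of_real ((l * ?r) powr - ?c) * exp (- z * complex_of_real (l\<^sup>2 * ?r\<^sup>2))) has_vector_derivative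
    z * complex_of_real ((1 * ?r) powr - ?c) * (- z * complex_of_real (2 * ?r\<^sup>2) * exp (- z * complex_of_real (1\<^sup>2 * ?r\<^sup>2)))
    + z * complex_of_real (- ?c * ?r powr - ?c) * exp (- z * complex_of_real (1\<^sup>2 * ?r\<^sup>2))) (at 1)"
  proof (intro has_vector_derivative_mult has_vector_derivative_mult_right has_vector_derivative_of_real)
    show "((\<lambda>l. exp (- z * complex_of_real (l\<^sup>2 * ?r\<^sup>2))) has_vector_derivative
        - z * complex_of_real (2 * ?r\<^sup>2) * exp (- z * complex_of_real (1\<^sup>2 * ?r\<^sup>2))) (at 1)"
      using field_vector_diff_chain_at[OF E DERIV_exp] by (simp add: o_def)
    show "((\<lambda>l. (l * ?r) powr - ?c) has_real_derivative - ?c * ?r powr - ?c) (at 1)"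
      using r by (auto intro!: derivative_eq_intros simp: powr_diff)
  qed
  moreover have "z * complex_of_real ((1 * ?r) powr - ?c) * (- z * complex_of_real (2 * ?r\<^sup>2) * exp (- z * complex_of_real (1\<^sup>2 * ?r\<^sup>2)))
    + z * complex_of_real (- ?c * ?r powr - ?c) * exp (- z * complex_of_real (1\<^sup>2 * ?r\<^sup>2))
    = - (complex_of_real ?c + 2 * z * complex_of_real (?r\<^sup>2)) * gauss z x"
    by (simp add: gauss_def algebra_simps)
  ultimately have "((\<lambda>l. z * complex_of_real ((l * ?r) powr - ?c) * exp (- z * complex_of_real (l\<^sup>2 * ?r\<^sup>2))) has_vector_derivative
      - (complex_of_real ?c + 2 * z * complex_of_real (?r\<^sup>2)) * gauss z x) (at 1)"
    by simp
  then show ?thesis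
    by (rule has_vector_derivative_transform_within_open[where S = "{0<..}"])
      (auto simp: gauss_def power_mult_distrib)
qed

text \<open>The weak form of \<open>H (gauss z) = hardy_gauss z\<close>.\<close>

lemma hgrad_grad_gauss:
  fixes u :: "'a::euclidean_space \<Rightarrow> complex"
  assumes u: "test_fn u" and z: "Re z > 0" and dim: "DIM('a) \<ge> 3"
  shows "(\<Sum>b\<in>Basis. l2inner (hgrad u b) (grad_gauss z b)) = l2inner u (hardy_gauss z)"
proof -
  let ?c = "crit_exp TYPE('a)" and ?n = "DIM('a)"
  let ?du = "\<lambda>x. \<Sum>b\<in>Basis. complex_of_real (x \<bullet> b) * frechet_derivative u (at x) b"
  \<comment> \<open>Chosen so that the conjugate of \<open>grad_gauss z b\<close> is
    \<open>k\<close> times the b-th coordinate. The argument then repeats the divergence trick, with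
    \<open>g\<close> = \<open>k u\<close> and \<open>e\<close> its radial derivative.\<close>
  define k where "k x = -2 * cnj z * cnj (gauss z x)" for x :: 'a
  define g where "g x = k x * u x" for x
  define e where "e x = k x * ?du x - (complex_of_real ?c + 2 * cnj z * complex_of_real ((norm x)\<^sup>2)) * g x" for x
  obtain R K where R: "R > 0" "K > 0" "\<And>x. R < norm x \<Longrightarrow> u x = 0"
    "\<And>x b. R < norm x \<Longrightarrow> frechet_derivative u (at x) b = 0"
    "\<And>x. norm (u x) \<le> K" "\<And>x b. b \<in> Basis \<Longrightarrow> norm (frechet_derivative u (at x) b) \<le> K"
    using test_fn_bounds[OF u] by metis
  note [measurable] = borel_measurable_test_fn[OF u] borel_measurable_test_fn_partial[OF u]
  define B where "B = 2 * norm z * norm z"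
  have k_bound: "norm (k x) \<le> B * norm x powr - ?c" for x
  proof -
    have "exp (- Re z * (norm x)\<^sup>2) \<le> 1" using z by simp
    then have "B * norm x powr - ?c * exp (- Re z * (norm x)\<^sup>2) \<le> B * norm x powr - ?c * 1"
      by (intro mult_left_mono) (auto simp: B_def)
    then show ?thesis by (simp add: k_def norm_mult norm_gauss B_def ac_simps)
  qed
  define M where "M = B * (R * (real ?n * K)) + (\<bar>?c\<bar> + 2 * norm z * R\<^sup>2 + 1) * (B * K)"
  have B0: "B \<ge> 0" by (simp add: B_def)
  have c0: "?c \<ge> 0" using dim by (simp add: crit_exp_def)
  have M0: "M \<ge> 0" unfolding M_def using R B0 by (intro add_nonneg_nonneg mult_nonneg_nonneg) auto
  have gB: "norm (g x) \<le> norm x powr - ?c * (B * K)" for x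
  proof -
    have "norm (k x) * norm (u x) \<le> (B * norm x powr - ?c) * K"
      by (rule mult_mono[OF k_bound R(5)]) (use B0 in auto)
    then show ?thesis by (simp add: g_def norm_mult ac_simps)
  qed
  have B1: "B * K \<le> M"
  proof -
    have "1 * (B * K) \<le> (\<bar>?c\<bar> + 2 * norm z * R\<^sup>2 + 1) * (B * K)"
      using R B0 by (intro mult_right_mono) auto
    moreover have "0 \<le> B * (R * (real ?n * K))"
      using R B0 by (intro mult_nonneg_nonneg) auto
    ultimately show ?thesis unfolding M_def by linarith
  qed
  have g_bound: "norm (g x) \<le> M * (norm x powr (- ?c) * indicator {..R} (norm x))" if x: "x \<noteq> 0" for x
  proof (cases "norm x \<le> R")
    case True
    have "norm x powr - ?c * (B * K) \<le> norm x powr - ?c * M"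
      by (intro mult_left_mono B1) auto
    with gB[of x] True show ?thesis by (simp add: mult.commute)
  qed (use R(3)[of x] M0 in \<open>auto simp: g_def\<close>)
  have e_bound: "norm (e x) \<le> M * (norm x powr (- ?c) * indicator {..R} (norm x))" if x: "x \<noteq> 0" for x
  proof (cases "norm x \<le> R")
    case False
    then show ?thesis using R(3,4)[of x] M0 by (simp add: e_def g_def)
  next
    case True
    have du: "norm (?du x) \<le> R * (real ?n * K)"
      by (rule order_trans[OF norm_radial_sum_le[OF R(6)] mult_right_mono[OF True]]) (use R in auto)
    have 1: "norm (k x * ?du x) \<le> (B * norm x powr - ?c) * (R * (real ?n * K))"
      unfolding norm_mult by (rule mult_mono[OF k_bound du]) (use B0 in auto)
    have "norm (complex_of_real ?c + 2 * cnj z * complex_of_real ((norm x)\<^sup>2)) \<le> \<bar>?c\<bar> + 2 * norm z * (norm x)\<^sup>2"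
      by (rule order_trans[OF norm_triangle_ineq])
        (simp only: norm_mult norm_of_real complex_mod_cnj norm_numeral abs_power2 order_refl)
    also have "\<dots> \<le> \<bar>?c\<bar> + 2 * norm z * R\<^sup>2"
      using True by (intro add_left_mono mult_left_mono power_mono) auto
    finally have "norm (complex_of_real ?c + 2 * cnj z * complex_of_real ((norm x)\<^sup>2)) \<le> \<bar>?c\<bar> + 2 * norm z * R\<^sup>2 + 1"
      by linarith
    then have 2: "norm ((complex_of_real ?c + 2 * cnj z * complex_of_real ((norm x)\<^sup>2)) * g x)
       \<le> (\<bar>?c\<bar> + 2 * norm z * R\<^sup>2 + 1) * (norm x powr - ?c * (B * K))"
      unfolding norm_mult[of _ "g x"] using gB by (intro mult_mono) auto
    have "norm (e x) \<le> (B * norm x powr - ?c) * (R * (real ?n * K)) + (\<bar>?c\<bar> + 2 * norm z * R\<^sup>2 + 1) * (norm x powr - ?c * (B * K))"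
      unfolding e_def by (rule order_trans[OF norm_triangle_ineq4 add_mono[OF 1 2]])
    also have "\<dots> = M * norm x powr - ?c"
      by (simp add: M_def algebra_simps)
    finally show ?thesis using True by simp
  qed
  have deriv: "((\<lambda>l. g (l *\<^sub>R x)) has_vector_derivative e x) (at 1)" if "x \<noteq> 0" for x
  proof -
    have "((\<lambda>l. -2 * cnj z * cnj (gauss z (l *\<^sub>R x)) * u (l *\<^sub>R x)) has_vector_derivative
        -2 * cnj z * cnj (gauss z (1 *\<^sub>R x)) * ?du x +
        -2 * cnj z * cnj (- (complex_of_real ?c + 2 * z * complex_of_real ((norm x)\<^sup>2)) * gauss z x) * u (1 *\<^sub>R x)) (at 1)"
      by (intro has_vector_derivative_mult has_vector_derivative_mult_right
        bounded_linear.has_vector_derivative[OF bounded_linear_cnj] test_fn_radial_derivative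
        gauss_radial_derivative u that)
    moreover have "-2 * cnj z * cnj (gauss z (1 *\<^sub>R x)) * ?du x +
        -2 * cnj z * cnj (- (complex_of_real ?c + 2 * z * complex_of_real ((norm x)\<^sup>2)) * gauss z x) * u (1 *\<^sub>R x) = e x"
      by (simp add: e_def g_def k_def algebra_simps)
    ultimately show ?thesis by (simp add: g_def[abs_def] k_def)
  qed
  have "(\<lambda>x::'a. cnj (gauss z x)) \<in> borel_measurable borel"
    by (rule measurable_compose[OF borel_measurable_gauss]) (intro borel_measurable_continuous_onI continuous_intros)
  then have [measurable]: "k \<in> borel_measurable borel"
    unfolding k_def by (intro borel_measurable_times borel_measurable_const)
  have gm [measurable]: "g \<in> borel_measurable borel" unfolding g_def by measurable
  have em: "e \<in> borel_measurable borel" unfolding e_def by measurable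
  have cn: "?c < real ?n" by (simp add: crit_exp_def)
  have R0: "0 \<le> R" using R by simp
  have div: "integrable lebesgue g" "integrable lebesgue e" "(\<integral>x. e x \<partial>lebesgue) = - of_nat ?n * (\<integral>x. g x \<partial>lebesgue)"
    by (rule integral_radial_derivative[OF gm em deriv c0 cn R0 g_bound e_bound]; assumption)+
  \<comment> \<open>The left side is k times the radial derivative of u, plus c g. Taking away the
    divergence e + n g leaves - 2 (1 - cnj z |x|^2) g because n = 2 c + 2, and that is the pairing
    density with \<open>hardy_gauss\<close>.\<close>
  have eq: "(\<Sum>b\<in>Basis. hgrad u b x * cnj (grad_gauss z b x)) = (e x + of_nat ?n * g x) + u x * cnj (hardy_gauss z x)" for x
  proof -
    let ?i = "complex_of_real (inverse ((norm x)\<^sup>2))" and ?C = "complex_of_real ?c"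
    have "(\<Sum>b\<in>Basis. hgrad u b x * cnj (grad_gauss z b x)) =
       (\<Sum>b\<in>Basis. 0 + k x * ((complex_of_real (x \<bullet> b) * frechet_derivative u (at x) b) * 1 + 0 * cnj 0)
         + ?C * ?i * (complex_of_real (x \<bullet> b) * complex_of_real (x \<bullet> b)) * g x)"
      by (rule sum.cong) (auto simp: hgrad_def grad_gauss_def g_def k_def divide_inverse algebra_simps)
    also have "\<dots> = k x * ?du x + ?C * ?i * complex_of_real ((norm x)\<^sup>2) * g x"
      unfolding sum_mult_split sum_Basis_inner_square by simp
    also have "?C * ?i * complex_of_real ((norm x)\<^sup>2) * g x = ?C * g x"
      by (cases "x = 0") (auto simp: g_def k_def gauss_def field_simps)
    finally have "(\<Sum>b\<in>Basis. hgrad u b x * cnj (grad_gauss z b x)) = k x * ?du x + ?C * g x" .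
    moreover have "of_nat ?n = 2 * ?C + 2"
    proof -
      have "real ?n = 2 * ?c + 2" by (simp add: crit_exp_def field_simps)
      then have "complex_of_real (real ?n) = complex_of_real (2 * ?c + 2)" by (rule arg_cong)
      then show ?thesis by simp
    qed
    moreover have "u x * cnj (hardy_gauss z x) = - 2 * (1 - cnj z * complex_of_real ((norm x)\<^sup>2)) * g x"
    proof -
      have "cnj (hardy_gauss z x) = 4 * cnj z * (1 - cnj z * complex_of_real ((norm x)\<^sup>2)) * cnj (gauss z x)"
        unfolding hardy_gauss_def
        by (simp only: complex_cnj_mult complex_cnj_diff complex_cnj_one complex_cnj_numeral complex_cnj_complex_of_real)
      then show ?thesis unfolding g_def k_def by algebra
    qed
    ultimately show ?thesis by (simp add: e_def algebra_simps)
  qed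
  have int: "integrable lebesgue (\<lambda>x. hgrad u b x * cnj (grad_gauss z b x))" if "b \<in> Basis" for b
    using that by (intro L2_mult_integrable L2_hgrad L2_grad_gauss u z dim)
  have int2: "integrable lebesgue (\<lambda>x. u x * cnj (hardy_gauss z x))"
    by (intro L2_mult_integrable L2_test_fn L2_hardy_gauss u z)
  have "(\<Sum>b\<in>Basis. l2inner (hgrad u b) (grad_gauss z b)) = (\<integral>x. (\<Sum>b\<in>Basis. hgrad u b x * cnj (grad_gauss z b x)) \<partial>lebesgue)"
    unfolding l2inner_def by (rule Bochner_Integration.integral_sum[OF int, symmetric])
  also have "\<dots> = (\<integral>x. e x + of_nat ?n * g x \<partial>lebesgue) + l2inner u (hardy_gauss z)"
    unfolding eq l2inner_def using div int2
    by (intro Bochner_Integration.integral_add integrable_mult_right Bochner_Integration.integrable_add) auto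
  also have "(\<integral>x. e x + of_nat ?n * g x \<partial>lebesgue) = 0"
    using div by simp
  finally show ?thesis by simp
qed

section \<open>Approximation of Gaussian profiles in the form norm\<close>

definition gauss_approx :: "real \<Rightarrow> complex \<Rightarrow> 'a::euclidean_space \<Rightarrow> complex" where
  "gauss_approx m z x = complex_of_real (log_cutoff m ((norm x)\<^sup>2)) * gauss z x"

text \<open>The profile in the variable s = |x|^2, as \<open>Ck_radial\<close> wants it.\<close>

definition gauss_profile :: "real \<Rightarrow> complex \<Rightarrow> real \<Rightarrow> complex" where
  "gauss_profile c z s = z * complex_of_real (s powr (- c / 2)) * exp (- z * complex_of_real s)"

lemma gauss_eq_profile: "x \<noteq> 0 \<Longrightarrow> gauss z (x::'a::euclidean_space) = gauss_profile (crit_exp TYPE('a)) z ((norm x)\<^sup>2)"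
  by (simp add: gauss_def gauss_profile_def powr_powr flip: powr_numeral)

lemma gauss_profile_has_derivative:
  assumes "s > 0"
  shows "(gauss_profile c z has_vector_derivative
    - (complex_of_real (c / (2 * s)) + z) * gauss_profile c z s) (at s)"
proof -
  have E: "((\<lambda>l. - z * complex_of_real l) has_vector_derivative - z * complex_of_real 1) (at s)"
    by (intro has_vector_derivative_mult_right has_vector_derivative_of_real) (auto intro!: derivative_eq_intros)
  have "((\<lambda>s. z * complex_of_real (s powr (- c / 2)) * exp (- z * complex_of_real s)) has_vector_derivative
    z * complex_of_real (s powr (- c / 2)) * (- z * complex_of_real 1 * exp (- z * complex_of_real s))
    + z * complex_of_real ((- c / (2 * s)) * s powr (- c / 2)) * exp (- z * complex_of_real s)) (at s)"
  proof (intro has_vector_derivative_mult has_vector_derivative_mult_right has_vector_derivative_of_real)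
    show "((\<lambda>s. exp (- z * complex_of_real s)) has_vector_derivative - z * complex_of_real 1 * exp (- z * complex_of_real s)) (at s)"
      using field_vector_diff_chain_at[OF E DERIV_exp] by (simp add: o_def)
    show "((\<lambda>s. s powr (- c / 2)) has_real_derivative - c / (2 * s) * s powr (- c / 2)) (at s)"
      using assms by (auto intro!: derivative_eq_intros simp: powr_diff)
  qed
  moreover have "z * complex_of_real (s powr (- c / 2)) * (- z * complex_of_real 1 * exp (- z * complex_of_real s))
    + z * complex_of_real ((- c / (2 * s)) * s powr (- c / 2)) * exp (- z * complex_of_real s)
    = - (complex_of_real (c / (2 * s)) + z) * gauss_profile c z s"
    unfolding gauss_profile_def by (simp only: of_real_mult of_real_minus of_real_1 minus_divide_left[symmetric]) algebra
  ultimately show ?thesis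
    unfolding gauss_profile_def[abs_def] by simp
qed

lemma Dk_gauss_profile: "Dk k {0<..} (gauss_profile c z)"
  unfolding gauss_profile_def[abs_def]
  by (rule Dk_mult[OF Dk_mult[OF Dk_const Dk_of_real[OF Dk_powr]] Dk_exp])

text \<open>The one-variable profile is smooth for s > 0 and vanishes identically for s < exp(-m);
  these two open sets cover the line, so \<open>Dk_Un\<close> glues. Vanishing beyond exp(m) gives
  the compact support.\<close>

lemma test_fn_gauss_approx:
  fixes z :: complex
  assumes "m > 0" shows "test_fn (gauss_approx m z :: 'a::euclidean_space \<Rightarrow> complex)"
proof -
  let ?c = "crit_exp TYPE('a)"
  \<comment> \<open>The case distinction agrees with \<open>gauss_approx\<close> at the origin,
    where \<open>gauss\<close> is 0 because \<open>0 powr a\<close> is 0, whatever value the cutoff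
    has there.\<close>
  define g where "g s = (if s > 0 then complex_of_real (log_cutoff m s) * gauss_profile ?c z s else 0)" for s
  have eq: "gauss_approx m z = (\<lambda>x::'a. g ((norm x)\<^sup>2))"
    by (auto simp: fun_eq_iff g_def gauss_approx_def gauss_eq_profile) (simp add: gauss_def)
  have g0: "g s = 0" if "s \<le> exp (-m) \<or> s \<ge> exp m" for s
    using log_cutoff_eq_0[OF assms _ that] by (auto simp: g_def)
  have "Dk k UNIV g" for k
  proof -
    have "Dk k {0<..} (\<lambda>s. complex_of_real (log_cutoff m s) * gauss_profile ?c z s)"
      by (rule Dk_mult[OF Dk_of_real[OF Dk_log_cutoff] Dk_gauss_profile])
    then have "Dk k {0<..} g"
      by (rule Dk_cong[rotated]) (auto simp: g_def)
    moreover have "Dk k {..<exp (-m)} g"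
      by (rule Dk_cong[OF _ Dk_const[of _ _ 0]]) (use g0 in auto)
    ultimately have "Dk k ({0<..} \<union> {..<exp (-m)}) g"
      by (intro Dk_Un) auto
    moreover have "{0<..} \<union> {..<exp (-m)} = UNIV"
      by (auto simp: not_less intro: le_less_trans)
    ultimately show ?thesis by simp
  qed
  then have "Ck k (gauss_approx m z :: 'a \<Rightarrow> complex)" for k
    unfolding eq by (rule Ck_radial)
  moreover have "bounded {x::'a. gauss_approx m z x \<noteq> 0}"
  proof (rule boundedI)
    fix x :: 'a assume "x \<in> {x. gauss_approx m z x \<noteq> 0}"
    then have "(norm x)\<^sup>2 \<le> exp m" using g0[of "(norm x)\<^sup>2"] unfolding eq by force
    then show "norm x \<le> sqrt (exp m)" by (rule real_le_rsqrt)
  qed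
  ultimately show ?thesis
    unfolding test_fn_def by (simp only: compact_closure) blast
qed

definition log_cutoff_deriv :: "real \<Rightarrow> real \<Rightarrow> real" where
  "log_cutoff_deriv m s = - 2 * exp 1 * bump 2 (1 - (ln s / m)\<^sup>2) * (ln s / m) / (m * s)"

lemma hgrad_gauss_approx:
  fixes x :: "'a::euclidean_space"
  assumes "m > 0" "x \<noteq> 0"
  shows "hgrad (gauss_approx m z) b x =
    complex_of_real (log_cutoff m ((norm x)\<^sup>2)) * grad_gauss z b x
    + complex_of_real (2 * (x \<bullet> b) * log_cutoff_deriv m ((norm x)\<^sup>2)) * gauss z x"
proof -
  let ?c = "crit_exp TYPE('a)"
  let ?s = "(norm x)\<^sup>2"
  let ?L = "complex_of_real (log_cutoff m ?s)" and ?D = "complex_of_real (log_cutoff_deriv m ?s)"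
  let ?P = "gauss_profile ?c z ?s"
  have s: "?s > 0" using assms by simp
  define d where "d = ?L * (- (complex_of_real (?c / (2 * ?s)) + z) * ?P) + ?D * ?P"
  have "((\<lambda>s. complex_of_real (log_cutoff m s) * gauss_profile ?c z s) has_vector_derivative d) (at ?s)"
    unfolding d_def
    by (intro has_vector_derivative_mult has_vector_derivative_of_real gauss_profile_has_derivative s)
       (use log_cutoff_has_derivative[OF assms(1) s] in \<open>simp add: log_cutoff_deriv_def\<close>)
  from radial_has_derivative[OF this]
  have "(gauss_approx m z has_derivative (\<lambda>h. complex_of_real (2 * (x \<bullet> h)) * d)) (at x)"
    by (rule has_derivative_transform_within_open[where s = "- {0}"])
      (use assms in \<open>auto simp: gauss_approx_def gauss_eq_profile\<close>)
  from frechet_derivative_at[OF this, symmetric]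
  have "hgrad (gauss_approx m z) b x = complex_of_real (2 * (x \<bullet> b)) * d
     + complex_of_real (?c * (x \<bullet> b) / ?s) * (?L * ?P)"
    using assms by (simp add: hgrad_def gauss_approx_def gauss_eq_profile)
  \<comment> \<open>The singular part c / (2 s) of the profile's derivative cancels against the
    potential term of \<open>hgrad\<close>.\<close>
  also have "\<dots> = ?L * (- 2 * z * complex_of_real (x \<bullet> b) * ?P) + complex_of_real (2 * (x \<bullet> b)) * ?D * ?P"
    using s unfolding d_def by (simp add: field_simps)
  finally show ?thesis
    using assms by (simp add: grad_gauss_def gauss_eq_profile mult.assoc)
qed

text \<open>In the radius this is the integral of r^-n r^(n-1) = 1/r from exp(-m/2) to exp(m/2), the
  logarithmic length m. The linear growth is outweighed by the factor 1/m^2 from the squared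
  derivative of the cutoff.\<close>

lemma integral_annulus:
  assumes "m \<ge> 0"
  shows "integrable lebesgue (\<lambda>x::'a::euclidean_space. norm x powr - real DIM('a) * indicator {exp (-m)..exp m} ((norm x)\<^sup>2))"
    and "(\<integral>x. norm (x::'a::euclidean_space) powr - real DIM('a) * indicator {exp (-m)..exp m} ((norm x)\<^sup>2) \<partial>lebesgue)
      = sphere_vol TYPE('a) * m"
proof -
  let ?n = "DIM('a)"
  let ?h = "\<lambda>r::real. r powr - real ?n * indicator {exp (-m)..exp m} (r\<^sup>2)"
  have ind: "indicator {exp (-m)..exp m} (r\<^sup>2) = (indicator {exp (-m/2)..exp (m/2)} r :: real)" if "r \<ge> 0" for r :: real
  proof -
    have "exp (-m) = (exp (-m/2))\<^sup>2" "exp m = (exp (m/2))\<^sup>2"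
      by (simp_all flip: exp_double)
    then show ?thesis
      using that by (simp add: indicator_def power2_le_iff_abs_le abs_le_square_iff[symmetric])
  qed
  have "(\<integral>\<^sup>+r. ennreal (r ^ (?n - 1)) * indicator {0..} r * ennreal (?h r) \<partial>lborel)
     = (\<integral>\<^sup>+r. ennreal (inverse r) * indicator {exp (-m/2)..exp (m/2)} r \<partial>lborel)"
  proof (rule nn_integral_cong)
    fix r :: real
    show "ennreal (r ^ (?n - 1)) * indicator {0..} r * ennreal (?h r) = ennreal (inverse r) * indicator {exp (-m/2)..exp (m/2)} r"
    proof (cases "r > 0")
      case True
      then show ?thesis
        using power_pred_mult_powr[where 'a = 'a, OF refl True, of "- real ?n"] ind[of r]
        by (simp add: ennreal_mult[symmetric] powr_minus indicator_def)
    next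
      case False
      then have "r \<notin> {exp (-m/2)..exp (m/2)}"
        using exp_gt_zero[of "-m/2"] by (auto simp del: exp_gt_zero)
      then show ?thesis using False by (cases "r = 0") auto
    qed
  qed
  also have "\<dots> = ennreal (ln (exp (m/2)) - ln (exp (-m/2)))"
  proof (rule nn_integral_FTC_Icc)
    fix r assume "r \<in> {exp (-m/2)..exp (m/2)}"
    then have "r > 0" using exp_gt_zero[of "-m/2"] by (auto simp del: exp_gt_zero)
    then show "(ln has_real_derivative inverse r) (at r)" "0 \<le> inverse r"
      by (auto intro!: derivative_eq_intros simp: divide_inverse)
  qed (use assms in auto)
  finally have nn: "(\<integral>\<^sup>+x. ennreal (?h (norm (x::'a))) \<partial>lebesgue) = ennreal (sphere_vol TYPE('a) * m)"
    using assms by (subst nn_integral_radial) (auto simp: ennreal_mult)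
  have meas: "(\<lambda>x::'a. ?h (norm x)) \<in> borel_measurable lebesgue"
    by (rule lebesgue_measurable_borel) measurable
  show "integrable lebesgue (\<lambda>x::'a. ?h (norm x))"
    by (rule integrableI_nonneg[OF meas]) (auto simp: nn)
  show "(\<integral>x. ?h (norm (x::'a)) \<partial>lebesgue) = sphere_vol TYPE('a) * m"
    by (rule integral_eq_nn_integral[OF meas, THEN trans]) (use assms in \<open>auto simp: nn\<close>)
qed

lemma gauss_approx_tendsto:
  assumes "Re z > 0"
  shows "(\<lambda>k. L2norm (\<lambda>x::'a::euclidean_space. gauss_approx (real (Suc k)) z x - gauss z x)) \<longlonglongrightarrow> 0"
proof (rule L2norm_tendsto_0_dominated)
  let ?L = "\<lambda>k x. complex_of_real (log_cutoff (real (Suc k)) ((norm (x::'a))\<^sup>2))"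
  have eq: "gauss_approx (real (Suc k)) z x - gauss z x = (?L k x - 1) * gauss z x" for k x
    by (simp add: gauss_approx_def algebra_simps)
  show "integrable lebesgue (\<lambda>x::'a. (norm (gauss z x))\<^sup>2)"
    using L2_gauss[OF assms] by (rule L2_integrable)
  show "(\<lambda>x::'a. gauss_approx (real (Suc k)) z x - gauss z x) \<in> borel_measurable lebesgue" for k
    using L2_gauss[OF assms] L2_test_fn[OF test_fn_gauss_approx[of "real (Suc k)" z]]
    by (auto intro!: borel_measurable_diff simp: L2_def)
  have "norm (?L k x - 1) \<le> 1" for k x
  proof -
    have "norm (?L k x - 1) = \<bar>log_cutoff (real (Suc k)) ((norm x)\<^sup>2) - 1\<bar>"
      by (metis norm_of_real of_real_1 of_real_diff)
    then show ?thesis using log_cutoff_bounds[of "real (Suc k)" "(norm x)\<^sup>2"] by simp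
  qed
  then have "norm (?L k x - 1) * norm (gauss z x) \<le> 1 * norm (gauss z x)" for k x
    by (intro mult_right_mono) auto
  then have "(norm (gauss_approx (real (Suc k)) z x - gauss z x))\<^sup>2 \<le> (norm (gauss z x))\<^sup>2" for k and x :: 'a
    unfolding eq norm_mult by (intro power_mono) auto
  then show "AE x in lebesgue. (norm (gauss_approx (real (Suc k)) z x - gauss z (x::'a)))\<^sup>2 \<le> (norm (gauss z x))\<^sup>2" for k
    by simp
  have "(\<lambda>k. (?L k x - 1) * gauss z x) \<longlonglongrightarrow> (complex_of_real 1 - 1) * gauss z x" for x
    by (intro tendsto_intros log_cutoff_tendsto)
  then show "AE x::'a in lebesgue. (\<lambda>k. gauss_approx (real (Suc k)) z x - gauss z x) \<longlonglongrightarrow> 0"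
    unfolding eq by simp
qed

text \<open>The error splits into \<open>A\<close>, the cutoff error times the gradient, which tends
  to zero by domination, and \<open>B\<close>, in which the cutoff is differentiated. The square of
  \<open>B\<close> is at most of order |x|^-n / m^2 on the logarithmic annulus, hence has integral
  of order 1/m.\<close>

lemma hgrad_gauss_approx_tendsto:
  assumes z: "Re z > 0" and dim: "DIM('a::euclidean_space) \<ge> 3" and b: "b \<in> Basis"
  shows "(\<lambda>k. L2norm (\<lambda>x::'a. hgrad (gauss_approx (real (Suc k)) z) b x - grad_gauss z b x)) \<longlonglongrightarrow> 0"
proof -
  let ?c = "crit_exp TYPE('a)"
  define A where "A k x = complex_of_real (log_cutoff (real (Suc k)) ((norm x)\<^sup>2) - 1) * grad_gauss z b x" for k and x :: 'a
  define B where "B k x = complex_of_real (2 * (x \<bullet> b) * log_cutoff_deriv (real (Suc k)) ((norm x)\<^sup>2)) * gauss z x" for k and x :: 'a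
  \<comment> \<open>256 is the square of 2 times 8: the 2 from differentiating |x|^2, the 8 from
    \<open>log_cutoff_derivative_bound\<close>. The sphere volume comes from
    \<open>integral_annulus\<close>.\<close>
  define V where "V = 256 * (exp 1)\<^sup>2 * (norm z)\<^sup>2 * sphere_vol TYPE('a)"
  have bm [measurable]: "bump j \<in> borel_measurable borel" for j
    using continuous_bump by (intro borel_measurable_continuous_onI continuous_at_imp_continuous_on) auto
  have Am: "A k \<in> borel_measurable lebesgue" for k
    unfolding A_def by (rule lebesgue_measurable_borel) (unfold log_cutoff_def, measurable)
  have Bm: "B k \<in> borel_measurable lebesgue" for k
    unfolding B_def by (rule lebesgue_measurable_borel) (unfold log_cutoff_deriv_def, measurable)
  have AE: "AE x in lebesgue. hgrad (gauss_approx (real (Suc k)) z) b x - grad_gauss z b x = A k x + B k x" for k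
    using AE_lebesgue_nonzero
    by eventually_elim (simp add: A_def B_def hgrad_gauss_approx algebra_simps)
  have A_le: "norm (A k x) \<le> norm (grad_gauss z b x)" for k x
  proof -
    have "\<bar>log_cutoff (real (Suc k)) ((norm x)\<^sup>2) - 1\<bar> * norm (grad_gauss z b x) \<le> 1 * norm (grad_gauss z b x)"
      using log_cutoff_bounds[of "real (Suc k)" "(norm x)\<^sup>2"] by (intro mult_right_mono) auto
    then show ?thesis by (simp add: A_def norm_mult del: of_real_diff)
  qed
  have LG: "integrable lebesgue (\<lambda>x::'a. (norm (grad_gauss z b x))\<^sup>2)"
    by (rule L2_integrable[OF L2_grad_gauss[OF z b]])
  have A0: "(\<lambda>k. L2norm (A k)) \<longlonglongrightarrow> 0"
  proof (rule L2norm_tendsto_0_dominated[OF Am LG])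
    show "AE x in lebesgue. (norm (A k x))\<^sup>2 \<le> (norm (grad_gauss z b x))\<^sup>2" for k
      using A_le by (intro AE_I2 power_mono) auto
    have "(\<lambda>k. A k x) \<longlonglongrightarrow> complex_of_real (1 - 1) * grad_gauss z b x" for x
      unfolding A_def by (intro tendsto_intros log_cutoff_tendsto)
    then show "AE x in lebesgue. (\<lambda>k. A k x) \<longlonglongrightarrow> 0" by simp
  qed
  let ?i = "\<lambda>k (x::'a). norm x powr - real DIM('a) * indicator {exp (- real (Suc k))..exp (real (Suc k))} ((norm x)\<^sup>2)"
  have B_le: "(norm (B k x))\<^sup>2 \<le> 256 * (exp 1)\<^sup>2 * (norm z)\<^sup>2 / (real (Suc k))\<^sup>2 * ?i k x" if x: "x \<noteq> 0" for k x
  proof -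
    let ?m = "real (Suc k)" and ?s = "(norm x)\<^sup>2"
    let ?I = "indicator {exp (- ?m)..exp ?m} ?s :: real"
    have s: "?s > 0" using x by simp
    have 1: "\<bar>log_cutoff_deriv ?m ?s\<bar> \<le> 8 * exp 1 / (?m * ?s) * ?I"
      unfolding log_cutoff_deriv_def by (rule log_cutoff_derivative_bound) (use s in auto)
    have 2: "norm (gauss z x) \<le> norm z * norm x powr - ?c"
    proof -
      have "norm x powr - ?c * exp (- Re z * (norm x)\<^sup>2) \<le> norm x powr - ?c * 1"
        using z by (intro mult_left_mono) auto
      then show ?thesis unfolding norm_gauss by (intro mult_left_mono) auto
    qed
    have "norm (B k x) = 2 * \<bar>x \<bullet> b\<bar> * \<bar>log_cutoff_deriv ?m ?s\<bar> * norm (gauss z x)"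
      by (simp only: B_def norm_mult norm_of_real abs_mult abs_numeral)
    also have "\<dots> \<le> 2 * norm x * (8 * exp 1 / (?m * ?s) * ?I) * (norm z * norm x powr - ?c)"
      using Basis_le_norm[OF b, of x] by (intro mult_mono 1 2) auto
    finally have "(norm (B k x))\<^sup>2 \<le> (2 * norm x * (8 * exp 1 / (?m * ?s) * ?I) * (norm z * norm x powr - ?c))\<^sup>2"
      by (intro power_mono) auto
    also have "\<dots> = 256 * (exp 1)\<^sup>2 * (norm z)\<^sup>2 / ?m\<^sup>2 * (inverse ?s * (norm x powr - ?c)\<^sup>2 * ?I)"
    proof -
      have I: "?I\<^sup>2 = ?I" by (simp add: indicator_def)
      have "(2 * norm x * (8 * exp 1 / (?m * ?s) * ?I) * (norm z * norm x powr - ?c))\<^sup>2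
          = 256 * (exp 1)\<^sup>2 * (norm z)\<^sup>2 / ?m\<^sup>2 * (?s / ?s\<^sup>2 * (norm x powr - ?c)\<^sup>2 * ?I)"
        by (simp only: power_mult_distrib power_divide I) simp
      also have "a / a\<^sup>2 = inverse a" if "a > 0" for a :: real
        using that by (simp add: power2_eq_square divide_inverse)
      note this[OF s]
      finally show ?thesis .
    qed
    also have "inverse ?s * (norm x powr - ?c)\<^sup>2 = norm x powr (-2 + - ?c + - ?c)"
      unfolding powr_add using x by (simp add: powr_minus power2_eq_square)
    also have "-2 + - ?c + - ?c = - real DIM('a)"
      using two_crit_exp[where 'a = 'a] by simp
    finally show ?thesis .
  qed
  have B_AE: "AE x in lebesgue. (norm (B k x))\<^sup>2 \<le> 256 * (exp 1)\<^sup>2 * (norm z)\<^sup>2 / (real (Suc k))\<^sup>2 * ?i k x" for k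
    using AE_lebesgue_nonzero by eventually_elim (rule B_le)
  have L2B: "L2 (B k)" for k
    by (rule L2I_bound[OF Bm integrable_mult_right[OF integral_annulus(1)[OF of_nat_0_le_iff]] B_AE])
  have L2A: "L2 (A k)" for k
    by (rule L2I_bound[OF Am LG]) (use A_le in \<open>auto intro!: power_mono\<close>)
  have B_norm: "(L2norm (B k))\<^sup>2 \<le> V * inverse (real (Suc k))" for k
  proof -
    have "(L2norm (B k))\<^sup>2 \<le> (\<integral>x. 256 * (exp 1)\<^sup>2 * (norm z)\<^sup>2 / (real (Suc k))\<^sup>2 * ?i k x \<partial>lebesgue)"
      unfolding L2norm_square
      by (rule integral_mono_AE[OF L2_integrable[OF L2B] integrable_mult_right[OF integral_annulus(1)[OF of_nat_0_le_iff]] B_AE])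
    also have "\<dots> = 256 * (exp 1)\<^sup>2 * (norm z)\<^sup>2 / (real (Suc k))\<^sup>2 * (sphere_vol TYPE('a) * real (Suc k))"
      by (subst Bochner_Integration.integral_mult_right_zero) (simp only: integral_annulus(2)[OF of_nat_0_le_iff])
    also have "\<dots> = V * inverse (real (Suc k))"
      unfolding V_def by (simp add: power2_eq_square divide_inverse)
    finally show ?thesis .
  qed
  have "(\<lambda>k. (L2norm (B k))\<^sup>2) \<longlonglongrightarrow> 0"
  proof (rule tendsto_sandwich[OF _ _ tendsto_const])
    show "(\<lambda>k. V * inverse (real (Suc k))) \<longlonglongrightarrow> 0"
      by (rule tendsto_mult_right_zero[OF LIMSEQ_inverse_real_of_nat])
  qed (use B_norm in auto)
  then have B0: "(\<lambda>k. L2norm (B k)) \<longlonglongrightarrow> 0"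
    using tendsto_real_sqrt by fastforce
  have le: "L2norm (\<lambda>x::'a. hgrad (gauss_approx (real (Suc k)) z) b x - grad_gauss z b x) \<le> L2norm (A k) + L2norm (B k)" for k
  proof -
    have "L2norm (\<lambda>x::'a. hgrad (gauss_approx (real (Suc k)) z) b x - grad_gauss z b x) = L2norm (\<lambda>x. A k x + B k x)"
      by (rule L2norm_cong_AE[OF L2_diff[OF L2_hgrad[OF test_fn_gauss_approx b dim] L2_grad_gauss[OF z b]] L2_add[OF L2A L2B] AE]) simp
    then show ?thesis using L2norm_triangle[OF L2A L2B] by simp
  qed
  show ?thesis
  proof (rule tendsto_sandwich[OF _ _ tendsto_const])
    show "(\<lambda>k. L2norm (A k) + L2norm (B k)) \<longlonglongrightarrow> 0"
      using tendsto_add[OF A0 B0] by simp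
  qed (use le in auto)
qed

section \<open>Membership of the profiles in the operator domain, and symmetry\<close>

lemma hgrad_diff:
  assumes "test_fn u" "test_fn v"
  shows "hgrad (\<lambda>x. u x - v x) b = (\<lambda>x. hgrad u b x - hgrad v b x)"
proof
  fix x
  have "((\<lambda>x. u x - v x) has_derivative (\<lambda>h. frechet_derivative u (at x) h - frechet_derivative v (at x) h)) (at x)"
    using assms test_fn_differentiable frechet_derivative_works by (intro has_derivative_diff) blast+
  from frechet_derivative_at[OF this, symmetric]
  show "hgrad (\<lambda>x. u x - v x) b x = hgrad u b x - hgrad v b x"
    by (simp add: hgrad_def right_diff_distrib)
qed

lemma norm_hardy_form_self:
  fixes u :: "'a::euclidean_space \<Rightarrow> complex"
  assumes "test_fn u" "DIM('a) \<ge> 3"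
  shows "norm (hardy_form u u) = (\<Sum>b\<in>Basis. (L2norm (hgrad u b))\<^sup>2)"
proof -
  have "hardy_form u u = complex_of_real (\<Sum>b\<in>Basis. (L2norm (hgrad u b))\<^sup>2)"
    unfolding hardy_form_eq[OF assms(1) assms] l2inner_self of_real_sum ..
  then show ?thesis
    by (simp only: norm_of_real abs_of_nonneg[OF sum_nonneg[OF zero_le_power2]])
qed

lemma sum_power2_le:
  fixes f :: "'b \<Rightarrow> real"
  assumes "\<And>x. x \<in> A \<Longrightarrow> f x \<ge> 0" shows "(\<Sum>x\<in>A. (f x)\<^sup>2) \<le> (\<Sum>x\<in>A. f x)\<^sup>2"
proof (cases "finite A")
  case True
  have "(\<Sum>x\<in>A. (f x)\<^sup>2) \<le> (\<Sum>x\<in>A. f x * (\<Sum>y\<in>A. f y))"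
    unfolding power2_eq_square using True assms
    by (intro sum_mono mult_left_mono member_le_sum) auto
  then show ?thesis
    by (simp add: power2_eq_square sum_distrib_right)
qed simp

lemma sum_hgrad_gauss_approx_tendsto:
  assumes "Re z > 0" "DIM('a::euclidean_space) \<ge> 3"
  shows "(\<lambda>k. \<Sum>b\<in>(Basis :: 'a set). L2norm (\<lambda>x. hgrad (gauss_approx (real (Suc k)) z) b x - grad_gauss z b x)) \<longlonglongrightarrow> 0"
  by (rule tendsto_null_sum) (rule hgrad_gauss_approx_tendsto[OF assms])

text \<open>On a difference of approximants the form is a sum of squares of \<open>hgrad\<close>
  differences, so the convergence of \<open>hgrad\<close> to \<open>grad_gauss\<close> gives the
  Cauchy condition. The limit of the form against a test function is the conjugate of
  \<open>hgrad_grad_gauss\<close>.\<close>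

lemma hardyH_gauss:
  assumes z: "Re z > 0" and dim: "DIM('a::euclidean_space) \<ge> 3"
  shows "hardyH (gauss z :: 'a \<Rightarrow> complex) (hardy_gauss z)"
  unfolding hardyH_def
proof (intro conjI exI)
  let ?g = "\<lambda>k. gauss_approx (real (Suc k)) z :: 'a \<Rightarrow> complex"
  define d where "d k = (\<Sum>b\<in>Basis. L2norm (\<lambda>x. hgrad (?g k) b x - grad_gauss z b x))" for k
  have d0: "d \<longlonglongrightarrow> 0"
    unfolding d_def by (rule sum_hgrad_gauss_approx_tendsto[OF z dim])
  have d_nonneg: "d k \<ge> 0" for k unfolding d_def by (intro sum_nonneg) auto
  have tg: "test_fn (?g k)" for k by (rule test_fn_gauss_approx) simp
  have LG: "L2 (grad_gauss z b :: 'a \<Rightarrow> complex)" if "b \<in> Basis" for b by (rule L2_grad_gauss[OF z that])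
  have Lg: "L2 (hgrad (?g k) b)" if "b \<in> Basis" for b k by (rule L2_hgrad[OF tg that dim])
  show "L2 (gauss z :: 'a \<Rightarrow> complex)" "L2 (hardy_gauss z :: 'a \<Rightarrow> complex)"
    using z by (auto intro: L2_gauss L2_hardy_gauss)
  show "\<forall>k. test_fn (?g k)" using tg by blast
  show "(\<lambda>k. L2norm (\<lambda>x. ?g k x - gauss z x)) \<longlonglongrightarrow> 0"
    by (rule gauss_approx_tendsto[OF z])
  have form: "norm (hardy_form (\<lambda>x. ?g k x - ?g l x) (\<lambda>x. ?g k x - ?g l x)) \<le> (d k + d l)\<^sup>2" for k l
  proof -
    let ?h = "\<lambda>b. L2norm (hgrad (\<lambda>x. ?g k x - ?g l x) b)"
    have le: "?h b \<le> L2norm (\<lambda>x. hgrad (?g k) b x - grad_gauss z b x) + L2norm (\<lambda>x. hgrad (?g l) b x - grad_gauss z b x)"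
      if b: "b \<in> Basis" for b
    proof -
      have "?h b = L2norm (\<lambda>x. (hgrad (?g k) b x - grad_gauss z b x) + (grad_gauss z b x - hgrad (?g l) b x))"
        unfolding hgrad_diff[OF tg tg] by (intro arg_cong[where f = L2norm] ext) simp
      also have "\<dots> \<le> L2norm (\<lambda>x. hgrad (?g k) b x - grad_gauss z b x) + L2norm (\<lambda>x. grad_gauss z b x - hgrad (?g l) b x)"
        by (intro L2norm_triangle L2_diff LG Lg b)
      finally show ?thesis by (simp only: L2norm_minus_commute[of "grad_gauss z b"])
    qed
    have "norm (hardy_form (\<lambda>x. ?g k x - ?g l x) (\<lambda>x. ?g k x - ?g l x)) = (\<Sum>b\<in>Basis. (?h b)\<^sup>2)"
      by (rule norm_hardy_form_self[OF test_fn_diff[OF tg tg] dim])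
    also have "\<dots> \<le> (\<Sum>b\<in>Basis. ?h b)\<^sup>2"
      by (rule sum_power2_le) auto
    also have "\<dots> \<le> (d k + d l)\<^sup>2"
      unfolding d_def sum.distrib[symmetric] by (intro power_mono sum_mono le sum_nonneg) auto
    finally show ?thesis .
  qed
  show "\<forall>e>0. \<exists>N. \<forall>k\<ge>N. \<forall>l\<ge>N. norm (hardy_form (\<lambda>x. ?g k x - ?g l x) (\<lambda>x. ?g k x - ?g l x)) < e"
  proof (intro allI impI)
    fix e :: real assume "e > 0"
    then have "sqrt e / 2 > 0" by simp
    then obtain N where N: "\<And>k. k \<ge> N \<Longrightarrow> \<bar>d k\<bar> < sqrt e / 2"
      using LIMSEQ_D[OF d0] by (metis diff_zero real_norm_def)
    have "norm (hardy_form (\<lambda>x. ?g k x - ?g l x) (\<lambda>x. ?g k x - ?g l x)) < e" if "k \<ge> N" "l \<ge> N" for k l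
    proof -
      have "d k + d l < sqrt e" using N[OF that(1)] N[OF that(2)] by linarith
      then have "(d k + d l)\<^sup>2 < (sqrt e)\<^sup>2"
        using d_nonneg by (intro power_strict_mono) auto
      with form[of k l] \<open>e > 0\<close> show ?thesis by simp
    qed
    then show "\<exists>N. \<forall>k\<ge>N. \<forall>l\<ge>N. norm (hardy_form (\<lambda>x. ?g k x - ?g l x) (\<lambda>x. ?g k x - ?g l x)) < e"
      by blast
  qed
  show "\<forall>\<psi>. test_fn \<psi> \<longrightarrow> (\<lambda>k. hardy_form (?g k) \<psi>) \<longlonglongrightarrow> l2inner (hardy_gauss z) \<psi>"
  proof (intro allI impI)
    fix \<psi> :: "'a \<Rightarrow> complex" assume \<psi>: "test_fn \<psi>"
    have "(\<lambda>k. \<Sum>b\<in>Basis. l2inner (hgrad (?g k) b) (hgrad \<psi> b)) \<longlonglongrightarrow> (\<Sum>b\<in>Basis. l2inner (grad_gauss z b) (hgrad \<psi> b))"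
      by (intro tendsto_sum l2inner_tendsto Lg LG L2_hgrad \<psi> dim hgrad_gauss_approx_tendsto z)
    moreover have "(\<Sum>b\<in>Basis. l2inner (grad_gauss z b) (hgrad \<psi> b)) = cnj (\<Sum>b\<in>Basis. l2inner (hgrad \<psi> b) (grad_gauss z b))"
      unfolding cnj_sum by (rule sum.cong[OF refl l2inner_commute])
    ultimately show "(\<lambda>k. hardy_form (?g k) \<psi>) \<longlonglongrightarrow> l2inner (hardy_gauss z) \<psi>"
      unfolding hgrad_grad_gauss[OF \<psi> z dim] l2inner_commute[symmetric] hardy_form_eq[OF tg \<psi> dim] by simp
  qed
qed

text \<open>The weak equation for \<open>u\<close> admits only test functions, and
  \<open>gauss z\<close> is not known to be one, so it is approximated. The form-Cauchy sequence
  behind \<open>u\<close> has bounded \<open>hgrad\<close>, which makes the error uniform in k; thus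
  k can go to infinity first and the cutoff parameter afterwards.\<close>

lemma hardyH_gauss_symmetric:
  assumes H: "hardyH u w" and z: "Re z > 0" and dim: "DIM('a::euclidean_space) \<ge> 3"
  shows "l2inner w (gauss z :: 'a \<Rightarrow> complex) = l2inner u (hardy_gauss z)"
proof -
  let ?g = "\<lambda>k. gauss_approx (real (Suc k)) z :: 'a \<Rightarrow> complex"
  define d where "d k = (\<Sum>b\<in>Basis. L2norm (\<lambda>x. hgrad (?g k) b x - grad_gauss z b x))" for k
  have d0: "d \<longlonglongrightarrow> 0"
    unfolding d_def by (rule sum_hgrad_gauss_approx_tendsto[OF z dim])
  have tg: "test_fn (?g k)" for k by (rule test_fn_gauss_approx) simp
  have LG: "L2 (grad_gauss z b :: 'a \<Rightarrow> complex)" if "b \<in> Basis" for b by (rule L2_grad_gauss[OF z that])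
  have Lg: "L2 (hgrad (?g k) b)" if "b \<in> Basis" for b k by (rule L2_hgrad[OF tg that dim])
  have Lu: "L2 u" and Lw: "L2 w" using H by (auto simp: hardyH_def)
  obtain \<phi> where \<phi>: "\<And>k. test_fn (\<phi> k)" "(\<lambda>k. L2norm (\<lambda>x. \<phi> k x - u x)) \<longlonglongrightarrow> 0"
    and cauchy: "\<forall>e>0. \<exists>N. \<forall>k\<ge>N. \<forall>l\<ge>N. norm (hardy_form (\<lambda>x. \<phi> k x - \<phi> l x) (\<lambda>x. \<phi> k x - \<phi> l x)) < e"
    and weak: "\<And>\<psi>. test_fn \<psi> \<Longrightarrow> (\<lambda>k. hardy_form (\<phi> k) \<psi>) \<longlonglongrightarrow> l2inner w \<psi>"
    using H unfolding hardyH_def by blast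
  have L\<phi>: "L2 (hgrad (\<phi> k) b)" if "b \<in> Basis" for b k by (rule L2_hgrad[OF \<phi>(1) that dim])
  obtain N where N: "\<And>k l. k \<ge> N \<Longrightarrow> l \<ge> N \<Longrightarrow> norm (hardy_form (\<lambda>x. \<phi> k x - \<phi> l x) (\<lambda>x. \<phi> k x - \<phi> l x)) < 1"
    using cauchy[rule_format, of 1] by auto
  \<comment> \<open>From index \<open>N\<close> on, all terms lie within form distance 1 of the
    \<open>N\<close>-th one.\<close>
  define K where "K = 1 + (\<Sum>b\<in>Basis. L2norm (hgrad (\<phi> N) b))"
  have bound: "L2norm (hgrad (\<phi> k) b) \<le> K" if k: "k \<ge> N" and b: "b \<in> Basis" for k b
  proof -
    have "(L2norm (hgrad (\<lambda>x. \<phi> k x - \<phi> N x) b))\<^sup>2 \<le> (\<Sum>b\<in>Basis. (L2norm (hgrad (\<lambda>x. \<phi> k x - \<phi> N x) b))\<^sup>2)"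
      by (rule member_le_sum[OF b]) auto
    also have "\<dots> < 1\<^sup>2"
      using N[OF k order_refl] unfolding norm_hardy_form_self[OF test_fn_diff[OF \<phi>(1) \<phi>(1)] dim] by simp
    finally have "L2norm (hgrad (\<lambda>x. \<phi> k x - \<phi> N x) b) < 1"
      by (rule power2_less_imp_less) simp
    moreover have "L2norm (hgrad (\<phi> k) b) \<le> L2norm (hgrad (\<lambda>x. \<phi> k x - \<phi> N x) b) + L2norm (hgrad (\<phi> N) b)"
      unfolding hgrad_diff[OF \<phi>(1) \<phi>(1)] by (rule L2norm_le_diff[OF L\<phi>[OF b] L\<phi>[OF b]])
    moreover have "L2norm (hgrad (\<phi> N) b) \<le> (\<Sum>b\<in>Basis. L2norm (hgrad (\<phi> N) b))"
      by (rule member_le_sum[OF b]) auto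
    ultimately show ?thesis unfolding K_def by linarith
  qed
  have close: "norm (hardy_form (\<phi> k) (?g m) - l2inner (\<phi> k) (hardy_gauss z)) \<le> K * d m" if k: "k \<ge> N" for k m
  proof -
    have "hardy_form (\<phi> k) (?g m) - l2inner (\<phi> k) (hardy_gauss z) =
        (\<Sum>b\<in>Basis. l2inner (hgrad (\<phi> k) b) (\<lambda>x. hgrad (?g m) b x - grad_gauss z b x))"
      unfolding hardy_form_eq[OF \<phi>(1) tg dim] hgrad_grad_gauss[OF \<phi>(1) z dim, symmetric] sum_subtractf[symmetric]
      by (rule sum.cong) (auto intro!: l2inner_diff_right[symmetric] L\<phi> Lg LG simp del: of_nat_Suc)
    also have "norm \<dots> \<le> (\<Sum>b\<in>(Basis::'a set). K * L2norm (\<lambda>x. hgrad (?g m) b x - grad_gauss z b x))"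
    proof (rule sum_norm_le)
      fix b :: 'a assume b: "b \<in> Basis"
      have "norm (l2inner (hgrad (\<phi> k) b) (\<lambda>x. hgrad (?g m) b x - grad_gauss z b x))
        \<le> L2norm (hgrad (\<phi> k) b) * L2norm (\<lambda>x. hgrad (?g m) b x - grad_gauss z b x)"
        by (intro norm_l2inner_le L\<phi> L2_diff Lg LG b)
      also have "\<dots> \<le> K * L2norm (\<lambda>x. hgrad (?g m) b x - grad_gauss z b x)"
        by (intro mult_right_mono bound k b) auto
      finally show "norm (l2inner (hgrad (\<phi> k) b) (\<lambda>x. hgrad (?g m) b x - grad_gauss z b x))
        \<le> K * L2norm (\<lambda>x. hgrad (?g m) b x - grad_gauss z b x)" .
    qed
    finally show ?thesis by (simp only: d_def sum_distrib_left)
  qed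
  \<comment> \<open>The limit in k for a fixed approximant: the form tends to the pairing with
    \<open>w\<close>, while the \<open>L2\<close> convergence takes care of the other term.\<close>
  have lim: "norm (l2inner w (?g m) - l2inner u (hardy_gauss z)) \<le> K * d m" for m
  proof (rule tendsto_upperbound)
    show "(\<lambda>k. norm (hardy_form (\<phi> k) (?g m) - l2inner (\<phi> k) (hardy_gauss z))) \<longlonglongrightarrow>
        norm (l2inner w (?g m) - l2inner u (hardy_gauss z))"
      by (intro tendsto_norm tendsto_diff weak tg l2inner_tendsto L2_test_fn \<phi> Lu L2_hardy_gauss z)
    show "\<forall>\<^sub>F k in sequentially. norm (hardy_form (\<phi> k) (?g m) - l2inner (\<phi> k) (hardy_gauss z)) \<le> K * d m"
      using close unfolding eventually_sequentially by blast
  qed simp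
  have "norm (l2inner w (gauss z) - l2inner u (hardy_gauss z)) \<le> 0"
  proof (rule tendsto_le[OF sequentially_bot])
    show "(\<lambda>m. norm (l2inner w (?g m) - l2inner u (hardy_gauss z))) \<longlonglongrightarrow> norm (l2inner w (gauss z) - l2inner u (hardy_gauss z))"
      by (intro tendsto_norm tendsto_diff tendsto_const l2inner_tendsto_right L2_test_fn tg L2_gauss z Lw gauss_approx_tendsto)
    show "(\<lambda>m. K * d m) \<longlonglongrightarrow> 0"
      by (rule tendsto_mult_right_zero[OF d0])
  qed (use lim in auto)
  then show ?thesis by simp
qed

section \<open>The evolution of a Gaussian profile\<close>

text \<open>Strong differentiability at one time, in the difference-quotient form that
  \<open>schr_group\<close> supplies. Square integrability at all times is included so that every
  quotient is in \<open>L2\<close>.\<close>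

definition L2_deriv :: "(real \<Rightarrow> 'a::euclidean_space \<Rightarrow> complex) \<Rightarrow> ('a \<Rightarrow> complex) \<Rightarrow> real \<Rightarrow> bool" where
  "L2_deriv u u' t \<longleftrightarrow> (\<forall>s. L2 (u s)) \<and> L2 u' \<and>
     ((\<lambda>h. L2norm (\<lambda>x. (u (t + h) x - u t x) / complex_of_real h - u' x)) \<longlongrightarrow> 0) (at 0)"

lemma L2_divide [intro]: "L2 f \<Longrightarrow> L2 (\<lambda>x. f x / a)"
  using L2_cmult[of f "inverse a"] by (simp add: divide_inverse mult.commute)

lemma l2inner_tendsto_both:
  assumes f: "\<And>k. L2 (f k)" "L2 f'" and g: "\<And>k. L2 (g k)" "L2 g'"
    and f0: "((\<lambda>k. L2norm (\<lambda>x. f k x - f' x)) \<longlongrightarrow> 0) F" and g0: "((\<lambda>k. L2norm (\<lambda>x. g k x - g' x)) \<longlongrightarrow> 0) F"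
  shows "((\<lambda>k. l2inner (f k) (g k)) \<longlongrightarrow> l2inner f' g') F"
proof -
  let ?a = "\<lambda>k. L2norm (\<lambda>x. f k x - f' x)" and ?b = "\<lambda>k. L2norm (\<lambda>x. g k x - g' x)"
  have le: "norm (l2inner (f k) (g k) - l2inner f' g') \<le> ?a k * (?b k + L2norm g') + L2norm f' * ?b k" for k
  proof -
    have "l2inner (f k) (g k) - l2inner f' g' = l2inner (\<lambda>x. f k x - f' x) (g k) + l2inner f' (\<lambda>x. g k x - g' x)"
      by (simp add: l2inner_diff_left[OF f(1) f(2) g(1)] l2inner_diff_right[OF g(1) g(2) f(2)])
    also have "norm \<dots> \<le> ?a k * L2norm (g k) + L2norm f' * ?b k"
      by (intro norm_triangle_mono norm_l2inner_le L2_diff f g)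
    also have "?a k * L2norm (g k) \<le> ?a k * (?b k + L2norm g')"
      by (intro mult_left_mono L2norm_le_diff g) simp
    finally show ?thesis by simp
  qed
  have "((\<lambda>k. ?a k * (?b k + L2norm g') + L2norm f' * ?b k) \<longlongrightarrow> 0 * (0 + L2norm g') + L2norm f' * 0) F"
    by (rule tendsto_add[OF tendsto_mult[OF f0 tendsto_add[OF g0 tendsto_const]] tendsto_mult[OF tendsto_const g0]])
  then have lim: "((\<lambda>k. ?a k * (?b k + L2norm g') + L2norm f' * ?b k) \<longlongrightarrow> 0) F"
    by simp
  have "((\<lambda>k. l2inner (f k) (g k) - l2inner f' g') \<longlongrightarrow> 0) F"
    by (rule Lim_null_comparison[OF always_eventually[OF allI[OF le]] lim])
  then show ?thesis by (rule LIM_zero_cancel)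
qed

lemma L2_deriv_imp_continuous:
  assumes "L2_deriv u u' t"
  shows "((\<lambda>h. L2norm (\<lambda>x. u (t + h) x - u t x)) \<longlongrightarrow> 0) (at 0)"
proof -
  have L: "\<And>s. L2 (u s)" "L2 u'" using assms by (auto simp: L2_deriv_def)
  let ?e = "\<lambda>h. L2norm (\<lambda>x. (u (t + h) x - u t x) / complex_of_real h - u' x)"
  have le: "L2norm (\<lambda>x. u (t + h) x - u t x) \<le> \<bar>h\<bar> * (?e h + L2norm u')" if "h \<noteq> 0" for h
  proof -
    have "L2norm (\<lambda>x. u (t + h) x - u t x) = L2norm (\<lambda>x. complex_of_real h * ((u (t + h) x - u t x) / complex_of_real h))"
      using that by simp
    also have "\<dots> = \<bar>h\<bar> * L2norm (\<lambda>x. (u (t + h) x - u t x) / complex_of_real h)"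
      by (subst L2norm_cmult) simp
    also have "\<dots> \<le> \<bar>h\<bar> * (?e h + L2norm u')"
      by (intro mult_left_mono L2norm_le_diff L2_divide L2_diff L) simp
    finally show ?thesis .
  qed
  have e0: "(?e \<longlongrightarrow> 0) (at 0)"
    using assms by (simp add: L2_deriv_def)
  have "((\<lambda>h. \<bar>h\<bar> * (?e h + L2norm u')) \<longlongrightarrow> \<bar>0\<bar> * (0 + L2norm u')) (at 0)"
    by (rule tendsto_mult[OF tendsto_rabs[OF tendsto_ident_at] tendsto_add[OF e0 tendsto_const]])
  then have lim: "((\<lambda>h. \<bar>h\<bar> * (?e h + L2norm u')) \<longlongrightarrow> 0) (at 0)" by simp
  show ?thesis
    by (rule Lim_null_comparison[OF _ lim]) (use le in \<open>auto simp: eventually_at_filter\<close>)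
qed

lemma has_vector_derivative_atI:
  assumes "((\<lambda>h. (f (t + h) - f t) /\<^sub>R h) \<longlongrightarrow> D) (at 0)"
  shows "(f has_vector_derivative D) (at t)"
proof -
  have lim: "((\<lambda>h. norm ((f (t + h) - f t) /\<^sub>R h - D)) \<longlongrightarrow> 0) (at 0)"
    by (rule tendsto_norm_zero[OF LIM_zero[OF assms]])
  have eq: "norm ((f (t + h) - f t) /\<^sub>R h - D) = norm (f (t + h) - f t - h *\<^sub>R D) / norm h" if "h \<noteq> 0" for h
  proof -
    have "f (t + h) - f t - h *\<^sub>R D = h *\<^sub>R ((f (t + h) - f t) /\<^sub>R h - D)"
      using that by (simp add: scaleR_diff_right)
    then show ?thesis using that by simp
  qed
  have "\<forall>\<^sub>F h in at 0. norm ((f (t + h) - f t) /\<^sub>R h - D) = norm (f (t + h) - f t - h *\<^sub>R D) / norm h"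
    unfolding eventually_at_filter by (intro always_eventually allI impI eq)
  from Lim_transform_eventually[OF lim this] show ?thesis
    unfolding has_vector_derivative_def has_derivative_at by (simp add: bounded_linear_scaleR_left)
qed

lemma l2inner_has_vector_derivative:
  assumes u: "L2_deriv u u' t" and v: "L2_deriv v v' t"
  shows "((\<lambda>s. l2inner (u s) (v s)) has_vector_derivative l2inner u' (v t) + l2inner (u t) v') (at t)"
proof -
  have L: "\<And>s. L2 (u s)" "L2 u'" "\<And>s. L2 (v s)" "L2 v'" using u v by (auto simp: L2_deriv_def)
  let ?D = "\<lambda>h x. (u (t + h) x - u t x) / complex_of_real h" and ?E = "\<lambda>h x. (v (t + h) x - v t x) / complex_of_real h"
  have lim: "((\<lambda>h. l2inner (?D h) (v (t + h)) + l2inner (u t) (?E h)) \<longlongrightarrow> l2inner u' (v t) + l2inner (u t) v') (at 0)"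
  proof (rule tendsto_add)
    show "((\<lambda>h. l2inner (?D h) (v (t + h))) \<longlongrightarrow> l2inner u' (v t)) (at 0)"
      by (rule l2inner_tendsto_both[OF L2_divide[OF L2_diff[OF L(1) L(1)]] L(2) L(3) L(3) _ L2_deriv_imp_continuous[OF v]])
        (use u in \<open>simp add: L2_deriv_def\<close>)
    show "((\<lambda>h. l2inner (u t) (?E h)) \<longlongrightarrow> l2inner (u t) v') (at 0)"
      by (rule l2inner_tendsto_right[OF L2_divide[OF L2_diff[OF L(3) L(3)]] L(4) L(1)])
        (use v in \<open>simp add: L2_deriv_def\<close>)
  qed
  \<comment> \<open>The usual splitting for a product rule. The first term carries \<open>v\<close>
    at the shifted time, so its limit also requires continuity of \<open>v\<close>.\<close>
  have eq: "l2inner (?D h) (v (t + h)) + l2inner (u t) (?E h)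
      = (l2inner (u (t + h)) (v (t + h)) - l2inner (u t) (v t)) /\<^sub>R h" if "h \<noteq> 0" for h
  proof -
    have 1: "l2inner (?D h) (v (t + h)) = inverse (complex_of_real h) * (l2inner (u (t + h)) (v (t + h)) - l2inner (u t) (v (t + h)))"
      unfolding divide_inverse mult.commute[of _ "inverse (complex_of_real h)"] l2inner_cmult_left
      by (simp add: l2inner_diff_left L)
    have 2: "l2inner (u t) (?E h) = inverse (complex_of_real h) * (l2inner (u t) (v (t + h)) - l2inner (u t) (v t))"
      unfolding divide_inverse mult.commute[of _ "inverse (complex_of_real h)"] l2inner_cmult_right
      by (simp add: l2inner_diff_right L)
    show ?thesis
      unfolding 1 2 scaleR_conv_of_real of_real_inverse by (simp add: right_diff_distrib)
  qed
  have "\<forall>\<^sub>F h in at 0. l2inner (?D h) (v (t + h)) + l2inner (u t) (?E h)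
      = (l2inner (u (t + h)) (v (t + h)) - l2inner (u t) (v t)) /\<^sub>R h"
    unfolding eventually_at_filter by (intro always_eventually allI impI eq)
  from Lim_transform_eventually[OF lim this]
  have "((\<lambda>h. (l2inner (u (t + h)) (v (t + h)) - l2inner (u t) (v t)) /\<^sub>R h) \<longlongrightarrow> l2inner u' (v t) + l2inner (u t) v') (at 0)" .
  then show ?thesis
    by (rule has_vector_derivative_atI)
qed

text \<open>The solution of z' = - 4 i z^2 with z(0) = 1.\<close>

definition gauss_time :: "real \<Rightarrow> complex" where
  "gauss_time t = inverse (1 + 4 * \<i> * complex_of_real t)"

lemma gauss_time_denom: "(1 + 4 * \<i> * complex_of_real t) \<noteq> 0"
  by (auto simp: complex_eq_iff)

lemma Re_gauss_time: "Re (gauss_time t) = 1 / (1 + 16 * t\<^sup>2)"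
  and Im_gauss_time: "Im (gauss_time t) = - 4 * t / (1 + 16 * t\<^sup>2)"
  by (simp_all add: gauss_time_def power2_eq_square)

lemma Re_gauss_time_pos: "Re (gauss_time t) > 0"
  unfolding Re_gauss_time by (simp add: add_pos_nonneg)

lemma norm_gauss_time_le: "norm (gauss_time t) \<le> 1"
proof -
  have "1 \<le> norm (1 + 4 * \<i> * complex_of_real t)"
    using complex_Re_le_cmod[of "1 + 4 * \<i> * complex_of_real t"] by simp
  then show ?thesis by (simp add: gauss_time_def norm_inverse inverse_le_1_iff)
qed

lemma gauss_time_0: "gauss_time 0 = 1"
  by (simp add: gauss_time_def)

lemma gauss_time_has_derivative: "(gauss_time has_vector_derivative - 4 * \<i> * (gauss_time t)\<^sup>2) (at t)"
proof -
  have "((\<lambda>t. 1 + 4 * \<i> * complex_of_real t) has_vector_derivative 0 + 4 * \<i> * complex_of_real 1) (at t)"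
    by (intro has_vector_derivative_add has_vector_derivative_const has_vector_derivative_mult_right
        has_vector_derivative_of_real) (auto intro!: derivative_eq_intros)
  from field_vector_diff_chain_at[OF this DERIV_inverse[OF gauss_time_denom]]
  show ?thesis
    by (simp add: o_def gauss_time_def[abs_def] power2_eq_square)
qed

lemma gauss_has_vector_derivative:
  "((\<lambda>t. gauss (gauss_time t) x) has_vector_derivative - \<i> * hardy_gauss (gauss_time t) x) (at t)"
proof -
  let ?p = "complex_of_real (norm x powr - crit_exp TYPE('a))" and ?s = "complex_of_real ((norm x)\<^sup>2)"
  let ?z = "gauss_time t"
  have "((\<lambda>z. z * ?p * exp (- z * ?s)) has_field_derivative ?p * exp (- ?z * ?s) + ?z * ?p * (exp (- ?z * ?s) * (- ?s))) (at ?z)"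
    by (auto intro!: derivative_eq_intros)
  from field_vector_diff_chain_at[OF gauss_time_has_derivative this]
  have "((\<lambda>t. gauss (gauss_time t) x) has_vector_derivative
     - 4 * \<i> * ?z\<^sup>2 * (?p * exp (- ?z * ?s) + ?z * ?p * (exp (- ?z * ?s) * (- ?s)))) (at t)"
    by (simp only: o_def gauss_def)
  also have "- 4 * \<i> * ?z\<^sup>2 * (?p * exp (- ?z * ?s) + ?z * ?p * (exp (- ?z * ?s) * (- ?s))) = - \<i> * hardy_gauss ?z x"
    unfolding hardy_gauss_def gauss_def by algebra
  finally show ?thesis .
qed

lemma gauss_bound_antimono: "a \<le> b \<Longrightarrow> gauss_bound b x \<le> gauss_bound a x"
  unfolding gauss_bound_def by (intro mult_left_mono) (auto intro!: mult_right_mono)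

text \<open>Pointwise differentiability in time is elementary. The mean value bound controls the
  quotients by one \<open>gauss_bound\<close> throughout a unit time window, and dominated
  convergence upgrades the limit to \<open>L2\<close>.\<close>

lemma L2_deriv_gauss:
  "L2_deriv (\<lambda>t. gauss (gauss_time t) :: 'a::euclidean_space \<Rightarrow> complex) (\<lambda>x. - \<i> * hardy_gauss (gauss_time t) x) t"
  unfolding L2_deriv_def
proof (intro conjI allI)
  let ?v = "\<lambda>t. gauss (gauss_time t) :: 'a \<Rightarrow> complex" and ?w = "\<lambda>t. hardy_gauss (gauss_time t) :: 'a \<Rightarrow> complex"
  show Lv: "L2 (?v s)" for s
    by (rule L2_gauss[OF Re_gauss_time_pos])
  show Lw: "L2 (\<lambda>x. - \<i> * ?w t x)"
    by (rule L2_cmult[OF L2_hardy_gauss[OF Re_gauss_time_pos]])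
  \<comment> \<open>A lower bound for Re z over all times within distance 1 of t; it is positive, so
    its \<open>gauss_bound\<close> is still square integrable.\<close>
  define a where "a = 1 / (1 + 16 * (\<bar>t\<bar> + 1)\<^sup>2)"
  have a: "a > 0" unfolding a_def by (simp add: add_pos_nonneg)
  have w_le: "norm (- \<i> * ?w s x) \<le> 8 * gauss_bound a x" if "\<bar>s - t\<bar> \<le> 1" for s x
  proof -
    have "s\<^sup>2 \<le> (\<bar>t\<bar> + 1)\<^sup>2"
      using that abs_le_square_iff[of s "\<bar>t\<bar> + 1"] by linarith
    then have "a \<le> Re (gauss_time s)"
      unfolding a_def Re_gauss_time by (intro divide_left_mono) (auto intro!: mult_pos_pos add_pos_nonneg)
    then have 1: "gauss_bound (Re (gauss_time s)) x \<le> gauss_bound a x"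
      by (rule gauss_bound_antimono)
    let ?n = "norm (gauss_time s)"
    \<comment> \<open>The time parameter has modulus at most 1, which turns the constant of
      \<open>norm_hardy_gauss_le\<close> into 8.\<close>
    have "4 * ?n * (1 + ?n) * ?n \<le> 4 * 1 * (1 + 1) * 1"
      using norm_gauss_time_le[of s] by (intro mult_mono) auto
    then have "4 * ?n * (1 + ?n) * ?n * gauss_bound (Re (gauss_time s)) x \<le> 8 * gauss_bound a x"
      using 1 gauss_bound_nonneg by (intro mult_mono) auto
    with norm_hardy_gauss_le[of "gauss_time s" x] have "norm (?w s x) \<le> 8 * gauss_bound a x"
      by (rule order_trans)
    then show ?thesis
      by (simp add: norm_mult)
  qed
  have lip: "norm (?v (t + h) x - ?v t x) \<le> 8 * gauss_bound a x * norm (t + h - t)" if "\<bar>h\<bar> \<le> 1" for h x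
  proof (rule differentiable_bound[where S = "{t - 1..t + 1}" and f = "\<lambda>t. ?v t x" and f' = "\<lambda>s r. r *\<^sub>R (- \<i> * ?w s x)"])
    fix s assume s: "s \<in> {t - 1..t + 1}"
    show "((\<lambda>t. ?v t x) has_derivative (\<lambda>r. r *\<^sub>R (- \<i> * ?w s x))) (at s within {t - 1..t + 1})"
      using gauss_has_vector_derivative has_derivative_at_withinI unfolding has_vector_derivative_def by blast
    have "norm (- \<i> * ?w s x) \<le> 8 * gauss_bound a x"
      by (rule w_le) (use s in auto)
    then have "norm r * norm (- \<i> * ?w s x) \<le> norm r * (8 * gauss_bound a x)" for r :: real
      by (rule mult_left_mono) simp
    then have "norm (r *\<^sub>R (- \<i> * ?w s x)) \<le> 8 * gauss_bound a x * norm r" for r :: real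
      unfolding norm_scaleR real_norm_def by (simp only: mult.commute)
    then show "onorm (\<lambda>r. r *\<^sub>R (- \<i> * ?w s x)) \<le> 8 * gauss_bound a x"
      by (rule onorm_le)
  qed (use that in auto)
  let ?q = "\<lambda>h x. (?v (t + h) x - ?v t x) / complex_of_real h - (- \<i> * ?w t x)"
  have q_le: "(norm (?q h x))\<^sup>2 \<le> 256 * (gauss_bound a x)\<^sup>2" if h: "\<bar>h\<bar> \<le> 1" "h \<noteq> 0" for h x
  proof -
    have "norm ((?v (t + h) x - ?v t x) / complex_of_real h) \<le> 8 * gauss_bound a x"
      using lip[OF h(1), of x] h(2) by (simp add: norm_divide pos_divide_le_eq)
    moreover have "norm (- \<i> * ?w t x) \<le> 8 * gauss_bound a x"
      by (rule w_le) simp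
    ultimately have "norm (?q h x) \<le> 8 * gauss_bound a x + 8 * gauss_bound a x"
      by (rule order_trans[OF norm_triangle_ineq4 add_mono])
    then have "(norm (?q h x))\<^sup>2 \<le> (16 * gauss_bound a x)\<^sup>2"
      by (intro power_mono) auto
    then show ?thesis by (simp add: power_mult_distrib)
  qed
  have q_lim: "((\<lambda>h. ?q h x) \<longlongrightarrow> 0) (at 0)" for x
  proof -
    have "((\<lambda>s. (?v s x - ?v t x) /\<^sub>R (s - t)) \<longlongrightarrow> - \<i> * ?w t x) (at t)"
      by (rule has_vector_derivative_imp_tendsto[OF gauss_has_vector_derivative])
    then have "((\<lambda>h. (?v (t + h) x - ?v t x) /\<^sub>R (t + h - t)) \<longlongrightarrow> - \<i> * ?w t x) (at 0)"
      by (subst (asm) at_to_0) (simp add: filterlim_filtermap add.commute)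
    from LIM_zero[OF this] show ?thesis
      by (simp add: scaleR_conv_of_real divide_inverse mult.commute)
  qed
  have Lq: "L2 (?q h)" for h
    by (intro L2_diff L2_divide Lv Lw)
  show "((\<lambda>h. L2norm (?q h)) \<longlongrightarrow> 0) (at 0)"
    unfolding tendsto_at_iff_sequentially
  proof (intro allI impI)
    fix X :: "nat \<Rightarrow> real" assume X: "\<forall>i. X i \<in> UNIV - {0}" "X \<longlonglongrightarrow> 0"
    \<comment> \<open>The majorant holds only for increments of size at most 1, so an initial
      segment of the sequence is dropped.\<close>
    obtain N where N: "\<And>n. n \<ge> N \<Longrightarrow> \<bar>X n\<bar> < 1"
      using LIMSEQ_D[OF X(2), of 1] by auto
    have "(\<lambda>k. L2norm (?q (X (k + N)))) \<longlonglongrightarrow> 0"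
    proof (rule L2norm_tendsto_0_dominated[where h = "\<lambda>x. 256 * (gauss_bound a x)\<^sup>2"])
      show "?q (X (k + N)) \<in> borel_measurable lebesgue" for k
        by (rule L2_measurable[OF Lq])
      show "integrable lebesgue (\<lambda>x::'a. 256 * (gauss_bound a x)\<^sup>2)"
        by (intro integrable_mult_right integrable_gauss_bound a)
      show "AE x in lebesgue. (norm (?q (X (k + N)) x))\<^sup>2 \<le> 256 * (gauss_bound a x)\<^sup>2" for k
        by (intro AE_I2 q_le) (use N[of "k + N"] X(1) in auto)
      show "AE x in lebesgue. (\<lambda>k. ?q (X (k + N)) x) \<longlonglongrightarrow> 0"
      proof (rule AE_I2)
        fix x :: 'a
        have "(\<lambda>k. ?q (X k) x) \<longlonglongrightarrow> 0"
          using q_lim[of x, unfolded tendsto_at_iff_sequentially] X by (auto simp: o_def)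
        then show "(\<lambda>k. ?q (X (k + N)) x) \<longlonglongrightarrow> 0"
          by (rule LIMSEQ_ignore_initial_segment)
      qed
    qed
    then have "(\<lambda>k. L2norm (?q (X k))) \<longlonglongrightarrow> 0"
      by (rule LIMSEQ_offset)
    then show "((\<lambda>h. L2norm (?q h)) \<circ> X) \<longlonglongrightarrow> 0"
      by (simp add: o_def)
  qed
qed

text \<open>A conservation law: the derivative of the pairing is - i <w, v> + i <u, H v>, which
  vanishes by \<open>hardyH_gauss_symmetric\<close>.\<close>

lemma l2inner_gauss_const:
  assumes u: "\<And>t. L2_deriv u (\<lambda>x. - \<i> * w t x) t" and H: "\<And>t. hardyH (u t) (w t)"
    and dim: "DIM('a::euclidean_space) \<ge> 3"
  shows "l2inner (u t) (gauss (gauss_time t) :: 'a \<Rightarrow> complex) = l2inner (u 0) (gauss (gauss_time 0))"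
proof -
  have "((\<lambda>t. l2inner (u t) (gauss (gauss_time t))) has_vector_derivative 0) (at t)" for t
  proof -
    have "l2inner (\<lambda>x. - \<i> * w t x) (gauss (gauss_time t)) + l2inner (u t) (\<lambda>x. - \<i> * hardy_gauss (gauss_time t) x) = 0"
      unfolding l2inner_cmult_left l2inner_cmult_right hardyH_gauss_symmetric[OF H Re_gauss_time_pos dim] by simp
    then show ?thesis
      using l2inner_has_vector_derivative[OF u L2_deriv_gauss, of t] by simp
  qed
  then have "\<exists>c. \<forall>t\<in>UNIV. l2inner (u t) (gauss (gauss_time t)) = c"
    by (intro has_derivative_zero_constant) (auto simp: has_vector_derivative_def)
  then show ?thesis by auto
qed

text \<open>Expand the squared \<open>L2\<close> distance between U(t) g and the explicit curve into
  four pairings. The mixed ones and the norm of the curve are conserved by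
  \<open>l2inner_gauss_const\<close>, the norm of U(t) g by the isometry; all four equal their
  common initial value and cancel.\<close>

lemma schr_group_gauss:
  fixes U :: "real \<Rightarrow> ('a::euclidean_space \<Rightarrow> complex) \<Rightarrow> ('a \<Rightarrow> complex)"
  assumes U: "schr_group U" and dim: "DIM('a) \<ge> 3"
  shows "AE x in lebesgue. U t (gauss 1) x = gauss (gauss_time t) x"
proof -
  let ?v = "\<lambda>t. gauss (gauss_time t) :: 'a \<Rightarrow> complex" and ?g = "gauss 1 :: 'a \<Rightarrow> complex"
  have Hg: "hardyH (?v t) (hardy_gauss (gauss_time t))" for t
    by (rule hardyH_gauss[OF Re_gauss_time_pos dim])
  have Lv: "L2 (?v t)" for t by (rule L2_gauss[OF Re_gauss_time_pos])
  have v0: "?v 0 = ?g" by (simp add: gauss_time_0)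
  have Lg: "L2 ?g" using Lv[of 0] v0 by simp
  have LU: "L2 (U t ?g)" "L2norm (U t ?g) = L2norm ?g" for t
    using U[unfolded schr_group_def, THEN conjunct1, THEN spec, THEN spec, THEN mp, OF Lg] by blast+
  have dom: "hardyH ?g (hardy_gauss 1)" using Hg[of 0] by (simp add: gauss_time_0)
  note U_dom = U[unfolded schr_group_def, THEN conjunct2, THEN conjunct2, THEN spec, THEN spec, THEN mp, OF dom]
  have U0: "AE x in lebesgue. U 0 ?g x = ?g x"
    by (rule U_dom[THEN conjunct1])
  \<comment> \<open>The group property yields a generator value separately for each time; a choice
    function makes it a curve.\<close>
  have "\<forall>t. \<exists>w'. hardyH (U t ?g) w' \<and>
      ((\<lambda>h. L2norm (\<lambda>x. (U (t + h) ?g x - U t ?g x) / complex_of_real h + \<i> * w' x)) \<longlongrightarrow> 0) (at 0)"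
    by (rule U_dom[THEN conjunct2])
  from choice[OF this] obtain w where w0: "\<forall>t. hardyH (U t ?g) (w t) \<and>
      ((\<lambda>h. L2norm (\<lambda>x. (U (t + h) ?g x - U t ?g x) / complex_of_real h + \<i> * w t x)) \<longlongrightarrow> 0) (at 0)" ..
  have w: "hardyH (U t ?g) (w t)"
    "((\<lambda>h. L2norm (\<lambda>x. (U (t + h) ?g x - U t ?g x) / complex_of_real h + \<i> * w t x)) \<longlongrightarrow> 0) (at 0)" for t
    using w0[THEN spec, of t] by (rule conjunct1, rule conjunct2)
  have "L2 (w t)" for t using w(1)[of t] by (simp add: hardyH_def)
  then have dU: "L2_deriv (\<lambda>t. U t ?g) (\<lambda>x. - \<i> * w t x) t" for t
    unfolding L2_deriv_def using w(2)[of t] by (intro conjI allI LU(1) L2_cmult) (simp_all only: mult_minus_left diff_minus_eq_add)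
  have 1: "l2inner (U t ?g) (?v t) = l2inner (U 0 ?g) (?v 0)"
    by (rule l2inner_gauss_const[OF dU w(1) dim])
  have 2: "l2inner (?v t) (?v t) = l2inner (?v 0) (?v 0)"
    by (rule l2inner_gauss_const[OF L2_deriv_gauss Hg dim])
  have 3: "l2inner (U 0 ?g) (?v 0) = l2inner (?v 0) (?v 0)"
    by (rule l2inner_cong_AE[OF LU(1) Lv Lv]) (use U0 v0 in simp)
  have 4: "l2inner (U t ?g) (U t ?g) = l2inner (?v 0) (?v 0)"
    unfolding l2inner_self LU(2) v0 ..
  have 5: "l2inner (?v t) (U t ?g) = l2inner (?v 0) (?v 0)"
    unfolding l2inner_commute[of "?v t"] 1 3 l2inner_self complex_cnj_complex_of_real ..
  have "l2inner (\<lambda>x. U t ?g x - ?v t x) (\<lambda>x. U t ?g x - ?v t x) = 0"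
    by (simp only: l2inner_diff_left[OF LU(1) Lv L2_diff[OF LU(1) Lv]]
        l2inner_diff_right[OF LU(1) Lv LU(1)] l2inner_diff_right[OF LU(1) Lv Lv] 1 2 3 4 5 diff_self)
  then have "L2norm (\<lambda>x. U t ?g x - ?v t x) = 0"
    unfolding l2inner_self by simp
  then show ?thesis
    by (rule L2_diff_zero_imp_AE_eq[OF LU(1) Lv])
qed

section \<open>Lorentz norms\<close>

lemma unit_ball_vol_neq_0 [simp]: "unit_ball_vol (real n) \<noteq> 0"
  using unit_ball_vol_pos[of "real n"] by linarith

lemma epowr_ennreal: "a \<ge> 0 \<Longrightarrow> epowr (ennreal a) b = ennreal (a powr b)"
  by (simp add: epowr_def)

lemma epowr_mono:
  assumes "x \<le> y" "0 \<le> b" shows "epowr x b \<le> epowr y b"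
proof (cases "y = top")
  case False
  then have "x \<noteq> top" using assms(1) by (auto simp: top_unique)
  with False have "enn2real x \<le> enn2real y"
    using assms(1) by (simp add: enn2real_mono less_top)
  then show ?thesis
    using False \<open>x \<noteq> top\<close> assms(2) by (simp add: epowr_def ennreal_leI powr_mono2)
qed (simp add: epowr_def)

lemma epowr_1: "epowr x 1 = x"
  by (cases x) (simp_all add: epowr_def)

lemma epowr_top: "epowr top b = top"
  by (simp add: epowr_def)

lemma borel_measurable_norm_greater:
  fixes f :: "'a::euclidean_space \<Rightarrow> complex"
  shows "f \<in> borel_measurable lebesgue \<Longrightarrow> {x. lam < norm (f x)} \<in> sets lebesgue"
  using borel_measurable_less[of "\<lambda>_. lam" lebesgue "\<lambda>x. norm (f x)"] by simp

lemma inverse_upper_exp: "1 / upper_exp DIM('a::euclidean_space) = crit_exp TYPE('a) / real DIM('a)"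
  by (simp add: upper_exp_def crit_exp_def divide_simps)

lemma inverse_lower_exp: "1 / lower_exp DIM('a::euclidean_space) = (crit_exp TYPE('a) + 2) / real DIM('a)"
  by (simp add: lower_exp_def crit_exp_def divide_simps)

text \<open>Let r be the radius of the ball of volume s. Any level below k r^-c is exceeded on a
  slightly larger ball, hence on a set of measure above s, and is not admissible in
  \<open>rearr\<close>. The bound does not depend on s because the exponent is critical: 1/p =
  c/n.\<close>

lemma rearr_lower_bound:
  fixes f :: "'a::euclidean_space \<Rightarrow> complex"
  assumes dim: "DIM('a) \<ge> 3" and f: "f \<in> borel_measurable lebesgue" and k: "k > 0"
    and lower: "AE x in lebesgue. norm x < \<rho> \<longrightarrow> k * norm x powr - crit_exp TYPE('a) \<le> norm (f x)"
    and s: "0 < s" "s < unit_ball_vol (real DIM('a)) * \<rho> ^ DIM('a)" and \<rho>: "\<rho> > 0"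
  shows "ennreal (k * unit_ball_vol (real DIM('a)) powr (crit_exp TYPE('a) / real DIM('a)))
    \<le> ennreal (s powr (1 / upper_exp DIM('a))) * rearr f s"
proof -
  let ?n = "DIM('a)" and ?c = "crit_exp TYPE('a)"
  let ?V = "unit_ball_vol (real ?n)"
  have V: "?V > 0" by simp
  have n: "?n > 0" by simp
  have c: "?c > 0" using dim by (simp add: crit_exp_def)
  define r where "r = (s / ?V) powr (1 / real ?n)"
  have r0: "r > 0" using s V by (simp add: r_def)
  have rn: "?V * r ^ ?n = s"
    using s V by (simp add: r_def powr_powr flip: powr_realpow)
  have r\<rho>: "r < \<rho>"
  proof -
    have "r ^ ?n < \<rho> ^ ?n" using s(2) rn V by (metis mult_less_cancel_left_pos)
    then show ?thesis using \<rho> power_less_imp_less_base by (metis less_imp_le)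
  qed
  have "k * r powr - ?c \<le> lam" if lam: "0 \<le> lam" "distrib_fn f lam \<le> ennreal s" for lam
  proof (rule ccontr)
    assume "\<not> k * r powr - ?c \<le> lam"
    then have less: "lam < k * r powr - ?c" by simp
    \<comment> \<open>The ball of radius r has measure exactly s, which is still admissible;
      continuity provides a radius \<open>y\<close> strictly larger for which the level is still
      exceeded.\<close>
    have "((\<lambda>y. k * y powr - ?c) \<longlongrightarrow> k * r powr - ?c) (at_right r)"
      using r0 by (intro tendsto_intros) auto
    then have "\<forall>\<^sub>F y in at_right r. lam < k * y powr - ?c"
      using less by (rule order_tendstoD)
    moreover have "\<forall>\<^sub>F y in at_right r. y \<in> {r<..<\<rho>}"
      using r\<rho> by (rule eventually_at_right_real)
    ultimately have "\<forall>\<^sub>F y in at_right r. lam < k * y powr - ?c \<and> y \<in> {r<..<\<rho>}"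
      by (rule eventually_conj)
    then obtain y where y: "lam < k * y powr - ?c" "r < y" "y < \<rho>"
      using eventually_happens'[OF trivial_limit_at_right_real] by auto
    have "emeasure lebesgue (ball (0::'a) y) \<le> emeasure lebesgue {x. lam < norm (f x)}"
    proof (rule emeasure_mono_AE)
      show "AE x in lebesgue. x \<in> ball 0 y \<longrightarrow> x \<in> {x. lam < norm (f x)}"
        using lower AE_lebesgue_nonzero
      proof eventually_elim
        case (elim x)
        show ?case
        proof
          assume "x \<in> ball 0 y"
          then have x: "norm x < y" by simp
          then have "y powr - ?c \<le> norm x powr - ?c"
            using elim(2) c by (intro powr_mono2') auto
          then have "k * y powr - ?c \<le> k * norm x powr - ?c" using k by simp
          also have "\<dots> \<le> norm (f x)" using elim(1) x y by auto
          finally show "x \<in> {x. lam < norm (f x)}" using y by simp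
        qed
      qed
    qed (rule borel_measurable_norm_greater[OF f])
    also have "\<dots> \<le> ennreal s" using lam(2) by (simp add: distrib_fn_def)
    finally have "?V * y ^ ?n \<le> s"
      using y r0 s by (simp add: emeasure_ball)
    moreover have "?V * r ^ ?n < ?V * y ^ ?n"
      using y r0 V n by (intro mult_strict_left_mono power_strict_mono) auto
    ultimately show False using rn by simp
  qed
  then have "ennreal (k * r powr - ?c) \<le> rearr f s"
    unfolding rearr_def by (intro INF_greatest ennreal_leI) auto
  then have "ennreal (s powr (1 / upper_exp ?n)) * ennreal (k * r powr - ?c) \<le> ennreal (s powr (1 / upper_exp ?n)) * rearr f s"
    by (intro mult_left_mono) auto
  moreover have "s powr (1 / upper_exp ?n) * (k * r powr - ?c) = k * ?V powr (?c / real ?n)"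
    using s V unfolding inverse_upper_exp r_def
    by (simp add: powr_powr powr_divide powr_minus divide_simps)
  ultimately show ?thesis
    using k by (simp flip: ennreal_mult)
qed

lemma lorentz_weak_lower_bound:
  fixes f :: "'a::euclidean_space \<Rightarrow> complex"
  assumes dim: "DIM('a) \<ge> 3" and f: "f \<in> borel_measurable lebesgue" and k: "k > 0"
    and lower: "AE x in lebesgue. norm x < \<rho> \<longrightarrow> k * norm x powr - crit_exp TYPE('a) \<le> norm (f x)"
    and \<rho>: "\<rho> > 0"
  shows "ennreal (k * unit_ball_vol (real DIM('a)) powr (crit_exp TYPE('a) / real DIM('a)))
    \<le> lorentz_weak (upper_exp DIM('a)) f"
proof -
  \<comment> \<open>Half the volume of the ball: a concrete point at which the lower bound on
    \<open>rearr\<close> applies, and one point suffices for a supremum.\<close>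
  let ?s = "unit_ball_vol (real DIM('a)) * \<rho> ^ DIM('a) / 2"
  have s: "0 < ?s" using \<rho> by simp
  then have "?s < unit_ball_vol (real DIM('a)) * \<rho> ^ DIM('a)" by linarith
  from rearr_lower_bound[OF dim f k lower s this \<rho>] show ?thesis
    unfolding lorentz_weak_def by (rule SUP_upper2[rotated]) (use s in simp)
qed

text \<open>The interval from d exp(-b) to d alone contributes b, for every b >= 0.\<close>

lemma nn_integral_inverse_eq_top:
  assumes "d > 0" shows "(\<integral>\<^sup>+s. ennreal (inverse s) * indicator {0<..d} s \<partial>lborel) = top"
proof -
  have "ennreal b \<le> (\<integral>\<^sup>+s. ennreal (inverse s) * indicator {0<..d} s \<partial>lborel)" if b: "b \<ge> 0" for b
  proof -
    have "d * exp (-b) \<le> d" using assms b by simp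
    have "ennreal b = ennreal (ln d - ln (d * exp (-b)))"
      using assms by (simp add: ln_mult)
    also have "\<dots> = (\<integral>\<^sup>+s. ennreal (inverse s) * indicator {d * exp (-b)..d} s \<partial>lborel)"
    proof (rule nn_integral_FTC_Icc[symmetric])
      fix r assume "r \<in> {d * exp (-b)..d}"
      then have "r > 0" using assms mult_pos_pos[OF assms exp_gt_zero, of "-b"] by (auto simp del: exp_gt_zero zero_less_mult_iff)
      then show "(ln has_real_derivative inverse r) (at r)" "0 \<le> inverse r"
        by (auto intro!: derivative_eq_intros simp: divide_inverse)
    qed (use \<open>d * exp (-b) \<le> d\<close> in auto)
    also have "\<dots> \<le> (\<integral>\<^sup>+s. ennreal (inverse s) * indicator {0<..d} s \<partial>lborel)"
    proof (intro nn_integral_mono mult_left_mono)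
      show "indicator {d * exp (-b)..d} s \<le> (indicator {0<..d} s :: ennreal)" for s
        using mult_pos_pos[OF assms exp_gt_zero, of "-b"] by (auto simp: indicator_def simp del: exp_gt_zero zero_less_mult_iff)
    qed simp
    finally show ?thesis .
  qed
  note le = this
  show ?thesis
  proof (rule ccontr)
    assume "(\<integral>\<^sup>+s. ennreal (inverse s) * indicator {0<..d} s \<partial>lborel) \<noteq> top"
    then obtain c where c: "c \<ge> 0" "(\<integral>\<^sup>+s. ennreal (inverse s) * indicator {0<..d} s \<partial>lborel) = ennreal c"
      by (metis ennreal_cases)
    with le[of "c + 1"] show False by simp
  qed
qed

text \<open>By \<open>rearr_lower_bound\<close> the integrand is at least a positive constant times
  1/s near s = 0, whatever the finite second index; the divergence is logarithmic.\<close>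

lemma lorentz_norm_eq_top:
  fixes f :: "'a::euclidean_space \<Rightarrow> complex"
  assumes dim: "DIM('a) \<ge> 3" and f: "f \<in> borel_measurable lebesgue" and k: "k > 0"
    and lower: "AE x in lebesgue. norm x < \<rho> \<longrightarrow> k * norm x powr - crit_exp TYPE('a) \<le> norm (f x)"
    and \<rho>: "\<rho> > 0" and q: "q \<ge> 1"
  shows "lorentz_norm (upper_exp DIM('a)) q f = top"
proof -
  let ?n = "DIM('a)" and ?V = "unit_ball_vol (real DIM('a))"
  define d where "d = ?V * \<rho> ^ ?n / 2"
  have d: "d > 0" "d < ?V * \<rho> ^ ?n" using \<rho> by (simp_all add: d_def)
  define K where "K = k * ?V powr (crit_exp TYPE('a) / real ?n)"
  have K: "K > 0" using k by (simp add: K_def)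
  have "top = ennreal (K powr q) * (\<integral>\<^sup>+s. ennreal (inverse s) * indicator {0<..d} s \<partial>lborel)"
    using K by (simp add: nn_integral_inverse_eq_top[OF d(1)] ennreal_mult_top)
  also have "\<dots> = (\<integral>\<^sup>+s. ennreal (K powr q) * (ennreal (inverse s) * indicator {0<..d} s) \<partial>lborel)"
    by (rule nn_integral_cmult[symmetric]) measurable
  also have "\<dots> \<le> (\<integral>\<^sup>+ s. indicator {0<..} s * epowr (ennreal (s powr (1 / upper_exp ?n)) * rearr f s) q / ennreal s \<partial>lborel)"
  proof (rule nn_integral_mono)
    fix s :: real
    show "ennreal (K powr q) * (ennreal (inverse s) * indicator {0<..d} s) \<le>
       indicator {0<..} s * epowr (ennreal (s powr (1 / upper_exp ?n)) * rearr f s) q / ennreal s"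
    proof (cases "s \<in> {0<..d}")
      case True
      then have "ennreal K \<le> ennreal (s powr (1 / upper_exp ?n)) * rearr f s"
        unfolding K_def using d by (intro rearr_lower_bound[OF dim f k lower _ _ \<rho>]) auto
      then have "epowr (ennreal K) q \<le> epowr (ennreal (s powr (1 / upper_exp ?n)) * rearr f s) q"
        using q by (intro epowr_mono) auto
      then have "ennreal (K powr q) * inverse (ennreal s) \<le> epowr (ennreal (s powr (1 / upper_exp ?n)) * rearr f s) q * inverse (ennreal s)"
        using K by (intro mult_right_mono) (auto simp: epowr_ennreal)
      then show ?thesis
        using True by (simp add: divide_ennreal_def inverse_ennreal)
    qed simp
  qed
  finally show ?thesis
    by (simp add: lorentz_norm_def top_unique epowr_top)
qed

lemma lorentz_norm_zero: "lorentz_norm p 1 (\<lambda>x. 0) = 0"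
proof -
  have "rearr (\<lambda>x::'a. 0) s = 0" for s
  proof -
    have "rearr (\<lambda>x::'a. 0) s \<le> ennreal 0"
      unfolding rearr_def by (rule INF_lower) (simp add: distrib_fn_def)
    then show ?thesis by simp
  qed
  then show ?thesis
    by (simp add: lorentz_norm_def epowr_1)
qed

text \<open>At z = 1 the modulus decreases with the radius, so the set where it exceeds its value at
  radius r lies inside the ball of radius r, whose volume is s.\<close>

lemma rearr_gauss_le:
  assumes dim: "DIM('a::euclidean_space) \<ge> 3" and s: "s > 0"
    and r: "r = (s / unit_ball_vol (real DIM('a))) powr (1 / real DIM('a))"
  shows "rearr (gauss 1 :: 'a \<Rightarrow> complex) s \<le> ennreal (r powr - crit_exp TYPE('a) * exp (- r\<^sup>2))"
proof -
  let ?n = "DIM('a)" and ?c = "crit_exp TYPE('a)"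
  let ?V = "unit_ball_vol (real ?n)"
  have V: "?V > 0" by simp
  have c: "?c > 0" using dim by (simp add: crit_exp_def)
  have r0: "r > 0" using s V by (simp add: r)
  have rn: "?V * r ^ ?n = s"
    using s V by (simp add: r powr_powr flip: powr_realpow)
  have "{x::'a. r powr - ?c * exp (- r\<^sup>2) < norm (gauss 1 x)} \<subseteq> ball 0 r"
  proof (rule subsetI, rule ccontr)
    fix x :: 'a
    assume x: "x \<in> {x. r powr - ?c * exp (- r\<^sup>2) < norm (gauss 1 x)}" and "x \<notin> ball 0 r"
    then have le: "r \<le> norm x" by simp
    then have "norm x powr - ?c * exp (- (norm x)\<^sup>2) \<le> r powr - ?c * exp (- r\<^sup>2)"
      using r0 c by (intro mult_mono powr_mono2') (auto intro!: power_mono)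
    then show False using x by (simp add: norm_gauss)
  qed
  then have "distrib_fn (gauss 1 :: 'a \<Rightarrow> complex) (r powr - ?c * exp (- r\<^sup>2)) \<le> emeasure lebesgue (ball (0::'a) r)"
    unfolding distrib_fn_def by (intro emeasure_mono) auto
  also have "\<dots> = ennreal s"
    using r0 rn by (simp add: emeasure_ball)
  finally show ?thesis
    unfolding rearr_def by (intro INF_lower) auto
qed

text \<open>The dual exponent has 1/p = (c + 2)/n, so a rearrangement of order s^(-c/n) leaves
  s^(2/n - 1), integrable at 0; the Gaussian decay takes care of large s.\<close>

lemma lorentz_norm_gauss_finite:
  assumes dim: "DIM('a::euclidean_space) \<ge> 3"
  shows "lorentz_norm (lower_exp DIM('a)) 1 (gauss 1 :: 'a \<Rightarrow> complex) < top"
proof -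
  let ?n = "DIM('a)" and ?c = "crit_exp TYPE('a)" and ?g = "gauss 1 :: 'a \<Rightarrow> complex"
  let ?V = "unit_ball_vol (real ?n)"
  have V: "?V > 0" by simp
  have n: "real ?n > 0" by simp
  define C1 where "C1 = ?V powr (?c / real ?n)"
  define C2 where "C2 = 4 * ?V powr ((?c + 4) / real ?n)"
  define e1 where "e1 = 2 / real ?n - 1"
  define e2 where "e2 = - (2 / real ?n) - 1"
  have e: "e1 > -1" "e2 < -1" using n by (simp_all add: e1_def e2_def)
  have le: "ennreal (s powr (1 / lower_exp ?n)) * rearr ?g s / ennreal s \<le> ennreal (C1 * s powr e1)" (is "?L \<le> _")
       "ennreal (s powr (1 / lower_exp ?n)) * rearr ?g s / ennreal s \<le> ennreal (C2 * s powr e2)"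
    if s: "s > 0" for s
  proof -
    define r where "r = (s / ?V) powr (1 / real ?n)"
    have r0: "r > 0" using s V by (simp add: r_def)
    have "ennreal (s powr (1 / lower_exp ?n)) * rearr ?g s * inverse (ennreal s)
        \<le> ennreal (s powr (1 / lower_exp ?n)) * ennreal (r powr - ?c * exp (- r\<^sup>2)) * inverse (ennreal s)"
      by (intro mult_right_mono mult_left_mono rearr_gauss_le[OF dim s r_def]) auto
    also have "\<dots> = ennreal (s powr (1 / lower_exp ?n) * (r powr - ?c * exp (- r\<^sup>2)) * inverse s)"
      using s by (simp add: inverse_ennreal ennreal_mult)
    finally have L: "?L \<le> ennreal (s powr (1 / lower_exp ?n) * (r powr - ?c * exp (- r\<^sup>2)) * inverse s)"
      by (simp add: divide_ennreal_def)
    \<comment> \<open>Each power r^-a gained from the exponential lowers the exponent of s by a/n.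
      The choice a = 0 serves s <= 1, and a = 4, with constant 2^2 from \<open>power_le_exp\<close>,
      serves s >= 1.\<close>
    have bound: "?L \<le> ennreal (B * ?V powr ((?c + a) / real ?n) * s powr ((2 - a) / real ?n - 1))"
      if "exp (- r\<^sup>2) \<le> B * r powr - a" for a B
    proof -
      have "s powr (1 / lower_exp ?n) * (r powr - ?c * exp (- r\<^sup>2)) * inverse s
        \<le> s powr (1 / lower_exp ?n) * (r powr - ?c * (B * r powr - a)) * inverse s"
        using that s by (intro mult_right_mono mult_left_mono) auto
      also have "\<dots> = B * (s powr (1 / lower_exp ?n) * (r powr (- ?c + - a)) * s powr (-1))"
        unfolding powr_add using s by (simp add: powr_minus)
      also have "r powr (- ?c + - a) = s powr - ((?c + a) / real ?n) * ?V powr ((?c + a) / real ?n)"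
      proof -
        have "1 / real ?n * (- ?c + - a) = - ((?c + a) / real ?n)"
          using n by (simp add: field_simps)
        moreover have "(s / ?V) powr - d = s powr - d * ?V powr d" for d
          using s V by (simp add: powr_divide powr_minus divide_simps)
        ultimately show ?thesis
          unfolding r_def powr_powr by (simp only:)
      qed
      also have "s powr (1 / lower_exp ?n) * (s powr (- ((?c + a) / real ?n)) * ?V powr ((?c + a) / real ?n)) * s powr (-1)
         = ?V powr ((?c + a) / real ?n) * s powr (1 / lower_exp ?n + - ((?c + a) / real ?n) + -1)"
        unfolding powr_add by (simp only: ac_simps)
      also have "1 / lower_exp ?n + - ((?c + a) / real ?n) + -1 = (2 - a) / real ?n - 1"
        unfolding inverse_lower_exp using n by (simp add: field_simps)
      finally have "s powr (1 / lower_exp ?n) * (r powr - ?c * exp (- r\<^sup>2)) * inverse s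
        \<le> B * (?V powr ((?c + a) / real ?n) * s powr ((2 - a) / real ?n - 1))" .
      from order_trans[OF L ennreal_leI[OF this]] show ?thesis
        by (simp only: mult.assoc)
    qed
    have "exp (- r\<^sup>2) \<le> 1 * r powr - 0" using r0 by simp
    from bound[OF this] show "?L \<le> ennreal (C1 * s powr e1)"
      by (simp add: C1_def e1_def)
    have "(r\<^sup>2) ^ 2 \<le> real 2 ^ 2 * exp (r\<^sup>2)" by (rule power_le_exp) simp
    then have "exp (- r\<^sup>2) \<le> 4 * r powr - 4"
      using r0 by (simp add: exp_minus powr_minus field_simps)
    from bound[OF this] show "?L \<le> ennreal (C2 * s powr e2)"
      by (simp add: C2_def e2_def)
  qed
  have "lorentz_norm (lower_exp ?n) 1 ?g =
     (\<integral>\<^sup>+ s. indicator {0<..} s * (ennreal (s powr (1 / lower_exp ?n)) * rearr ?g s) / ennreal s \<partial>lborel)"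
    by (simp add: lorentz_norm_def epowr_1)
  also have "\<dots> \<le> (\<integral>\<^sup>+ s. ennreal C1 * (ennreal (s powr e1) * indicator {0..1} s) + ennreal C2 * (ennreal (s powr e2) * indicator {1..} s) \<partial>lborel)"
  proof (rule nn_integral_mono)
    fix s :: real
    show "indicator {0<..} s * (ennreal (s powr (1 / lower_exp ?n)) * rearr ?g s) / ennreal s
      \<le> ennreal C1 * (ennreal (s powr e1) * indicator {0..1} s) + ennreal C2 * (ennreal (s powr e2) * indicator {1..} s)"
    proof (cases "s > 0")
      case True
      have C: "C1 \<ge> 0" "C2 \<ge> 0" by (simp_all add: C1_def C2_def)
      show ?thesis
      proof (cases "s \<le> 1")
        case True
        with le(1)[OF \<open>s > 0\<close>] C \<open>s > 0\<close> show ?thesis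
          by (intro add_increasing2) (simp_all add: ennreal_mult)
      next
        case False
        with le(2)[OF \<open>s > 0\<close>] C \<open>s > 0\<close> show ?thesis
          by (simp add: ennreal_mult)
      qed
    qed simp
  qed
  also have "\<dots> = ennreal C1 * (\<integral>\<^sup>+ s. ennreal (s powr e1) * indicator {0..1} s \<partial>lborel)
     + ennreal C2 * (\<integral>\<^sup>+ s. ennreal (s powr e2) * indicator {1..} s \<partial>lborel)"
    by (simp add: nn_integral_add nn_integral_cmult)
  also have "\<dots> < top"
    using nn_integral_has_integral_lebesgue'[OF _ has_integral_powr_from_0[of e1 1]]
      nn_integral_has_integral_lebesgue'[OF _ has_integral_powr_to_inf[of e2 1]] e
    by (simp add: ennreal_mult_less_top)
  finally show ?thesis .
qed

lemma L2_time_lower_bound: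
  assumes "\<And>t. t \<in> {a..b} \<Longrightarrow> ennreal K \<le> N (u t)" "K \<ge> 0" "a \<le> b"
  shows "ennreal (K * sqrt (b - a)) \<le> L2_time N u"
proof -
  have "ennreal (K\<^sup>2 * (b - a)) = (\<integral>\<^sup>+ t. ennreal (K\<^sup>2) * indicator {a..b} t \<partial>lborel)"
    using assms by (simp add: nn_integral_cmult_indicator ennreal_mult)
  also have "\<dots> \<le> (\<integral>\<^sup>+ t. (N (u t))\<^sup>2 \<partial>lborel)"
  proof (rule nn_integral_mono)
    fix t show "ennreal (K\<^sup>2) * indicator {a..b} t \<le> (N (u t))\<^sup>2"
    proof (cases "t \<in> {a..b}")
      case True
      then have "(ennreal K)\<^sup>2 \<le> (N (u t))\<^sup>2" by (intro power_mono assms) auto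
      then show ?thesis using True assms(2) by (simp add: ennreal_power)
    qed simp
  qed
  finally have "epowr (ennreal (K\<^sup>2 * (b - a))) (1 / 2) \<le> L2_time N u"
    unfolding L2_time_def by (rule epowr_mono) simp
  then show ?thesis
    using assms by (simp add: epowr_ennreal powr_half_sqrt real_sqrt_mult)
qed

section \<open>Failure of the endpoint estimates\<close>

lemma norm_exp_minus_1_le:
  assumes "Re w \<ge> 0" shows "norm (exp (- w) - 1) \<le> norm w"
proof -
  have "norm (exp (- w) - exp 0) \<le> 1 * norm (- w - 0)"
    by (rule field_differentiable_bound[where S = "{z. Re z \<le> 0}" and f' = exp])
      (use assms in \<open>auto intro!: derivative_eq_intros convex_halfspace_Re_le\<close>)
  then show ?thesis by simp
qed

text \<open>Near the origin the Gaussian factor is nearly 1: replacing z exp(- z |x|^2) by z costs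
  at most |z|^2 |x|^2, and |z| <= 1. What remains is Im z, negative for positive times.\<close>

lemma Im_gauss_le:
  fixes x :: "'a::euclidean_space"
  shows "Im (gauss (gauss_time t) x) \<le> norm x powr - crit_exp TYPE('a) * (- 4 * t / (1 + 16 * t\<^sup>2) + (norm x)\<^sup>2)"
proof -
  let ?z = "gauss_time t" and ?s = "complex_of_real ((norm x)\<^sup>2)"
  have "Im (?z * (exp (- (?z * ?s)) - 1)) \<le> norm (?z * (exp (- (?z * ?s)) - 1))"
    by (metis abs_Im_le_cmod abs_le_D1)
  also have "\<dots> \<le> norm ?z * norm (?z * ?s)"
    unfolding norm_mult[of ?z "exp _ - 1"] using Re_gauss_time_pos[of t]
    by (intro mult_left_mono norm_exp_minus_1_le) auto
  also have "\<dots> = norm ?z * norm ?z * (norm x)\<^sup>2"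
    by (simp add: norm_mult norm_power)
  also have "\<dots> \<le> 1 * 1 * (norm x)\<^sup>2"
    using norm_gauss_time_le[of t] by (intro mult_right_mono mult_mono) auto
  finally have "Im (?z * exp (- (?z * ?s))) \<le> Im ?z + (norm x)\<^sup>2"
    by (simp add: algebra_simps)
  then have "norm x powr - crit_exp TYPE('a) * Im (?z * exp (- (?z * ?s)))
     \<le> norm x powr - crit_exp TYPE('a) * (Im ?z + (norm x)\<^sup>2)"
    by (rule mult_left_mono) simp
  moreover have "gauss ?z x = complex_of_real (norm x powr - crit_exp TYPE('a)) * (?z * exp (- (?z * ?s)))"
    by (simp add: gauss_def)
  then have "Im (gauss ?z x) = norm x powr - crit_exp TYPE('a) * Im (?z * exp (- (?z * ?s)))"
    by (simp only: Im_complex_of_real Re_complex_of_real times_complex.sel mult_zero_left add_0_right)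
  ultimately show ?thesis
    by (simp only: Im_gauss_time)
qed

lemma L2_indicator:
  fixes A :: "'a::euclidean_space set"
  assumes "A \<in> sets lebesgue" "A \<subseteq> ball 0 \<rho>" shows "L2 (indicator A :: 'a \<Rightarrow> complex)"
  unfolding L2_def
proof
  show "(indicator A :: 'a \<Rightarrow> complex) \<in> borel_measurable lebesgue"
    using assms by (intro borel_measurable_indicator)
  have "emeasure lebesgue A \<le> emeasure lebesgue (ball (0::'a) \<rho>)"
    by (rule emeasure_mono[OF assms(2)]) simp
  also have "\<dots> < \<infinity>" using emeasure_bounded_finite[OF bounded_ball, of 0 \<rho>] by simp
  finally have "integrable lebesgue (indicator A :: 'a \<Rightarrow> real)"
    using assms by (intro integrable_real_indicator)
  moreover have "(norm (indicator A x :: complex))\<^sup>2 = indicator A x" for x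
    by (simp add: indicator_def)
  ultimately show "integrable lebesgue (\<lambda>x. (norm (indicator A x :: complex))\<^sup>2)" by simp
qed

lemma integral_Im_gauss_bound:
  fixes t r :: real
  assumes "t > 0"
  shows "((\<lambda>s. - 4 * (t - s) / (1 + 16 * (t - s)\<^sup>2) + r) has_integral (r * t - ln (1 + 16 * t\<^sup>2) / 8)) {0..t}"
proof -
  \<comment> \<open>At s = t the logarithm vanishes, at s = 0 it produces the term that grows with
    t.\<close>
  let ?P = "\<lambda>s. ln (1 + 16 * (t - s)\<^sup>2) / 8 + r * s"
  have "((\<lambda>s. - 4 * (t - s) / (1 + 16 * (t - s)\<^sup>2) + r) has_integral (?P t - ?P 0)) {0..t}"
  proof (rule fundamental_theorem_of_calculus)
    fix s
    have pos: "1 + 16 * (t - s)\<^sup>2 > 0" by (simp add: add_pos_nonneg)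
    have "(?P has_real_derivative - 4 * (t - s) / (1 + 16 * (t - s)\<^sup>2) + r) (at s)"
      using pos by (auto intro!: derivative_eq_intros simp: field_simps)
    then show "(?P has_vector_derivative - 4 * (t - s) / (1 + 16 * (t - s)\<^sup>2) + r) (at s within {0..t})"
      by (simp add: has_real_derivative_iff_has_vector_derivative has_vector_derivative_at_within)
  qed (use assms in simp)
  then show ?thesis by simp
qed

lemma L2_deriv_const: "L2 f \<Longrightarrow> L2_deriv (\<lambda>t. f) (\<lambda>x. 0) t"
  by (simp add: L2_deriv_def L2norm_def)

lemma interval_integral_continuous:
  fixes f :: "real \<Rightarrow> complex"
  assumes "continuous_on UNIV f" "t \<ge> 0"
  shows "(f has_integral (LBINT s=0..t. f s)) {0..t}"
proof -
  have "continuous_on {0..t} f"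
    using assms(1) continuous_on_subset by blast
  then have "set_integrable lborel {0..t} f" "f integrable_on {0..t}"
    by (rule borel_integrable_atLeastAtMost', rule integrable_continuous_real)
  moreover from interval_integral_eq_integral[OF assms(2) this(1)]
  have "(LBINT s=0..t. f s) = integral {0..t} f"
    by (simp add: zero_ereal_def)
  ultimately show ?thesis by (simp add: has_integral_integral)
qed

text \<open>The Duhamel integral of the source frozen at \<open>gauss 1\<close> diverges logarithmically in time near the
  origin, because \<open>Im (gauss_time t)\<close> decays like \<open>- 1 / (4 t)\<close>.\<close>

lemma duhamel_gauss_lower_bound:
  fixes U :: "real \<Rightarrow> ('a::euclidean_space \<Rightarrow> complex) \<Rightarrow> ('a \<Rightarrow> complex)"
  assumes U: "schr_group U" and dim: "DIM('a) \<ge> 3"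
    and G: "duhamel U F G" and F: "\<forall>s\<in>{0..T}. F s = gauss 1"
    and t: "0 < t" "t \<le> T" and \<rho>: "\<rho> > 0" "\<rho>\<^sup>2 * T \<le> 1"
  shows "AE x in lebesgue. norm x < \<rho> \<longrightarrow>
    (ln (1 + 16 * t\<^sup>2) / 8 - 1) * norm x powr - crit_exp TYPE('a) \<le> norm (G t x)"
proof -
  let ?c = "crit_exp TYPE('a)"
  define K where "K = ln (1 + 16 * t\<^sup>2) / 8 - 1"
  have LG: "L2 (G t)"
    and duh: "\<And>\<phi>. L2 \<phi> \<Longrightarrow> l2inner (G t) \<phi> = (LBINT s=0..t. l2inner (U (t - s) (F s)) \<phi>)"
    using G unfolding duhamel_def by blast+
  have Gm [measurable]: "G t \<in> borel_measurable lebesgue" by (rule L2_measurable[OF LG])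
  have pm: "(\<lambda>x::'a. norm x powr - ?c) \<in> borel_measurable lebesgue"
    by (rule lebesgue_measurable_borel) measurable
  \<comment> \<open>The part of the ball where the desired upper bound on the imaginary part fails.
    Only pairings of \<open>G t\<close> are known, so its indicator is taken as the test function
    and \<open>A\<close> is shown to be null.\<close>
  define A where "A = {x. norm x < \<rho> \<and> - K * norm x powr - ?c < Im (G t x)}"
  have Im_m: "(\<lambda>x. Im (G t x)) \<in> borel_measurable lebesgue" by measurable
  have Am: "A \<in> sets lebesgue"
  proof -
    have "ball 0 \<rho> \<inter> {x \<in> space lebesgue. - K * norm x powr - ?c < Im (G t x)} \<in> sets lebesgue"
      by (intro sets.Int borel_measurable_less borel_measurable_times borel_measurable_const pm Im_m) simp
    moreover have "A = ball 0 \<rho> \<inter> {x \<in> space lebesgue. - K * norm x powr - ?c < Im (G t x)}"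
      by (auto simp: A_def)
    ultimately show ?thesis by simp
  qed
  have A\<rho>: "A \<subseteq> ball 0 \<rho>" by (auto simp: A_def)
  define \<phi> where "\<phi> = (indicator A :: 'a \<Rightarrow> complex)"
  have L\<phi>: "L2 \<phi>" unfolding \<phi>_def by (rule L2_indicator[OF Am A\<rho>])
  let ?m = "\<lambda>x. indicator A x * norm x powr - ?c"
  have im: "integrable lebesgue ?m"
  proof (rule Bochner_Integration.integrable_bound[OF integrable_radial_powr_near[of ?c \<rho>]])
    show "AE x in lebesgue. norm (?m x) \<le> norm (norm x powr - ?c * indicator {..\<rho>} (norm x))"
      by (rule AE_I2) (auto simp: A_def indicator_def)
    show "?m \<in> borel_measurable lebesgue"
      by (intro borel_measurable_times borel_measurable_indicator Am pm)
  qed (use \<rho> in \<open>auto simp: crit_exp_def\<close>)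
  define M where "M = (\<integral>x. ?m x \<partial>lebesgue)"
  have Im_inner: "Im (l2inner f \<phi>) = (\<integral>x. indicator A x * Im (f x) \<partial>lebesgue)"
    and int_Im: "integrable lebesgue (\<lambda>x. indicator A x * Im (f x))" if "L2 f" for f
  proof -
    have eq: "Im (f x * cnj (\<phi> x)) = indicator A x * Im (f x)" for x
      by (simp add: \<phi>_def indicator_def)
    show "Im (l2inner f \<phi>) = (\<integral>x. indicator A x * Im (f x) \<partial>lebesgue)"
      unfolding l2inner_def eq[symmetric] by (rule integral_Im[OF L2_mult_integrable[OF that L\<phi>], symmetric])
    show "integrable lebesgue (\<lambda>x. indicator A x * Im (f x))"
      unfolding eq[symmetric] by (rule integrable_Im[OF L2_mult_integrable[OF that L\<phi>]])
  qed
  define J where "J \<tau> = l2inner (gauss (gauss_time \<tau>)) \<phi>" for \<tau>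
  have J_le: "Im (J \<tau>) \<le> (- 4 * \<tau> / (1 + 16 * \<tau>\<^sup>2) + \<rho>\<^sup>2) * M" for \<tau>
  proof -
    have "Im (J \<tau>) = (\<integral>x. indicator A x * Im (gauss (gauss_time \<tau>) x) \<partial>lebesgue)"
      unfolding J_def by (rule Im_inner[OF L2_gauss[OF Re_gauss_time_pos]])
    also have "\<dots> \<le> (\<integral>x. (- 4 * \<tau> / (1 + 16 * \<tau>\<^sup>2) + \<rho>\<^sup>2) * ?m x \<partial>lebesgue)"
    proof (rule integral_mono[OF int_Im[OF L2_gauss[OF Re_gauss_time_pos]] integrable_mult_right[OF im]])
      fix x :: 'a
      show "indicator A x * Im (gauss (gauss_time \<tau>) x) \<le> (- 4 * \<tau> / (1 + 16 * \<tau>\<^sup>2) + \<rho>\<^sup>2) * ?m x"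
      proof (cases "x \<in> A")
        case True
        then have "(norm x)\<^sup>2 \<le> \<rho>\<^sup>2" by (intro power_mono) (auto simp: A_def)
        then have "norm x powr - ?c * (- 4 * \<tau> / (1 + 16 * \<tau>\<^sup>2) + (norm x)\<^sup>2) \<le> norm x powr - ?c * (- 4 * \<tau> / (1 + 16 * \<tau>\<^sup>2) + \<rho>\<^sup>2)"
          by (intro mult_left_mono add_left_mono) auto
        with Im_gauss_le[of \<tau> x] True show ?thesis by (simp add: mult.commute)
      qed simp
    qed
    finally show ?thesis by (simp add: M_def)
  qed
  \<comment> \<open>Pairing with the constant curve \<open>\<phi>\<close>: the derivative is wanted
    here for the continuity of \<open>J\<close>, by which the interval integral becomes a gauge
    integral that can be compared.\<close>
  have "(J has_vector_derivative l2inner (\<lambda>x. - \<i> * hardy_gauss (gauss_time \<tau>) x) \<phi> + l2inner (gauss (gauss_time \<tau>)) (\<lambda>x::'a. 0)) (at \<tau>)" for \<tau>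
    using l2inner_has_vector_derivative[OF L2_deriv_gauss L2_deriv_const[OF L\<phi>], of \<tau>]
    unfolding J_def[abs_def] .
  then have "continuous_on UNIV J"
    by (meson continuous_at_imp_continuous_on has_vector_derivative_continuous)
  then have contJ: "continuous_on UNIV (\<lambda>s. J (t - s))"
    by (rule continuous_on_compose2) (auto intro!: continuous_intros)
  have "l2inner (G t) \<phi> = (LBINT s=0..t. J (t - s))"
    unfolding duh[OF L\<phi>]
  proof (rule interval_integral_cong)
    fix s assume "s \<in> einterval (min 0 (ereal t)) (max 0 (ereal t))"
    then have "s \<in> {0..T}" using t by (auto simp: einterval_def min_def max_def)
    then have Fs: "F s = gauss 1" using F by blast
    have "L2 (U (t - s) (gauss 1))"
      using U[unfolded schr_group_def, THEN conjunct1, THEN spec, THEN spec, THEN mp, OF L2_gauss[of 1]] by simp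
    then show "l2inner (U (t - s) (F s)) \<phi> = J (t - s)"
      unfolding Fs J_def
      by (rule l2inner_cong_AE[OF _ L2_gauss[OF Re_gauss_time_pos] L\<phi> schr_group_gauss[OF U dim]])
  qed
  with interval_integral_continuous[OF contJ, of t] t
  have "((\<lambda>s. J (t - s)) has_integral l2inner (G t) \<phi>) {0..t}" by simp
  from has_integral_linear[OF this bounded_linear_Im]
  have "((\<lambda>s. Im (J (t - s))) has_integral Im (l2inner (G t) \<phi>)) {0..t}" by (simp add: o_def)
  moreover have "((\<lambda>s. (- 4 * (t - s) / (1 + 16 * (t - s)\<^sup>2) + \<rho>\<^sup>2) * M) has_integral (\<rho>\<^sup>2 * t - ln (1 + 16 * t\<^sup>2) / 8) * M) {0..t}"
    by (rule has_integral_mult_left[OF integral_Im_gauss_bound[OF t(1)]])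
  ultimately have "Im (l2inner (G t) \<phi>) \<le> (\<rho>\<^sup>2 * t - ln (1 + 16 * t\<^sup>2) / 8) * M"
    by (rule has_integral_le) (rule J_le)
  also have "\<dots> \<le> - K * M"
  proof (rule mult_right_mono)
    \<comment> \<open>The error accumulated from |x|^2 over the time interval is at most rho^2 T <=
      1; this is the 1 subtracted in \<open>K\<close>.\<close>
    have "\<rho>\<^sup>2 * t \<le> \<rho>\<^sup>2 * T" using t by (intro mult_left_mono) auto
    then show "\<rho>\<^sup>2 * t - ln (1 + 16 * t\<^sup>2) / 8 \<le> - K" using \<rho> unfolding K_def by linarith
    show "M \<ge> 0" unfolding M_def by (rule integral_nonneg_AE) auto
  qed
  finally have le: "(\<integral>x. indicator A x * Im (G t x) \<partial>lebesgue) \<le> - K * M"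
    unfolding Im_inner[OF LG] .
  \<comment> \<open>Nonnegative everywhere and strictly positive on \<open>A\<close>, yet with
    integral at most zero; so it vanishes almost everywhere and \<open>A\<close> is
    negligible.\<close>
  define f where "f x = indicator A x * Im (G t x) + K * ?m x" for x
  have fi: "integrable lebesgue f"
    unfolding f_def by (intro Bochner_Integration.integrable_add int_Im LG integrable_mult_right im)
  have "(\<integral>x. f x \<partial>lebesgue) = (\<integral>x. indicator A x * Im (G t x) \<partial>lebesgue) + K * M"
    unfolding f_def M_def
    by (subst Bochner_Integration.integral_add[OF int_Im[OF LG] integrable_mult_right[OF im]]) simp
  with le have "(\<integral>x. f x \<partial>lebesgue) \<le> 0" by simp
  moreover have f0: "f x \<ge> 0" for x
    by (auto simp: f_def A_def indicator_def)
  then have "(\<integral>x. f x \<partial>lebesgue) \<ge> 0" by simp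
  ultimately have "(\<integral>x. f x \<partial>lebesgue) = 0" by linarith
  then have "AE x in lebesgue. f x = 0"
    using integral_nonneg_eq_0_iff_AE[OF fi] f0 by simp
  then show ?thesis
  proof eventually_elim
    case (elim x)
    show ?case
    proof
      assume "norm x < \<rho>"
      moreover have "x \<notin> A" using elim by (auto simp: f_def A_def)
      ultimately have "K * norm x powr - ?c \<le> - Im (G t x)" by (auto simp: A_def)
      also have "\<dots> \<le> norm (G t x)" using abs_Im_le_cmod[of "G t x"] by linarith
      finally show "(ln (1 + 16 * t\<^sup>2) / 8 - 1) * norm x powr - ?c \<le> norm (G t x)"
        unfolding K_def .
    qed
  qed
qed

lemma radial_gauss: "radial (gauss z)"
  by (simp add: radial_def gauss_def)

theorem theorem2p7:
  fixes U :: "real \<Rightarrow> ('a::euclidean_space \<Rightarrow> complex) \<Rightarrow> ('a \<Rightarrow> complex)"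
  assumes "DIM('a) \<ge> 3"
    and "schr_group U"
  shows "(\<exists>\<psi>. L2 \<psi> \<and> radial \<psi> \<and>
            (\<forall>q::real. 1 \<le> q \<longrightarrow>
               L2_time (lorentz_norm (upper_exp DIM('a)) q) (\<lambda>t. U t \<psi>) = top))
      \<and> (\<forall>C::real. C > 0 \<longrightarrow>
           (\<exists>F :: real \<Rightarrow> 'a \<Rightarrow> complex.
              (\<lambda>(t, x). F t x) \<in> borel_measurable (lborel \<Otimes>\<^sub>M lebesgue) \<and>
              (\<forall>t. L2 (F t)) \<and>
              (\<forall>a b. (\<integral>\<^sup>+ s\<in>{a..b}. ennreal (L2norm (F s)) \<partial>lborel) < top) \<and>
              (AE t in lborel. radial (F t)) \<and>
              L2_time (lorentz_norm (lower_exp DIM('a)) 1) F < top \<and>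
              (\<forall>G. duhamel U F G \<longrightarrow>
                 L2_time (lorentz_weak (upper_exp DIM('a))) G
                   > ennreal C * L2_time (lorentz_norm (lower_exp DIM('a)) 1) F)))"
proof (intro conjI allI impI)
  note dim = assms(1) and U = assms(2)
  let ?c = "crit_exp TYPE('a)" and ?n = "DIM('a)"
  let ?\<psi> = "gauss 1 :: 'a \<Rightarrow> complex"
  have L\<psi>: "L2 ?\<psi>" by (rule L2_gauss) simp
  have LU: "L2 (U t ?\<psi>)" for t
    using U[unfolded schr_group_def, THEN conjunct1, THEN spec, THEN spec, THEN mp, OF L\<psi>] by simp
  show "\<exists>\<psi>. L2 \<psi> \<and> radial \<psi> \<and>
            (\<forall>q::real. 1 \<le> q \<longrightarrow> L2_time (lorentz_norm (upper_exp ?n) q) (\<lambda>t. U t \<psi>) = top)"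
  proof (intro exI conjI allI impI)
    fix q :: real assume q: "1 \<le> q"
    have "lorentz_norm (upper_exp ?n) q (U t ?\<psi>) = top" for t
    proof (rule lorentz_norm_eq_top[OF dim L2_measurable[OF LU] _ _ zero_less_one q])
      let ?z = "gauss_time t"
      \<comment> \<open>On the unit ball Re z |x|^2 is at most 1, so the Gaussian factor costs no
        more than exp(-1).\<close>
      show "norm ?z * exp (-1) > 0" by (simp add: gauss_time_def gauss_time_denom)
      show "AE x in lebesgue. norm x < 1 \<longrightarrow> norm ?z * exp (-1) * norm x powr - ?c \<le> norm (U t ?\<psi> x)"
        using schr_group_gauss[OF U dim, of t]
      proof eventually_elim
        case (elim x)
        show ?case
        proof
          assume "norm x < 1"
          then have "(norm x)\<^sup>2 \<le> 1" by (simp add: power_le_one)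
          moreover have "Re ?z \<le> 1"
            using norm_gauss_time_le complex_Re_le_cmod order_trans by blast
          ultimately have "Re ?z * (norm x)\<^sup>2 \<le> 1 * 1"
            using Re_gauss_time_pos[of t] by (intro mult_mono) auto
          then have "norm ?z * norm x powr - ?c * exp (-1) \<le> norm ?z * norm x powr - ?c * exp (- Re ?z * (norm x)\<^sup>2)"
            by (intro mult_left_mono) auto
          then show "norm ?z * exp (-1) * norm x powr - ?c \<le> norm (U t ?\<psi> x)"
            unfolding elim norm_gauss by (simp add: ac_simps)
        qed
      qed
    qed
    then show "L2_time (lorentz_norm (upper_exp ?n) q) (\<lambda>t. U t ?\<psi>) = top"
      by (simp add: L2_time_def epowr_top power2_eq_square ennreal_top_mult)
  qed (use L\<psi> radial_gauss in auto)

  fix C :: real assume C: "C > 0"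
  define N0 where "N0 = enn2real (lorentz_norm (lower_exp ?n) 1 ?\<psi>)"
  have N0: "lorentz_norm (lower_exp ?n) 1 ?\<psi> = ennreal N0" "N0 \<ge> 0"
    using lorentz_norm_gauss_finite[OF dim] by (simp_all add: N0_def)
  define B where "B = unit_ball_vol (real ?n) powr (?c / real ?n)"
  have B: "B > 0" by (simp add: B_def)
  \<comment> \<open>The amplitude at which the two sides would balance: C N0 sqrt(T) = D B
    sqrt(T/2). The factor \<open>sqrt 2\<close> pays for using only the second half of the time
    interval.\<close>
  define D where "D = C * N0 * sqrt 2 / B"
  have D: "D \<ge> 0" using C N0 B by (simp add: D_def)
  \<comment> \<open>Makes ln(T^2) = 8 (D + 2), so that an eighth of the logarithm exceeds D even
    after 1 is subtracted.\<close>
  define T where "T = exp (4 * (D + 2))"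
  have T: "T \<ge> 1" using D by (simp add: T_def)
  \<comment> \<open>The amplitude of \<open>duhamel_gauss_lower_bound\<close> at t = T/2, hence a
    lower bound for it on all of [T/2, T].\<close>
  define K where "K = ln (1 + 4 * T\<^sup>2) / 8 - 1"
  have K: "K > D"
  proof -
    have "8 * (D + 2) = ln (T\<^sup>2)"
      by (simp add: T_def ln_realpow)
    also have "\<dots> < ln (1 + 4 * T\<^sup>2)"
      using T by (subst ln_less_cancel_iff) (auto simp: add_pos_nonneg)
    finally show ?thesis by (simp add: K_def)
  qed
  define F where "F t x = indicator {0..T} t * ?\<psi> x" for t :: real and x :: 'a
  have F_in: "F t = ?\<psi>" if "t \<in> {0..T}" for t using that by (simp add: F_def fun_eq_iff)
  then have F_T: "\<forall>s\<in>{0..T}. F s = ?\<psi>" by blast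
  have F_out: "F t = (\<lambda>x. 0)" if "t \<notin> {0..T}" for t using that by (simp add: F_def fun_eq_iff)
  have LF: "L2 (F t)" for t using L\<psi> F_in F_out by (cases "t \<in> {0..T}") auto
  have "L2_time (lorentz_norm (lower_exp ?n) 1) F = epowr (\<integral>\<^sup>+ t. ennreal (N0\<^sup>2) * indicator {0..T} t \<partial>lborel) (1 / 2)"
    unfolding L2_time_def
  proof (intro arg_cong2[where f = epowr] nn_integral_cong refl)
    fix t show "(lorentz_norm (lower_exp ?n) 1 (F t))\<^sup>2 = ennreal (N0\<^sup>2) * indicator {0..T} t"
      using N0 F_in[of t] F_out[of t] by (cases "t \<in> {0..T}") (auto simp: ennreal_power lorentz_norm_zero)
  qed
  also have "\<dots> = ennreal (N0 * sqrt T)"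
    using T N0 by (simp add: nn_integral_cmult_indicator epowr_ennreal powr_half_sqrt real_sqrt_mult flip: ennreal_mult)
  finally have norm_F: "L2_time (lorentz_norm (lower_exp ?n) 1) F = ennreal (N0 * sqrt T)" .
  show "\<exists>F :: real \<Rightarrow> 'a \<Rightarrow> complex.
              (\<lambda>(t, x). F t x) \<in> borel_measurable (lborel \<Otimes>\<^sub>M lebesgue) \<and>
              (\<forall>t. L2 (F t)) \<and>
              (\<forall>a b. (\<integral>\<^sup>+ s\<in>{a..b}. ennreal (L2norm (F s)) \<partial>lborel) < top) \<and>
              (AE t in lborel. radial (F t)) \<and>
              L2_time (lorentz_norm (lower_exp ?n) 1) F < top \<and>
              (\<forall>G. duhamel U F G \<longrightarrow>
                 L2_time (lorentz_weak (upper_exp ?n)) G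
                   > ennreal C * L2_time (lorentz_norm (lower_exp ?n) 1) F)"
  proof (intro exI[of _ F] conjI allI impI)
    note [measurable] = L2_measurable[OF L\<psi>]
    show "(\<lambda>(t, x). F t x) \<in> borel_measurable (lborel \<Otimes>\<^sub>M lebesgue)"
      unfolding F_def by measurable
    show "L2 (F t)" for t by (rule LF)
    show "AE t in lborel. radial (F t)"
    proof (rule AE_I2)
      show "radial (F t)" for t
      proof (cases "t \<in> {0..T}")
        case True
        show ?thesis unfolding F_in[OF True] by (rule radial_gauss)
      next
        case False
        show ?thesis unfolding F_out[OF False] by (simp add: radial_def)
      qed
    qed
    show "L2_time (lorentz_norm (lower_exp ?n) 1) F < top"
      by (simp add: norm_F)
    show "(\<integral>\<^sup>+ s\<in>{a..b}. ennreal (L2norm (F s)) \<partial>lborel) < top" for a b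
    proof -
      have "(\<integral>\<^sup>+ s\<in>{a..b}. ennreal (L2norm (F s)) \<partial>lborel) \<le> (\<integral>\<^sup>+ s. ennreal (L2norm ?\<psi>) * indicator {a..b} s \<partial>lborel)"
      proof (intro nn_integral_mono mult_right_mono ennreal_leI)
        show "L2norm (F s) \<le> L2norm ?\<psi>" for s
          using F_in[of s] F_out[of s] by (cases "s \<in> {0..T}") (auto simp: L2norm_def)
      qed simp
      also have "\<dots> < top"
        by (simp add: nn_integral_cmult_indicator ennreal_mult_less_top emeasure_lborel_Icc_eq)
      finally show ?thesis .
    qed
    fix G assume G: "duhamel U F G"
    have K_le: "ennreal (K * B) \<le> lorentz_weak (upper_exp ?n) (G t)" if t: "t \<in> {T / 2..T}" for t
    proof -
      \<comment> \<open>The radius shrinks as T grows, but this is harmless: the bound in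
        \<open>lorentz_weak_lower_bound\<close> does not depend on it, by the scale invariance of
        |x|^-c in the weak space.\<close>
      define \<rho> where "\<rho> = 1 / sqrt T"
      have \<rho>: "\<rho> > 0" "\<rho>\<^sup>2 * T \<le> 1" using T by (simp_all add: \<rho>_def power_divide)
      have t': "0 < t" "t \<le> T" using t T by auto
      have "(T / 2)\<^sup>2 \<le> t\<^sup>2" using t T by (intro power_mono) auto
      then have "1 + 4 * T\<^sup>2 \<le> 1 + 16 * t\<^sup>2" by (simp add: power_divide)
      then have "ln (1 + 4 * T\<^sup>2) \<le> ln (1 + 16 * t\<^sup>2)"
        by (intro ln_mono) (auto simp: add_pos_nonneg)
      then have Kt: "K \<le> ln (1 + 16 * t\<^sup>2) / 8 - 1" unfolding K_def by simp
      have "AE x in lebesgue. norm x < \<rho> \<longrightarrow> K * norm x powr - ?c \<le> norm (G t x)"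
        using duhamel_gauss_lower_bound[OF U dim G F_T t' \<rho>]
      proof eventually_elim
        case (elim x)
        then show ?case
          using mult_right_mono[OF Kt, of "norm x powr - ?c"] by auto
      qed
      moreover have "G t \<in> borel_measurable lebesgue"
        using G L2_measurable unfolding duhamel_def by blast
      ultimately show ?thesis
        unfolding B_def using K D \<rho> by (intro lorentz_weak_lower_bound[OF dim]) auto
    qed
    \<comment> \<open>Both sides scale like sqrt(T), so the comparison is reduced to
      \<open>K\<close> > \<open>D\<close>, which the logarithm has provided.\<close>
    have "C * (N0 * sqrt T) = D * B * sqrt (T - T / 2)"
      using B T by (simp add: D_def real_sqrt_divide)
    also have "\<dots> < K * B * sqrt (T - T / 2)"
      using K B T by (intro mult_strict_right_mono) auto
    finally have "ennreal C * ennreal (N0 * sqrt T) < ennreal (K * B * sqrt (T - T / 2))"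
      using C N0 T by (simp add: ennreal_less_iff flip: ennreal_mult)
    also have "\<dots> \<le> L2_time (lorentz_weak (upper_exp ?n)) G"
      using K_le K D B T by (intro L2_time_lower_bound) auto
    finally show "ennreal C * L2_time (lorentz_norm (lower_exp ?n) 1) F < L2_time (lorentz_weak (upper_exp ?n)) G"
      by (simp add: norm_F)
  qed
qed

end
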